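(* There are absolute constants $A,B>0$ and $m_0\in\mathbb N$ such that the following hold. (1) Whenever $m\ge m_0$ is an integer, $n\in\mathbb N$, and $p\in[2m,\infty]$ satisfies \[ \beta_{m,p}:=\frac{q_{m,p}}{s_{m,p}}-1\ge\frac{B}{m}, \] every complex $m$-homogeneous polynomial $P:\mathbb C^n\to\mathbb C$ satisfies \[ \Lambda_{m,q_{m,p}}(P)\le\|P\|_p . \] (2) In particular, $\Lambda_{m,q_{m,p}}(P)\le\|P\|_p$ holds for every integer $m\ge m_0$, every $p\in[2m+A,\infty]$, every $n\in\mathbb N$ and every complex $m$-homogeneous polynomial $P:\mathbb C^n\to\mathbb C$.
   Context: For a complex $m$-homogeneous polynomial $P(z)=\sum_{|\alpha|=m}b_\alpha z^\alpha$ on $\mathbb C^n$ ($\alpha\in\mathbb N_0^n$, $|\alpha|=\sum_j\alpha_j$, $\alpha!=\prod_j\alpha_j!$) and $q\ge1$, the Bombieri $q$-norm is \[ \Lambda_{m,q}(P)=\Bigl(\sum_{|\alpha|=m}\Bigl(\frac{m!}{\alpha!}\Bigr)^{1-q}|b_\alpha|^q\Bigr)^{1/q}. \] For $2m\le p<\infty$, $q_{m,p}=\dfrac{2mp}{mp+p-2m}$ and $s_{m,p}=\dfrac{p}{p-m}$; also $q_{m,\infty}=\dfrac{2m}{m+1}$ and $s_{m,\infty}=1$. For $1\le p\le\infty$, $\|P\|_p=\sup\{|P(z)|:z\in\mathbb C^n,\ \|z\|_p\le1\}$ with $\|z\|_p$ the $\ell_p^n$ norm. "Absolute constant" means independent of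 $m,n,p,P$. *)

theory Defs
  imports Complex_Main "HOL-Library.Extended_Real"
begin

text \<open>
  The dimension \<open>n\<close> varies inside the statement, so a point of \<open>\<complex>\<^sup>n\<close> is a function
  \<^typ>\<open>nat \<Rightarrow> complex\<close> of which only the coordinates \<open>i < n\<close> are ever used. An
  \<open>m\<close>-homogeneous polynomial on \<open>\<complex>\<^sup>n\<close> is given by its coefficient family \<open>b\<close>, of which only
  the values on \<open>multi_indices n m\<close> are used.
\<close>

definition multi_indices :: "nat \<Rightarrow> nat \<Rightarrow> (nat \<Rightarrow> nat) set" where
  "multi_indices n m = {\<alpha>. (\<forall>i\<ge>n. \<alpha> i = 0) \<and> (\<Sum>i<n. \<alpha> i) = m}"

lemma finite_multi_indices: "finite (multi_indices n m)"
proof (rule finite_subset)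
  show "multi_indices n m \<subseteq>
      {\<alpha>. \<forall>i. (i \<in> {..<n} \<longrightarrow> \<alpha> i \<in> {..m}) \<and> (i \<notin> {..<n} \<longrightarrow> \<alpha> i = 0)}"
    by (auto simp: multi_indices_def intro!: member_le_sum)
  show "finite {\<alpha> :: nat \<Rightarrow> nat.
      \<forall>i. (i \<in> {..<n} \<longrightarrow> \<alpha> i \<in> {..m}) \<and> (i \<notin> {..<n} \<longrightarrow> \<alpha> i = 0)}"
    by (rule finite_set_of_finite_funs) auto
qed

definition hpoly :: "nat \<Rightarrow> nat \<Rightarrow> ((nat \<Rightarrow> nat) \<Rightarrow> complex) \<Rightarrow> (nat \<Rightarrow> complex) \<Rightarrow> complex" where
  "hpoly n m b z = (\<Sum>\<alpha>\<in>multi_indices n m. b \<alpha> * (\<Prod>i<n. z i ^ \<alpha> i))"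

definition multi_fact :: "nat \<Rightarrow> (nat \<Rightarrow> nat) \<Rightarrow> real" where
  "multi_fact n \<alpha> = (\<Prod>i<n. fact (\<alpha> i))"

definition bombieri_norm :: "nat \<Rightarrow> nat \<Rightarrow> real \<Rightarrow> ((nat \<Rightarrow> nat) \<Rightarrow> complex) \<Rightarrow> real" where
  "bombieri_norm n m q b =
     (\<Sum>\<alpha>\<in>multi_indices n m. (fact m / multi_fact n \<alpha>) powr (1 - q) * cmod (b \<alpha>) powr q)
       powr (1 / q)"

text \<open>The \<open>\<ell>\<^sub>p\<close> norm on \<open>\<complex>\<^sup>n\<close>, meant for \<open>n \<ge> 1\<close> and \<open>1 \<le> p \<le> \<infinity>\<close>.\<close>

definition lp_norm :: "nat \<Rightarrow> ereal \<Rightarrow> (nat \<Rightarrow> complex) \<Rightarrow> real" where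
  "lp_norm n p z =
     (if p = \<infinity> then Max ((\<lambda>i. cmod (z i)) ` {..<n})
      else (\<Sum>i<n. cmod (z i) powr real_of_ereal p) powr (1 / real_of_ereal p))"

text \<open>
  The supremum is taken over a nonempty set of reals, bounded above because the closed unit
  ball of \<open>lp_norm n p\<close> is bounded in the coordinates \<open>i < n\<close>.
\<close>

definition poly_norm :: "nat \<Rightarrow> nat \<Rightarrow> ereal \<Rightarrow> ((nat \<Rightarrow> nat) \<Rightarrow> complex) \<Rightarrow> real" where
  "poly_norm n m p b = Sup {cmod (hpoly n m b z) | z. lp_norm n p z \<le> 1}"

text \<open>The exponents are meant for \<open>2 * m \<le> p \<le> \<infinity>\<close> and \<open>m \<ge> 1\<close>.\<close>

definition q_exp :: "nat \<Rightarrow> ereal \<Rightarrow> real" where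
  "q_exp m p =
     (if p = \<infinity> then 2 * real m / (real m + 1)
      else 2 * real m * real_of_ereal p
             / (real m * real_of_ereal p + real_of_ereal p - 2 * real m))"

definition s_exp :: "nat \<Rightarrow> ereal \<Rightarrow> real" where
  "s_exp m p =
     (if p = \<infinity> then 1 else real_of_ereal p / (real_of_ereal p - real m))"

definition beta_exp :: "nat \<Rightarrow> ereal \<Rightarrow> real" where
  "beta_exp m p = q_exp m p / s_exp m p - 1"

end

theory Submission
  imports Defs "HOL-Analysis.Analysis"
begin

text \<open>
  Put \<open>\<kappa> = 1/p\<close> and normalise \<open>\<parallel>P\<parallel>\<^sub>p = 1\<close>. Averaging \<open>P\<close> over independent \<open>m\<close>-th roots of
  unity in each variable leaves \<open>\<Sum> b\<^sub>j z\<^sub>j\<^sup>m\<close>, so the diagonal coefficients satisfy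
  \<open>\<Sum> \<bar>b\<^sub>j\<bar>\<^sup>s \<le> 1\<close>. If the largest of them is \<open>1 - \<delta>\<close>, then, because \<open>q - s \<ge> B/m\<close>,
  they contribute at most \<open>(1 - \<delta>)\<^sup>q\<^sup>-\<^sup>s \<le> 1 - B \<delta>/m\<close> to the \<open>q\<close>-th power of the
  Bombieri norm. It remains to bound the contribution of the other coefficients by \<open>B \<delta>/m\<close>.

  A Blei-type inequality bounds it by a mixed \<open>\<ell>\<^sub>1(\<ell>\<^sub>2)\<close> sum over the partial derivatives of
  \<open>P\<close> after a rescaling \<open>z\<^sub>i \<mapsto> t\<^sub>i\<^sup>\<kappa> z\<^sub>i\<close> of the variables. The Bombieri weights
  \<open>\<alpha>!/m!\<close> are so small off the diagonal that the inner \<open>\<ell>\<^sub>2\<close> norm is at most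
  \<open>C m\<^sup>-\<^sup>1\<^sup>/\<^sup>2\<close> times an \<open>L\<^sub>1\<close> norm on the torus, by a dimension-free inequality in the spirit of
  Carleman. Finally, if \<open>z\<^sub>1\<^sup>m\<close> has coefficient \<open>1 - \<delta>\<close>, then
  \<open>1 + \<delta>/2 - Re (z\<^sub>1\<^sup>-\<^sup>m P(z))\<close> is nonnegative with mean \<open>3\<delta>/2\<close> on
  \<open>\<bar>z\<^sub>1\<bar> = 1, \<bar>z\<^sub>i\<bar> = (\<delta> t\<^sub>i)\<^sup>\<kappa>\<close>, and Caratheodory's coefficient bound controls those
  \<open>L\<^sub>1\<close> norms by \<open>\<delta>\<close>.

  All torus means are finite averages over grids of roots of unity.
\<close>

subsection \<open>Averages over grids of roots of unity\<close>

text \<open>Equality holds at the monomials z_j^m, so no constant may be lost: the off-diagonal part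
  must vanish to first order in \<delta>, and with the factor 1/m, since the gap between q and s
  saves no more than that on the diagonal. The two factors have different sources. The 1/m is the
  gain m^(-1/2) of the Carleman-type inequality, raised to a power q close to 2. The \<delta> comes
  from the L1 norms, but seeing z_1^m at full size leaves only mass \<delta> for the other
  variables, which costs \<delta>^(-m\<kappa>). What remains, \<delta>^(1-m\<kappa>), becomes
  \<delta>^(q/s) after the q-th power, hence at most \<delta> because q \<ge> s. Two obstacles shape
  the details. The derivative in the direction z_1 contains the large coefficient and is not small,
  so that direction is estimated through the homogeneous parts in the remaining variables. And at
  \<alpha> = (m-1)e_i + e_j the Bombieri weight is a factor m too large for the slot j; the weights
  \<theta> in the entropy inequality are there to absorb this factor.\<close>

definition funs_upto :: "nat \<Rightarrow> 'a set \<Rightarrow> 'a \<Rightarrow> (nat \<Rightarrow> 'a) set" where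
  "funs_upto n D c = {f. (\<forall>i<n. f i \<in> D) \<and> (\<forall>i\<ge>n. f i = c)}"

lemma funs_upto_0: "funs_upto 0 D c = {\<lambda>_. c}"
  by (auto simp: funs_upto_def)

lemma bij_betw_funs_upto_Suc:
  "bij_betw (\<lambda>(f, d). f(n := d)) (funs_upto n D c \<times> D) (funs_upto (Suc n) D c)"
proof (rule bij_betw_byWitness[where f' = "\<lambda>f. (f(n := c), f n)"])
  show "\<forall>a\<in>funs_upto n D c \<times> D. (\<lambda>f. (f(n := c), f n)) ((\<lambda>(f, d). f(n := d)) a) = a"
    by (auto simp: funs_upto_def fun_eq_iff)
  show "(\<lambda>(f, d). f(n := d)) ` (funs_upto n D c \<times> D) \<subseteq> funs_upto (Suc n) D c"
    by (auto simp: funs_upto_def less_Suc_eq)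
qed (auto simp: funs_upto_def)

lemma finite_funs_upto: "finite D \<Longrightarrow> finite (funs_upto n D c)"
proof (induction n)
  case (Suc n)
  then show ?case
    using bij_betw_finite[OF bij_betw_funs_upto_Suc, of n D c] by simp
qed (simp add: funs_upto_0)

lemma sum_funs_upto_Suc:
  assumes "finite D"
  shows "(\<Sum>f\<in>funs_upto (Suc n) D c. F f) = (\<Sum>f\<in>funs_upto n D c. \<Sum>d\<in>D. F (f(n := d)))"
proof -
  have "(\<Sum>f\<in>funs_upto (Suc n) D c. F f) = (\<Sum>(f, d)\<in>funs_upto n D c \<times> D. F (f(n := d)))"
    by (subst sum.reindex_bij_betw[OF bij_betw_funs_upto_Suc, symmetric])
       (simp add: case_prod_beta)
  then show ?thesis
    by (simp add: sum.cartesian_product)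
qed

abbreviation roots :: "nat \<Rightarrow> complex set" where
  "roots N \<equiv> {\<zeta>. \<zeta> ^ N = 1}"

lemma norm_roots: "0 < N \<Longrightarrow> \<zeta> \<in> roots N \<Longrightarrow> cmod \<zeta> = 1"
proof -
  assume N: "0 < N" and "\<zeta> \<in> roots N"
  then have "cmod \<zeta> ^ N = 1 ^ N"
    by (simp flip: norm_power)
  then show ?thesis
    using power_eq_imp_eq_base[of "cmod \<zeta>" N 1] N by simp
qed

lemma unimodular_mult_cnj: "cmod \<zeta> = 1 \<Longrightarrow> \<zeta> * cnj \<zeta> = 1"
  using complex_norm_square[of \<zeta>] by simp

definition uavg :: "nat \<Rightarrow> (complex \<Rightarrow> 'a::real_normed_field) \<Rightarrow> 'a" where
  "uavg N F = (\<Sum>\<zeta>\<in>roots N. F \<zeta>) / of_nat N"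

text \<open>Coordinates past n are frozen at 1, so every coordinate of a grid point is unimodular.
  Such means agree with torus means as soon as N exceeds all frequency differences involved.\<close>

definition tavg :: "nat \<Rightarrow> nat \<Rightarrow> ((nat \<Rightarrow> complex) \<Rightarrow> 'a::real_normed_field) \<Rightarrow> 'a" where
  "tavg N n F = (\<Sum>z\<in>funs_upto n (roots N) 1. F z) / of_nat (N ^ n)"

lemma finite_roots: "0 < N \<Longrightarrow> finite (roots N)"
  by (rule finite_roots_unity) auto

lemma tavg_0: "tavg N 0 F = F (\<lambda>_. 1)"
  by (simp add: tavg_def funs_upto_0)

lemma tavg_Suc:
  assumes "0 < N"
  shows "tavg N (Suc n) F = tavg N n (\<lambda>z. uavg N (\<lambda>\<zeta>. F (z(n := \<zeta>))))"
  by (simp add: tavg_def uavg_def sum_funs_upto_Suc[OF finite_roots[OF assms]]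
      sum_divide_distrib field_simps)

lemma uavg_const: "0 < N \<Longrightarrow> uavg N (\<lambda>_. c) = c"
  by (simp add: uavg_def card_roots_unity_eq)

lemma uavg_sum: "uavg N (\<lambda>\<zeta>. \<Sum>k\<in>A. F k \<zeta>) = (\<Sum>k\<in>A. uavg N (F k))"
  by (simp add: uavg_def sum.swap[of _ A] sum_divide_distrib)

lemma uavg_add: "uavg N (\<lambda>\<zeta>. F \<zeta> + G \<zeta>) = uavg N F + uavg N G"
  by (simp add: uavg_def sum.distrib add_divide_distrib)

lemma uavg_cmult: "uavg N (\<lambda>\<zeta>. c * F \<zeta>) = c * uavg N F"
  by (simp add: uavg_def sum_distrib_left)

lemma uavg_cong: "(\<And>\<zeta>. \<zeta> \<in> roots N \<Longrightarrow> F \<zeta> = G \<zeta>) \<Longrightarrow> uavg N F = uavg N G"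
  by (simp add: uavg_def)

lemma uavg_mono: "(\<And>\<zeta>. \<zeta> \<in> roots N \<Longrightarrow> F \<zeta> \<le> G \<zeta>) \<Longrightarrow> uavg N F \<le> (uavg N G :: real)"
  by (auto simp: uavg_def intro!: divide_right_mono sum_mono)

lemma norm_uavg_le: "norm (uavg N F) \<le> uavg N (\<lambda>\<zeta>. norm (F \<zeta>))"
  by (auto simp: uavg_def norm_divide intro!: divide_right_mono sum_norm_le)

lemma Re_uavg: "Re (uavg N F) = uavg N (\<lambda>\<zeta>. Re (F \<zeta>))"
  by (simp add: uavg_def)

lemma cnj_uavg: "cnj (uavg N F) = uavg N (\<lambda>\<zeta>. cnj (F \<zeta>))"
  by (simp add: uavg_def)

lemma tavg_const: "0 < N \<Longrightarrow> tavg N n (\<lambda>_. c) = c"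
  by (induction n) (simp_all add: tavg_0 tavg_Suc uavg_const)

lemma tavg_sum: "tavg N n (\<lambda>z. \<Sum>k\<in>A. F k z) = (\<Sum>k\<in>A. tavg N n (F k))"
  by (simp add: tavg_def sum.swap[of _ A] sum_divide_distrib)

lemma tavg_diff: "tavg N n (\<lambda>z. F z - G z) = tavg N n F - tavg N n G"
  by (simp add: tavg_def sum_subtractf diff_divide_distrib)

lemma tavg_cmult: "tavg N n (\<lambda>z. c * F z) = c * tavg N n F"
  by (simp add: tavg_def sum_distrib_left)

lemma tavg_cong:
  "(\<And>z. z \<in> funs_upto n (roots N) 1 \<Longrightarrow> F z = G z) \<Longrightarrow> tavg N n F = tavg N n G"
  by (simp add: tavg_def)

lemma tavg_mono:
  "(\<And>z. z \<in> funs_upto n (roots N) 1 \<Longrightarrow> F z \<le> G z) \<Longrightarrow> tavg N n F \<le> (tavg N n G :: real)"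
  by (auto simp: tavg_def intro!: divide_right_mono sum_mono)

lemma norm_tavg_le: "norm (tavg N n F) \<le> tavg N n (\<lambda>z. norm (F z))"
  by (auto simp: tavg_def norm_divide norm_power intro!: divide_right_mono sum_norm_le)

lemma Re_tavg: "Re (tavg N n F) = tavg N n (\<lambda>z. Re (F z))"
  by (simp add: tavg_def flip: of_nat_power)

text \<open>Congruence and not equality of exponents: for large N this is orthogonality, while for N
  = m the aliasing is wanted, since it retains the exponents divisible by m.\<close>

lemma uavg_character:
  assumes "0 < N"
  shows "uavg N (\<lambda>\<zeta>. \<zeta> ^ a * cnj \<zeta> ^ b) = (if a mod N = b mod N then 1 else 0)"
proof (cases "a mod N = b mod N")
  case True
  have "\<zeta> ^ a * cnj \<zeta> ^ b = 1" if z: "\<zeta> \<in> roots N" for \<zeta>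
  proof -
    have red: "\<zeta> ^ k = \<zeta> ^ (k mod N)" for k
      using z power_add[of \<zeta> "N * (k div N)" "k mod N"] by (simp add: power_mult)
    have "\<zeta> ^ a = \<zeta> ^ b"
      using red[of a] red[of b] True by simp
    moreover have "cmod (\<zeta> ^ b) = 1"
      using norm_roots[OF assms z] by (simp add: norm_power)
    ultimately show ?thesis
      using unimodular_mult_cnj[of "\<zeta> ^ b"] by simp
  qed
  then have "uavg N (\<lambda>\<zeta>. \<zeta> ^ a * cnj \<zeta> ^ b) = uavg N (\<lambda>_. 1 :: complex)"
    by (intro uavg_cong)
  then show ?thesis
    using True uavg_const[OF assms, of "1::complex"] by simp
next
  case False
  define w where "w = cis (2 * pi / real N)"
  define S where "S = (\<Sum>\<zeta>\<in>roots N. \<zeta> ^ a * cnj \<zeta> ^ b)"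
  have wN: "w ^ N = 1"
    unfolding w_def Complex.DeMoivre using assms by (simp add: mult.commute[of "real N"])
  have w1: "cmod w = 1"
    by (simp add: w_def)
  have inj: "inj_on (\<lambda>k. w ^ k) {..<N}"
    using bij_betw_imp_inj_on[OF Complex.bij_betw_roots_unity[OF assms]]
    by (simp add: inj_on_def w_def Complex.DeMoivre field_simps)
  have red: "w ^ k = w ^ (k mod N)" for k
    using wN power_add[of w "N * (k div N)" "k mod N"] by (simp add: power_mult)
  have ne: "w ^ a \<noteq> w ^ b"
  proof
    assume "w ^ a = w ^ b"
    then have "w ^ (a mod N) = w ^ (b mod N)"
      using red by metis
    with inj have "a mod N = b mod N"
      using assms by (auto simp: inj_on_def)
    with False show False by simp
  qed
  \<comment> \<open>Rotation by the primitive root w permutes the roots and multiplies the sum by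
    w^(a-b), which differs from 1.\<close>
  have "bij_betw (\<lambda>\<zeta>. w * \<zeta>) (roots N) (roots N)"
    by (rule bij_betw_byWitness[where f' = "\<lambda>\<zeta>. cnj w * \<zeta>"])
       (use w1 wN in \<open>auto simp: power_mult_distrib mult.assoc[symmetric] unimodular_mult_cnj
          mult.commute[of "cnj w"] simp flip: complex_cnj_power\<close>)
  then have "S = (\<Sum>\<zeta>\<in>roots N. (w * \<zeta>) ^ a * cnj (w * \<zeta>) ^ b)"
    unfolding S_def by (rule sum.reindex_bij_betw[symmetric, where g = "\<lambda>\<zeta>. \<zeta> ^ a * cnj \<zeta> ^ b"])
  also have "\<dots> = w ^ a * cnj (w ^ b) * S"
    unfolding S_def sum_distrib_left by (simp add: power_mult_distrib mult_ac)
  finally have "S * (1 - w ^ a * cnj (w ^ b)) = 0"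
    by (simp add: algebra_simps)
  moreover have "w ^ a * cnj (w ^ b) \<noteq> 1"
  proof
    assume *: "w ^ a * cnj (w ^ b) = 1"
    have "w ^ b * cnj (w ^ b) = 1"
      by (rule unimodular_mult_cnj) (simp add: norm_power w1)
    with * ne show False
      by (metis mult.commute mult.right_neutral mult.assoc)
  qed
  ultimately have "S = 0" by simp
  with False show ?thesis
    by (simp add: uavg_def S_def)
qed

definition monom_at :: "nat \<Rightarrow> (nat \<Rightarrow> complex) \<Rightarrow> (nat \<Rightarrow> nat) \<Rightarrow> complex" where
  "monom_at n z \<alpha> = (\<Prod>i<n. z i ^ \<alpha> i)"

lemma tavg_character:
  assumes "0 < N"
  shows "tavg N n (\<lambda>z. monom_at n z \<alpha> * cnj (monom_at n z \<beta>)) =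
    (if \<forall>i<n. \<alpha> i mod N = \<beta> i mod N then 1 else 0)"
proof (induction n)
  case (Suc n)
  have "tavg N (Suc n) (\<lambda>z. monom_at (Suc n) z \<alpha> * cnj (monom_at (Suc n) z \<beta>)) =
    tavg N n (\<lambda>z. monom_at n z \<alpha> * cnj (monom_at n z \<beta>) * uavg N (\<lambda>\<zeta>. \<zeta> ^ \<alpha> n * cnj \<zeta> ^ \<beta> n))"
    unfolding tavg_Suc[OF assms] uavg_cmult[symmetric]
    by (intro tavg_cong uavg_cong) (simp add: monom_at_def mult_ac)
  also have "\<dots> = (if \<alpha> n mod N = \<beta> n mod N then 1 else 0) *
      tavg N n (\<lambda>z. monom_at n z \<alpha> * cnj (monom_at n z \<beta>))"
    unfolding uavg_character[OF assms] tavg_cmult[symmetric] by (simp add: mult.commute)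
  finally show ?case
    by (simp add: Suc.IH less_Suc_eq all_conj_distrib)
qed (simp add: tavg_0 monom_at_def)

lemma norm_grid: "0 < N \<Longrightarrow> z \<in> funs_upto n (roots N) 1 \<Longrightarrow> cmod (z i) = 1"
  by (cases "i < n") (auto simp: funs_upto_def intro: norm_roots)

subsection \<open>Weighted coefficient norms and the mean modulus\<close>

lemma uavg_power_coeff:
  assumes "degree p + j < N" and "k < N"
  shows "uavg N (\<lambda>\<zeta>. \<zeta> ^ j * poly p (c * \<zeta>) * cnj \<zeta> ^ k) =
    (if j \<le> k then coeff p (k - j) * c ^ (k - j) else 0)"
proof -
  have N: "0 < N" using assms by simp
  have "uavg N (\<lambda>\<zeta>. \<zeta> ^ j * poly p (c * \<zeta>) * cnj \<zeta> ^ k) =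
    (\<Sum>i\<le>degree p. coeff p i * c ^ i * uavg N (\<lambda>\<zeta>. \<zeta> ^ (i + j) * cnj \<zeta> ^ k))"
    unfolding uavg_cmult[symmetric] uavg_sum[symmetric] poly_altdef
    by (intro uavg_cong) (simp add: sum_distrib_left sum_distrib_right power_mult_distrib power_add mult_ac)
  also have "\<dots> = (\<Sum>i\<le>degree p. if i = k - j \<and> j \<le> k then coeff p i * c ^ i else 0)"
    using assms by (intro sum.cong refl) (auto simp: uavg_character[OF N])
  also have "\<dots> = (if j \<le> k then coeff p (k - j) * c ^ (k - j) else 0)"
    by (auto simp: coeff_eq_0)
  finally show ?thesis .
qed

text \<open>The frequency k of the conjugate of p vanishes for k > 0. Hence the k-th coefficient of
  p is also that of 2 Re p, and for a nonnegative function it is bounded by the mean, which is 2 Re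
  p(0).\<close>

lemma caratheodory_coeff_le:
  fixes p :: "complex poly"
  assumes re: "\<And>\<zeta>. cmod \<zeta> = 1 \<Longrightarrow> 0 \<le> Re (poly p (of_real r * \<zeta>))"
    and k: "0 < k" and r: "0 \<le> r"
  shows "cmod (coeff p k) * r ^ k \<le> 2 * Re (coeff p 0)"
proof -
  define N where "N = degree p + k + 1"
  have N: "0 < N" by (simp add: N_def)
  let ?c = "of_real r :: complex"
  define A where "A = uavg N (\<lambda>\<zeta>. poly p (?c * \<zeta>) * cnj \<zeta> ^ k)"
  define B where "B = uavg N (\<lambda>\<zeta>. \<zeta> ^ k * poly p (?c * \<zeta>))"
  have A: "A = coeff p k * ?c ^ k"
    using uavg_power_coeff[of p 0 N k ?c] by (simp add: A_def N_def)
  have B: "B = 0"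
    using uavg_power_coeff[of p k N 0 ?c] k by (simp add: B_def N_def)
  have C: "uavg N (\<lambda>\<zeta>. poly p (?c * \<zeta>)) = coeff p 0"
    using uavg_power_coeff[of p 0 N 0 ?c] by (simp add: N_def)
  have "A = A + cnj B"
    by (simp add: B)
  also have "\<dots> = uavg N (\<lambda>\<zeta>. of_real (2 * Re (poly p (?c * \<zeta>))) * cnj \<zeta> ^ k)"
    unfolding A_def B_def cnj_uavg uavg_add[symmetric]
    by (intro uavg_cong) (simp add: complex_add_cnj[symmetric] ring_distribs mult.commute del: of_real_mult)
  also have "cmod \<dots> \<le> uavg N (\<lambda>\<zeta>. cmod (of_real (2 * Re (poly p (?c * \<zeta>))) * cnj \<zeta> ^ k))"
    by (rule norm_uavg_le)
  also have "\<dots> = uavg N (\<lambda>\<zeta>. 2 * Re (poly p (?c * \<zeta>)))"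
  proof (intro uavg_cong)
    fix \<zeta> assume "\<zeta> \<in> roots N"
    then have "cmod \<zeta> = 1" by (rule norm_roots[OF N])
    then show "cmod (of_real (2 * Re (poly p (?c * \<zeta>))) * cnj \<zeta> ^ k) = 2 * Re (poly p (?c * \<zeta>))"
      using re[of \<zeta>] by (simp add: norm_mult norm_power del: of_real_mult complex_cnj_power)
  qed
  also have "\<dots> = 2 * Re (coeff p 0)"
    unfolding uavg_cmult C[symmetric] Re_uavg by simp
  finally show ?thesis
    using r by (simp add: A norm_mult norm_power)
qed

text \<open>Testing \<open>f\<close> against \<open>\<zeta>\<^sup>a (1 + \<epsilon> (u \<zeta>\<^sup>k - cnj (u \<zeta>\<^sup>k)))\<close>, whose modulus is at most
  \<open>sqrt (1 + 4 \<epsilon>\<^sup>2)\<close>, recovers \<open>c a\<close> and \<open>c (a + k)\<close> because \<open>c (a - k)\<close> vanishes.\<close>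
lemma two_coeffs_le_uavg:
  fixes c :: "nat \<Rightarrow> complex"
  assumes N: "2 * D < N" and a: "a + k \<le> D" and k: "0 < k" and c0: "\<And>i. i < a \<Longrightarrow> c i = 0"
  defines "F \<equiv> \<lambda>\<zeta>. \<Sum>i\<le>D. c i * \<zeta> ^ i"
  shows "(cmod (c a))\<^sup>2 + (cmod (c (a + k)))\<^sup>2 / 4 \<le> (uavg N (\<lambda>\<zeta>. cmod (F \<zeta>)))\<^sup>2"
proof -
  have N0: "0 < N" using N by simp
  let ?A = "uavg N (\<lambda>\<zeta>. cmod (F \<zeta>))"
  have coef: "uavg N (\<lambda>\<zeta>. F \<zeta> * cnj \<zeta> ^ j) = c j" if "j \<le> D" for j
  proof -
    have "uavg N (\<lambda>\<zeta>. F \<zeta> * cnj \<zeta> ^ j) = (\<Sum>i\<le>D. c i * uavg N (\<lambda>\<zeta>. \<zeta> ^ i * cnj \<zeta> ^ j))"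
      unfolding uavg_cmult[symmetric] uavg_sum[symmetric] F_def
      by (intro uavg_cong) (simp add: sum_distrib_left sum_distrib_right mult_ac)
    also have "\<dots> = (\<Sum>i\<le>D. if i = j then c i else 0)"
      using that N by (intro sum.cong refl) (auto simp: uavg_character[OF N0])
    finally show ?thesis using that by simp
  qed
  \<comment> \<open>The frequency a - k of F is either negative or below a, hence absent; i + k
    \<le> 2 D < N excludes aliasing.\<close>
  have coef0: "uavg N (\<lambda>\<zeta>. F \<zeta> * (\<zeta> ^ k * cnj \<zeta> ^ a)) = 0"
  proof -
    have "uavg N (\<lambda>\<zeta>. F \<zeta> * (\<zeta> ^ k * cnj \<zeta> ^ a)) =
        (\<Sum>i\<le>D. c i * uavg N (\<lambda>\<zeta>. \<zeta> ^ (i + k) * cnj \<zeta> ^ a))"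
      unfolding uavg_cmult[symmetric] uavg_sum[symmetric] F_def
      by (intro uavg_cong) (simp add: sum_distrib_left sum_distrib_right mult_ac power_add)
    also have "\<dots> = 0"
      using a k N c0 by (intro sum.neutral ballI) (auto simp: uavg_character[OF N0])
    finally show ?thesis .
  qed
  have bound: "cmod (uavg N (\<lambda>\<zeta>. F \<zeta> * h \<zeta>)) \<le> M * ?A"
    if h: "\<And>\<zeta>. cmod \<zeta> = 1 \<Longrightarrow> cmod (h \<zeta>) \<le> M" for h M
  proof -
    have "cmod (uavg N (\<lambda>\<zeta>. F \<zeta> * h \<zeta>)) \<le> uavg N (\<lambda>\<zeta>. cmod (F \<zeta> * h \<zeta>))"
      by (rule norm_uavg_le)
    also have "\<dots> \<le> uavg N (\<lambda>\<zeta>. M * cmod (F \<zeta>))"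
    proof (intro uavg_mono)
      fix \<zeta> assume "\<zeta> \<in> roots N"
      from h[OF norm_roots[OF N0 this]] have "cmod (F \<zeta>) * cmod (h \<zeta>) \<le> cmod (F \<zeta>) * M"
        by (intro mult_left_mono) auto
      then show "cmod (F \<zeta> * h \<zeta>) \<le> M * cmod (F \<zeta>)"
        by (simp add: norm_mult mult.commute)
    qed
    finally show ?thesis by (simp add: uavg_cmult)
  qed
  define X where "X = cmod (c a)"
  define Y where "Y = cmod (c (a + k))"
  have Y: "Y \<le> ?A"
    using bound[of "\<lambda>\<zeta>. cnj \<zeta> ^ (a + k)" 1] coef[OF a] by (simp add: Y_def norm_power)
  show ?thesis
  proof (cases "X = 0")
    case True
    have "Y\<^sup>2 / 4 \<le> ?A\<^sup>2"
    proof -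
      have "Y\<^sup>2 \<le> ?A\<^sup>2" and "0 \<le> Y\<^sup>2"
        using Y by (auto intro!: power_mono simp: Y_def)
      then show ?thesis by linarith
    qed
    with True show ?thesis by (simp add: X_def Y_def)
  next
    case False
    then have X: "0 < X" by (simp add: X_def)
    \<comment> \<open>The maximiser of (X + e Y)^2 / (1 + 4 e^2), from the equality case of
      Cauchy-Schwarz; the maximum is X^2 + Y^2/4.\<close>
    define e where "e = Y / (4 * X)"
    have e: "0 \<le> e" using X by (simp add: e_def Y_def)
    obtain u where u: "cmod u = 1" "cmod (c a + of_real e * (cnj u * c (a + k))) = X + e * Y"
    proof (cases "c (a + k) = 0")
      case True
      then show ?thesis by (intro that[of 1]) (auto simp: X_def Y_def)
    next
      case F: False
      define v where "v = sgn (c a) * cnj (sgn (c (a + k)))"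
      have v: "cmod v = 1"
        using F False by (simp add: v_def norm_mult norm_sgn X_def)
      have "v * c (a + k) = sgn (c a) * of_real Y"
        unfolding v_def Y_def using F
        by (simp add: sgn_eq complex_norm_square[symmetric] mult.assoc power2_eq_square
            mult.commute[of "cnj _"] field_simps)
      moreover have "c a = sgn (c a) * of_real X"
        using False by (simp add: sgn_eq X_def)
      ultimately have "c a + of_real e * (v * c (a + k)) = sgn (c a) * of_real (X + e * Y)"
        by (metis (no_types, lifting) distrib_left mult.left_commute of_real_add of_real_mult)
      also have "cmod \<dots> = X + e * Y"
        using False X e by (simp add: norm_mult norm_sgn X_def Y_def del: of_real_add of_real_mult)
      finally show ?thesis
        using v by (intro that[of "cnj v"]) auto
    qed
    define h where "h = (\<lambda>\<zeta>. cnj \<zeta> ^ a * (1 + of_real e * (cnj u * cnj \<zeta> ^ k - u * \<zeta> ^ k)))"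
    have "cmod (h \<zeta>) \<le> sqrt (1 + 4 * e\<^sup>2)" if z: "cmod \<zeta> = 1" for \<zeta>
    proof -
      define y where "y = u * \<zeta> ^ k"
      have y: "cmod y = 1" by (simp add: y_def norm_mult norm_power u z)
      have "(Im y)\<^sup>2 \<le> 1"
        using abs_Im_le_cmod[of y] y by (simp add: abs_square_le_1)
      have "cmod (h \<zeta>) = cmod (1 + of_real e * (cnj y - y))"
        by (simp add: h_def y_def norm_mult norm_power z)
      also have "\<dots> = sqrt (1 + (e * (2 * Im y))\<^sup>2)"
        by (simp add: cmod_def power2_eq_square)
      also have "\<dots> \<le> sqrt (1 + 4 * e\<^sup>2)"
        using mult_left_mono[OF \<open>(Im y)\<^sup>2 \<le> 1\<close>, of "4 * e\<^sup>2"]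
        by (simp add: power_mult_distrib mult_ac)
      finally show ?thesis .
    qed
    from bound[OF this] have b: "cmod (uavg N (\<lambda>\<zeta>. F \<zeta> * h \<zeta>)) \<le> sqrt (1 + 4 * e\<^sup>2) * ?A" .
    have "uavg N (\<lambda>\<zeta>. F \<zeta> * h \<zeta>) = uavg N (\<lambda>\<zeta>. F \<zeta> * cnj \<zeta> ^ a) +
      (of_real e * cnj u) * uavg N (\<lambda>\<zeta>. F \<zeta> * cnj \<zeta> ^ (a + k)) +
      (- of_real e * u) * uavg N (\<lambda>\<zeta>. F \<zeta> * (\<zeta> ^ k * cnj \<zeta> ^ a))"
      unfolding uavg_cmult[symmetric] uavg_add[symmetric] h_def
      by (intro uavg_cong) (simp add: algebra_simps power_add)
    also have "\<dots> = c a + of_real e * (cnj u * c (a + k))"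
      using a by (simp add: coef coef0 mult.assoc del: complex_cnj_power)
    finally have "(X + e * Y)\<^sup>2 \<le> (sqrt (1 + 4 * e\<^sup>2) * ?A)\<^sup>2"
      using b u X e by (intro power_mono) (auto simp: Y_def)
    also have "\<dots> = (1 + 4 * e\<^sup>2) * ?A\<^sup>2"
      by (simp add: power_mult_distrib)
    finally have *: "(X + e * Y)\<^sup>2 \<le> (1 + 4 * e\<^sup>2) * ?A\<^sup>2" .
    have "X + e * Y = (1 + 4 * e\<^sup>2) * X"
      using X by (simp add: e_def field_simps power2_eq_square)
    with * have "(1 + 4 * e\<^sup>2) * ((1 + 4 * e\<^sup>2) * X\<^sup>2) \<le> (1 + 4 * e\<^sup>2) * ?A\<^sup>2"
      by (simp add: power2_eq_square mult_ac)
    then have "(1 + 4 * e\<^sup>2) * X\<^sup>2 \<le> ?A\<^sup>2"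
      by (rule mult_left_le_imp_le) (simp add: add_pos_nonneg)
    moreover have "(1 + 4 * e\<^sup>2) * X\<^sup>2 = X\<^sup>2 + Y\<^sup>2 / 4"
      using X by (simp add: e_def field_simps power2_eq_square)
    ultimately show ?thesis by (simp add: X_def Y_def)
  qed
qed

text \<open>Each coefficient after the lowest one has square at most 4 G, where G is the slack left
  by the lowest. Weights of total 1/4 fit all of them into G at once. The constant 1 is what makes
  iteration over the variables free of the dimension.\<close>

lemma weighted_coeffs_le_uavg:
  fixes c :: "nat \<Rightarrow> complex" and w :: "nat \<Rightarrow> real"
  assumes N: "2 * D < N" and a: "a \<le> D" and c0: "\<And>i. i < a \<Longrightarrow> c i = 0"
    and w0: "w 0 = 1" and w: "\<And>k. 0 \<le> w k" and ws: "(\<Sum>k=1..D. w k) \<le> 1 / 4"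
  shows "(\<Sum>i\<le>D. w (i - a) * (cmod (c i))\<^sup>2) \<le> (uavg N (\<lambda>\<zeta>. cmod (\<Sum>i\<le>D. c i * \<zeta> ^ i)))\<^sup>2"
proof -
  let ?A = "uavg N (\<lambda>\<zeta>. cmod (\<Sum>i\<le>D. c i * \<zeta> ^ i))"
  define G where "G = ?A\<^sup>2 - (cmod (c a))\<^sup>2"
  have "(\<Sum>i\<le>D. w (i - a) * (cmod (c i))\<^sup>2) = (\<Sum>i\<in>{a..D}. w (i - a) * (cmod (c i))\<^sup>2)"
    using c0 by (intro sum.mono_neutral_right) auto
  also have "\<dots> = (\<Sum>k\<in>{0..D - a}. w k * (cmod (c (a + k)))\<^sup>2)"
    using a by (intro sum.reindex_bij_witness[of _ "\<lambda>k. a + k" "\<lambda>i. i - a"]) auto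
  also have "\<dots> = (cmod (c a))\<^sup>2 + (\<Sum>k\<in>{1..D - a}. w k * (cmod (c (a + k)))\<^sup>2)"
    by (simp add: sum.atLeast_Suc_atMost w0)
  also have "(\<Sum>k\<in>{1..D - a}. w k * (cmod (c (a + k)))\<^sup>2) \<le> (\<Sum>k\<in>{1..D - a}. w k * (4 * G))"
  proof (intro sum_mono mult_left_mono w)
    fix k assume "k \<in> {1..D - a}"
    then have "a + k \<le> D" "0 < k" using a by auto
    from two_coeffs_le_uavg[where c = c, OF N this c0] show "(cmod (c (a + k)))\<^sup>2 \<le> 4 * G"
      by (simp add: G_def)
  qed
  also have "\<dots> = 4 * G * (\<Sum>k\<in>{1..D - a}. w k)"
    by (simp add: sum_distrib_left mult_ac)
  also have "\<dots> \<le> G"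
  proof -
    have "cmod (c a) = cmod (uavg N (\<lambda>\<zeta>. (\<Sum>i\<le>D. c i * \<zeta> ^ i) * cnj \<zeta> ^ a))"
    proof -
      have "uavg N (\<lambda>\<zeta>. (\<Sum>i\<le>D. c i * \<zeta> ^ i) * cnj \<zeta> ^ a) =
          (\<Sum>i\<le>D. c i * uavg N (\<lambda>\<zeta>. \<zeta> ^ i * cnj \<zeta> ^ a))"
        unfolding uavg_cmult[symmetric] uavg_sum[symmetric]
        by (intro uavg_cong) (simp add: sum_distrib_left sum_distrib_right mult_ac)
      also have "\<dots> = (\<Sum>i\<le>D. if i = a then c i else 0)"
        using a N by (intro sum.cong refl) (auto simp: uavg_character)
      finally show ?thesis using a by simp
    qed
    also have "\<dots> \<le> uavg N (\<lambda>\<zeta>. cmod ((\<Sum>i\<le>D. c i * \<zeta> ^ i) * cnj \<zeta> ^ a))"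
      by (rule norm_uavg_le)
    also have "\<dots> = ?A"
      using norm_roots[of N] N by (intro uavg_cong) (simp add: norm_mult norm_power)
    finally have G: "0 \<le> G"
      by (simp add: G_def power_mono)
    have "(\<Sum>k\<in>{1..D - a}. w k) \<le> (\<Sum>k=1..D. w k)"
      by (intro sum_mono2) (auto simp: w)
    with ws have "(\<Sum>k\<in>{1..D - a}. w k) \<le> 1 / 4" by simp
    from mult_left_mono[OF this, of "4 * G"] G show ?thesis by simp
  qed
  finally show ?thesis by (simp add: G_def)
qed

section \<open>Minkowski's inequality and iteration over the variables\<close>

lemma L2_set_sum_le:
  "finite A \<Longrightarrow> L2_set (\<lambda>k. \<Sum>z\<in>A. g z k) K \<le> (\<Sum>z\<in>A. L2_set (g z) K)"
proof (induction A rule: finite_induct)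
  case (insert x A)
  then show ?case
    using L2_set_triangle_ineq[of "g x" "\<lambda>k. \<Sum>z\<in>A. g z k" K] by simp
qed (simp add: L2_set_def)

lemma L2_set_tavg_le:
  assumes "0 < N" "finite K"
  shows "L2_set (\<lambda>k. tavg N n (g k)) K \<le> tavg N n (\<lambda>z. L2_set (\<lambda>k. g k z) K)"
proof -
  let ?A = "funs_upto n (roots N) 1"
  have "L2_set (\<lambda>k. tavg N n (g k)) K = L2_set (\<lambda>k. (\<Sum>z\<in>?A. g k z) * (1 / of_nat (N ^ n))) K"
    by (simp add: tavg_def)
  also have "\<dots> = L2_set (\<lambda>k. \<Sum>z\<in>?A. g k z) K * (1 / of_nat (N ^ n))"
    by (rule L2_set_left_distrib[symmetric]) simp
  also have "\<dots> \<le> (\<Sum>z\<in>?A. L2_set (\<lambda>k. g k z) K) * (1 / of_nat (N ^ n))"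
    using L2_set_sum_le[OF finite_funs_upto[OF finite_roots[OF assms(1)]]]
    by (intro mult_right_mono) auto
  finally show ?thesis by (simp add: tavg_def)
qed

definition exponent_box :: "nat \<Rightarrow> nat \<Rightarrow> (nat \<Rightarrow> nat) set" where
  "exponent_box n D = funs_upto n {..D} 0"

text \<open>For a fixed last exponent the induction hypothesis treats the first n variables.
  Minkowski's inequality then moves the l2 norm over the last exponent inside the L1 mean, where the
  one-variable inequality applies pointwise.\<close>

lemma weighted_coeffs_le_tavg:
  fixes b :: "(nat \<Rightarrow> nat) \<Rightarrow> complex" and w :: "nat \<Rightarrow> real"
  assumes N: "2 * D < N" and a: "\<And>i. a i \<le> D"
    and w0: "w 0 = 1" and w: "\<And>k. 0 \<le> w k" and ws: "(\<Sum>k=1..D. w k) \<le> 1 / 4"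
    and b: "\<And>\<alpha> i. \<alpha> \<in> exponent_box n D \<Longrightarrow> i < n \<Longrightarrow> \<alpha> i < a i \<Longrightarrow> b \<alpha> = 0"
  shows "(\<Sum>\<alpha>\<in>exponent_box n D. (\<Prod>i<n. w (\<alpha> i - a i)) * (cmod (b \<alpha>))\<^sup>2) \<le>
    (tavg N n (\<lambda>z. cmod (\<Sum>\<alpha>\<in>exponent_box n D. b \<alpha> * monom_at n z \<alpha>)))\<^sup>2"
  using b
proof (induction n arbitrary: b)
  case 0
  then show ?case by (simp add: exponent_box_def funs_upto_0 tavg_0 monom_at_def)
next
  case (Suc n)
  have N0: "0 < N" using N by simp
  let ?g = "\<lambda>k z. cmod (\<Sum>\<alpha>\<in>exponent_box n D. b (\<alpha>(n := k)) * monom_at n z \<alpha>)"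
  have "(\<Sum>\<alpha>\<in>exponent_box (Suc n) D. (\<Prod>i<Suc n. w (\<alpha> i - a i)) * (cmod (b \<alpha>))\<^sup>2) =
    (\<Sum>k\<le>D. w (k - a n) * (\<Sum>\<alpha>\<in>exponent_box n D. (\<Prod>i<n. w (\<alpha> i - a i)) * (cmod (b (\<alpha>(n := k))))\<^sup>2))"
    by (simp add: exponent_box_def sum_funs_upto_Suc sum.swap[of _ "{..D}"] sum_distrib_left mult_ac)
  also have "\<dots> \<le> (\<Sum>k\<le>D. w (k - a n) * (tavg N n (?g k))\<^sup>2)"
  proof (intro sum_mono mult_left_mono w Suc.IH)
    fix k \<alpha> i assume "k \<in> {..D}" "\<alpha> \<in> exponent_box n D" "i < n" "\<alpha> i < a i"
    then show "b (\<alpha>(n := k)) = 0"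
      by (intro Suc.prems[of "\<alpha>(n := k)" i]) (auto simp: exponent_box_def funs_upto_def less_Suc_eq)
  qed
  also have "\<dots> = (L2_set (\<lambda>k. tavg N n (\<lambda>z. sqrt (w (k - a n)) * ?g k z)) {..D})\<^sup>2"
    by (simp add: L2_set_def tavg_cmult power_mult_distrib w sum_nonneg)
  also have "\<dots> \<le> (tavg N n (\<lambda>z. L2_set (\<lambda>k. sqrt (w (k - a n)) * ?g k z) {..D}))\<^sup>2"
    by (intro power_mono L2_set_tavg_le N0) auto
  also have "\<dots> \<le> (tavg N (Suc n) (\<lambda>z. cmod (\<Sum>\<alpha>\<in>exponent_box (Suc n) D. b \<alpha> * monom_at (Suc n) z \<alpha>)))\<^sup>2"
  proof (intro power_mono)
    let ?B = "\<lambda>z. uavg N (\<lambda>\<zeta>. cmod (\<Sum>k\<le>D. (\<Sum>\<alpha>\<in>exponent_box n D. b (\<alpha>(n := k)) * monom_at n z \<alpha>) * \<zeta> ^ k))"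
    have "tavg N n (\<lambda>z. L2_set (\<lambda>k. sqrt (w (k - a n)) * ?g k z) {..D}) \<le> tavg N n ?B"
    proof (rule tavg_mono)
      fix z
      have "(\<Sum>k\<le>D. w (k - a n) * (?g k z)\<^sup>2) \<le> (?B z)\<^sup>2"
      proof (rule weighted_coeffs_le_uavg[OF N a _ w0 w ws])
        fix k assume "k < a n"
        moreover from this have "k \<le> D" using a[of n] by simp
        ultimately have "b (\<alpha>(n := k)) = 0" if "\<alpha> \<in> exponent_box n D" for \<alpha>
          using that by (intro Suc.prems[of "\<alpha>(n := k)" n])
            (auto simp: exponent_box_def funs_upto_def less_Suc_eq)
        then show "(\<Sum>\<alpha>\<in>exponent_box n D. b (\<alpha>(n := k)) * monom_at n z \<alpha>) = 0"
          by (intro sum.neutral) simp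
      qed
      moreover have "0 \<le> ?B z"
        by (simp add: uavg_def sum_nonneg)
      ultimately show "L2_set (\<lambda>k. sqrt (w (k - a n)) * ?g k z) {..D} \<le> ?B z"
        unfolding L2_set_def by (intro real_le_lsqrt) (simp_all add: power_mult_distrib w sum_nonneg)
    qed
    also have "tavg N n ?B = tavg N (Suc n) (\<lambda>z. cmod (\<Sum>\<alpha>\<in>exponent_box (Suc n) D. b \<alpha> * monom_at (Suc n) z \<alpha>))"
      unfolding tavg_Suc[OF N0]
    proof (intro tavg_cong uavg_cong arg_cong[where f = cmod])
      fix z \<zeta>
      show "(\<Sum>k\<le>D. (\<Sum>\<alpha>\<in>exponent_box n D. b (\<alpha>(n := k)) * monom_at n z \<alpha>) * \<zeta> ^ k) =
          (\<Sum>\<alpha>\<in>exponent_box (Suc n) D. b \<alpha> * monom_at (Suc n) (z(n := \<zeta>)) \<alpha>)"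
        by (simp add: exponent_box_def sum_funs_upto_Suc sum.swap[of _ "{..D}"] sum_distrib_right
            monom_at_def mult.assoc)
    qed
    finally show "tavg N n (\<lambda>z. L2_set (\<lambda>k. sqrt (w (k - a n)) * ?g k z) {..D}) \<le>
        tavg N (Suc n) (\<lambda>z. cmod (\<Sum>\<alpha>\<in>exponent_box (Suc n) D. b \<alpha> * monom_at (Suc n) z \<alpha>))" .
    show "0 \<le> tavg N n (\<lambda>z. L2_set (\<lambda>k. sqrt (w (k - a n)) * ?g k z) {..D})"
      by (simp add: tavg_def sum_nonneg)
  qed
  finally show ?case .
qed

text \<open>Parseval's identity on the grid: as D < N, distinct exponents of the box stay distinct
  modulo N.\<close>

lemma tavg_bessel:
  fixes b :: "(nat \<Rightarrow> nat) \<Rightarrow> complex"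
  assumes N: "D < N" and I: "I \<subseteq> exponent_box n D"
  shows "tavg N n (\<lambda>z. (cmod (\<Sum>\<alpha>\<in>I. b \<alpha> * monom_at n z \<alpha>))\<^sup>2) = (\<Sum>\<alpha>\<in>I. (cmod (b \<alpha>))\<^sup>2)"
proof -
  have N0: "0 < N" using N by simp
  have fin: "finite I"
    using finite_subset[OF I] finite_funs_upto[of "{..D}" n 0] by (simp add: exponent_box_def)
  have orth: "tavg N n (\<lambda>z. monom_at n z \<alpha> * cnj (monom_at n z \<beta>)) = (if \<alpha> = \<beta> then 1 else 0)"
    if "\<alpha> \<in> I" "\<beta> \<in> I" for \<alpha> \<beta>
  proof -
    have "\<alpha> = \<beta>" if "\<forall>i<n. \<alpha> i mod N = \<beta> i mod N"
    proof
      fix i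
      have "\<alpha> \<in> exponent_box n D" "\<beta> \<in> exponent_box n D"
        using I \<open>\<alpha> \<in> I\<close> \<open>\<beta> \<in> I\<close> by auto
      then show "\<alpha> i = \<beta> i"
        using that N by (cases "i < n") (auto simp: exponent_box_def funs_upto_def, metis le_less_trans mod_less)
    qed
    then show ?thesis by (auto simp: tavg_character[OF N0])
  qed
  have "complex_of_real (tavg N n (\<lambda>z. (cmod (\<Sum>\<alpha>\<in>I. b \<alpha> * monom_at n z \<alpha>))\<^sup>2)) =
    tavg N n (\<lambda>z. complex_of_real ((cmod (\<Sum>\<alpha>\<in>I. b \<alpha> * monom_at n z \<alpha>))\<^sup>2))"
    by (simp add: tavg_def)
  also have "\<dots> = tavg N n (\<lambda>z. \<Sum>\<alpha>\<in>I. \<Sum>\<beta>\<in>I. (b \<alpha> * cnj (b \<beta>)) * (monom_at n z \<alpha> * cnj (monom_at n z \<beta>)))"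
    unfolding complex_norm_square by (simp add: sum_product mult_ac)
  also have "\<dots> = (\<Sum>\<alpha>\<in>I. \<Sum>\<beta>\<in>I. (b \<alpha> * cnj (b \<beta>)) * (if \<alpha> = \<beta> then 1 else 0))"
    unfolding tavg_sum tavg_cmult by (intro sum.cong refl) (simp add: orth)
  also have "\<dots> = (\<Sum>\<alpha>\<in>I. b \<alpha> * cnj (b \<alpha>))"
    using fin by (simp add: if_distrib[of "\<lambda>x. _ * x"] cong: if_cong)
  also have "\<dots> = complex_of_real (\<Sum>\<alpha>\<in>I. (cmod (b \<alpha>))\<^sup>2)"
    by (simp only: of_real_sum complex_norm_square)
  finally show ?thesis
    using of_real_eq_iff by blast
qed

subsection \<open>The weights of the Bombieri norm\<close>

text \<open>Absorbing a into the binomial coefficient and using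
  \<open>(s + a - 1) choose (a - 1)\<close> \<ge> 2^(a-1) reduces the claim to a (36/25)^a \<le> 3 *
  2^a. As 2 = (36/25)(25/18), this is Bernoulli's inequality for 25/18. The constant is 264 = 44 *
  6.\<close>

lemma binomial_growth:
  assumes "1 \<le> a" "a \<le> s"
  shows "44 * (36/25) ^ a * real (s + a) \<le> 264 * real ((s + a) choose a)"
proof -
  obtain a' where a': "a = Suc a'"
    using assms by (cases a) auto
  have "2 ^ a' \<le> real ((s + a') choose a')"
  proof (cases "a' = 0")
    case False
    then have "(2::real) ^ a' \<le> (real (s + a') / real a') ^ a'"
      using assms a' by (intro power_mono) (auto simp: field_simps)
    also have "\<dots> \<le> real ((s + a') choose a')"
      by (rule binomial_ge_n_over_k_pow_k) simp
    finally show ?thesis .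
  qed simp
  then have "real (s + a) * 2 ^ a' \<le> real (s + a) * real ((s + a') choose a')"
    by (intro mult_left_mono) auto
  also have "\<dots> = real a * real ((s + a) choose a)"
    using Suc_times_binomial[of a' "s + a'"] a' by (metis add_Suc_right of_nat_mult)
  finally have 1: "real (s + a) * 2 ^ a \<le> 2 * (real a * real ((s + a) choose a))"
    by (simp add: a')
  have "1 + real a * (7/18) \<le> (1 + 7/18 :: real) ^ a"
    by (rule Bernoulli_inequality) simp
  then have "real a \<le> 3 * (25/18) ^ a"
    by simp
  then have "real a * (36/25) ^ a \<le> 3 * (25/18) ^ a * (36/25) ^ a"
    by (intro mult_right_mono) auto
  also have "\<dots> = 3 * 2 ^ a"
    by (simp add: power_mult_distrib[symmetric])
  finally have 2: "real a * (36/25) ^ a \<le> 3 * 2 ^ a" .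
  have "real a * (44 * (36/25) ^ a * real (s + a)) = 44 * real (s + a) * (real a * (36/25) ^ a)"
    by simp
  also have "\<dots> \<le> 44 * real (s + a) * (3 * 2 ^ a)"
    using 2 by (intro mult_left_mono) auto
  also have "\<dots> = 132 * (real (s + a) * 2 ^ a)"
    by simp
  also have "\<dots> \<le> 132 * (2 * (real a * real ((s + a) choose a)))"
    by (intro mult_left_mono 1) simp
  also have "\<dots> = real a * (264 * real ((s + a) choose a))"
    by simp
  finally show ?thesis
    using assms by (simp add: mult_le_cancel_left)
qed

text \<open>\<open>fact a\<close> divided by 1/44 and by two copies of (5/6)^a. One copy, with the
  1/44, is compensated by \<open>coeff_wt\<close> at the same coordinate; the other is saved for the
  coordinate of largest exponent.\<close>

definition fact_wt :: "nat \<Rightarrow> real" where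
  "fact_wt a = (if a = 0 then 1 else 44 * (36/25) ^ a * fact a)"

lemma fact_wt_pos: "0 < fact_wt a"
  by (simp add: fact_wt_def)

text \<open>Adding one coordinate \<open>a \<le> s\<close> multiplies the multinomial coefficient by
  \<open>(s + a) choose a\<close>; once \<open>s \<ge> 264\<close> this pays for the factor \<open>44 (36/25)\<^sup>a\<close> and for the
  increase of \<open>s\<close>, and the earlier steps cost a bounded power of \<open>264\<close>.\<close>
lemma fact_prod_fact_wt_le:
  fixes \<gamma> :: "'i \<Rightarrow> nat" and K :: nat
  assumes "finite A" and "\<And>i. i \<in> A \<Longrightarrow> \<gamma> i \<le> l" and l: "1 \<le> l" and K: "264 \<le> K"
    and "0 < (\<Sum>i\<in>A. \<gamma> i)"
  shows "fact l * (\<Prod>i\<in>A. fact_wt (\<gamma> i)) * real (l + (\<Sum>i\<in>A. \<gamma> i)) \<le>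
    fact (l + (\<Sum>i\<in>A. \<gamma> i)) * real K ^ (1 + min (l + (\<Sum>i\<in>A. \<gamma> i)) K)"
  using assms(1,2,5)
proof (induction A rule: finite_induct)
  case empty
  then show ?case by simp
next
  case (insert x A)
  define s where "s = l + (\<Sum>i\<in>A. \<gamma> i)"
  define a where "a = \<gamma> x"
  define X where "X = fact l * (\<Prod>i\<in>A. fact_wt (\<gamma> i))"
  have X: "0 < X"
    by (auto simp: X_def intro!: mult_pos_pos prod_pos fact_wt_pos)
  have sum: "l + (\<Sum>i\<in>insert x A. \<gamma> i) = s + a"
    using insert by (simp add: s_def a_def)
  have prod: "fact l * (\<Prod>i\<in>insert x A. fact_wt (\<gamma> i)) = X * fact_wt a"
    using insert by (simp add: X_def a_def)
  have a: "a \<le> s" and s: "1 \<le> s"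
    using insert.prems(1)[of x] l by (auto simp: s_def a_def)
  have "X * fact_wt a * real (s + a) \<le> fact (s + a) * real K ^ (1 + min (s + a) K)"
  proof (cases "a = 0")
    case True
    with insert.IH insert.prems insert.hyps show ?thesis
      by (simp add: fact_wt_def X_def s_def a_def)
  next
    case False
    have "fact_wt a * real (s + a) = fact a * (44 * (36/25) ^ a * real (s + a))"
      using False by (simp add: fact_wt_def)
    also have "\<dots> \<le> fact a * (real K * real ((s + a) choose a))"
    proof (intro mult_left_mono)
      have "44 * (36/25) ^ a * real (s + a) \<le> 264 * real ((s + a) choose a)"
        using False a by (intro binomial_growth) auto
      also have "\<dots> \<le> real K * real ((s + a) choose a)"
        using K by (intro mult_right_mono) auto
      finally show "44 * (36/25) ^ a * real (s + a) \<le> real K * real ((s + a) choose a)" .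
    qed auto
    finally have "fact s * (fact_wt a * real (s + a)) \<le>
        fact s * (fact a * (real K * real ((s + a) choose a)))"
      by (intro mult_left_mono) auto
    also have "\<dots> = real K * fact (s + a)"
    proof -
      have "fact a * fact s * real ((s + a) choose a) = fact (s + a)"
        using binomial_fact_lemma[of a "s + a"]
        by (metis add_diff_cancel_right' le_add2 of_nat_fact of_nat_mult)
      then show ?thesis by (simp add: mult_ac)
    qed
    finally have step: "fact s * (fact_wt a * real (s + a)) \<le> real K * fact (s + a)" .
    show ?thesis
    proof (cases "(\<Sum>i\<in>A. \<gamma> i) = 0")
      case True
      then have "X = fact s"
        using insert.hyps by (simp add: X_def s_def fact_wt_def)
      then have "X * fact_wt a * real (s + a) \<le> real K * fact (s + a)"
        using step by (simp add: mult_ac)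
      also have "\<dots> \<le> real K * fact (s + a) * real K ^ min (s + a) K"
        using one_le_power[of "real K" "min (s + a) K"] K
          mult_left_mono[of 1 "real K ^ min (s + a) K" "real K * fact (s + a)"] by simp
      finally show ?thesis by (simp add: mult_ac)
    next
      case F: False
      then have IH: "X * real s \<le> fact s * real K ^ (1 + min s K)"
        using insert.IH insert.prems(1) unfolding X_def s_def by auto
      have "real s * (X * fact_wt a * real (s + a)) = X * real s * (fact_wt a * real (s + a))"
        by simp
      also have "\<dots> \<le> fact s * real K ^ (1 + min s K) * (fact_wt a * real (s + a))"
        using IH fact_wt_pos[of a] by (intro mult_right_mono) auto
      also have "\<dots> = real K ^ (1 + min s K) * (fact s * (fact_wt a * real (s + a)))"
        by simp
      also have "\<dots> \<le> real K ^ (1 + min s K) * (real K * fact (s + a))"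
        by (intro mult_left_mono step) auto
      also have "\<dots> = real K * real K ^ (1 + min s K) * fact (s + a)"
        by simp
      also have "\<dots> \<le> real s * real K ^ (1 + min (s + a) K) * fact (s + a)"
      proof (intro mult_right_mono)
        \<comment> \<open>For s \<ge> K the exponent is saturated and the factor s itself pays for
          K. For s < K the exponent grows by at least one because a \<ge> 1.\<close>
        show "real K * real K ^ (1 + min s K) \<le> real s * real K ^ (1 + min (s + a) K)"
        proof (cases "K \<le> s")
          case True
          then show ?thesis by (auto simp: min_def intro!: mult_right_mono)
        next
          case K': False
          have "real K * real K ^ (1 + min s K) = real K ^ (2 + s)"
            using K' by simp
          also have "\<dots> \<le> real K ^ (1 + min (s + a) K)"
            using K K' False by (intro power_increasing) auto
          also have "\<dots> \<le> real s * real K ^ (1 + min (s + a) K)"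
            using s mult_right_mono[of 1 "real s" "real K ^ (1 + min (s + a) K)"] by simp
          finally show ?thesis .
        qed
      qed auto
      finally have "real s * (X * fact_wt a * real (s + a)) \<le>
          real s * (fact (s + a) * real K ^ (1 + min (s + a) K))"
        by (simp add: mult_ac)
      then show ?thesis
        using s by (simp add: mult_le_cancel_left)
    qed
  qed
  then show ?case
    unfolding sum prod .
qed

text \<open>These weights sum to at most \<open>1/4\<close>, decay slowly at both ends of \<open>{0..m}\<close>, and are
  bounded below at \<open>k = m - 1\<close>: a coordinate holding nearly the whole degree is charged only
  for the degree that it misses.\<close>
definition coeff_wt :: "nat \<Rightarrow> nat \<Rightarrow> real" where
  "coeff_wt m k = (if k = 0 then 1 else ((5/6) ^ k + (5/6) ^ (m - k)) / 44)"

lemma coeff_wt_pos: "0 < coeff_wt m k"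
  by (auto simp: coeff_wt_def intro!: add_pos_pos)

text \<open>The two geometric series are at most 5 and 6, whence 44 = 4 (5 + 6).\<close>

lemma sum_coeff_wt_le: "(\<Sum>k=1..m. coeff_wt m k) \<le> 1 / 4"
proof -
  have geo: "(\<Sum>k<m. (5/6 :: real) ^ k) \<le> 6"
    by (simp add: sum_gp_strict)
  have 1: "(\<Sum>k=1..m. (5/6 :: real) ^ k) = 5/6 * (\<Sum>k<m. (5/6 :: real) ^ k)"
    unfolding sum_distrib_left
    by (rule sum.reindex_bij_witness[of _ Suc "\<lambda>k. k - 1"]) (auto simp: power_eq_if)
  have 2: "(\<Sum>k=1..m. (5/6 :: real) ^ (m - k)) = (\<Sum>k<m. (5/6 :: real) ^ k)"
    by (rule sum.reindex_bij_witness[of _ "\<lambda>k. m - k" "\<lambda>k. m - k"]) auto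
  have "(\<Sum>k=1..m. coeff_wt m k) =
      ((\<Sum>k=1..m. (5/6) ^ k) + (\<Sum>k=1..m. (5/6) ^ (m - k))) / 44"
    unfolding sum.distrib[symmetric] sum_divide_distrib by (intro sum.cong) (auto simp: coeff_wt_def)
  then show ?thesis
    using geo unfolding 1 2 by simp
qed

text \<open>Every coordinate but the largest is charged \<open>fact_wt\<close>; the spare powers of
  5/6 multiply to the degree missing from the largest one, which is what its weight asks for. The
  factor \<open>real d\<close> on the left is the gain of order m.\<close>

lemma multi_fact_le_coeff_wt:
  assumes sum: "(\<Sum>i<n. \<gamma> i) = d" and i0: "i0 < n" and max: "\<And>i. i < n \<Longrightarrow> \<gamma> i \<le> \<gamma> i0"
    and less: "\<gamma> i0 < d" and K: "264 \<le> K"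
  shows "multi_fact n \<gamma> * real d \<le>
    53 * real K ^ (1 + K) * (fact d * (\<Prod>i<n. coeff_wt (Suc d) (\<gamma> i)))"
proof -
  define A where "A = {..<n} - {i0}"
  define l where "l = \<gamma> i0"
  have A: "finite A" "{..<n} = insert i0 A" "i0 \<notin> A"
    using i0 by (auto simp: A_def)
  have d: "d = l + (\<Sum>i\<in>A. \<gamma> i)"
    using sum A by (simp add: l_def)
  have l: "1 \<le> l"
  proof (rule ccontr)
    assume "\<not> 1 \<le> l"
    then have "\<gamma> i = 0" if "i < n" for i
      using max[OF that] by (simp add: l_def)
    with sum less show False by simp
  qed
  have pos: "0 < (\<Sum>i\<in>A. \<gamma> i)"
    using less d by (simp add: l_def)
  have "multi_fact n \<gamma> * real d = fact l * (\<Prod>i\<in>A. fact (\<gamma> i)) * real d"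
    using A by (simp add: multi_fact_def l_def)
  also have "\<dots> \<le> fact l * (\<Prod>i\<in>A. fact_wt (\<gamma> i) * coeff_wt (Suc d) (\<gamma> i) * (5/6) ^ \<gamma> i) * real d"
  proof -
    have "fact (\<gamma> i) \<le> fact_wt (\<gamma> i) * coeff_wt (Suc d) (\<gamma> i) * (5/6) ^ \<gamma> i" for i
    proof (cases "\<gamma> i = 0")
      case False
      have "fact (\<gamma> i) = fact_wt (\<gamma> i) * ((5/6) ^ \<gamma> i / 44) * (5/6) ^ \<gamma> i"
        using False by (simp add: fact_wt_def power_mult_distrib[symmetric])
      also have "\<dots> \<le> fact_wt (\<gamma> i) * coeff_wt (Suc d) (\<gamma> i) * (5/6) ^ \<gamma> i"
        using False fact_wt_pos[of "\<gamma> i"]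
        by (intro mult_right_mono mult_left_mono) (auto simp: coeff_wt_def)
      finally show ?thesis .
    qed (simp add: fact_wt_def coeff_wt_def)
    then show ?thesis
      by (intro mult_right_mono mult_left_mono prod_mono) auto
  qed
  also have "\<dots> = (fact l * (\<Prod>i\<in>A. fact_wt (\<gamma> i)) * real d) *
      ((\<Prod>i\<in>A. coeff_wt (Suc d) (\<gamma> i)) * (5/6) ^ (\<Sum>i\<in>A. \<gamma> i))"
    by (simp add: prod.distrib power_sum mult_ac)
  also have "\<dots> \<le> (fact d * real K ^ (1 + K)) *
      ((\<Prod>i\<in>A. coeff_wt (Suc d) (\<gamma> i)) * (53 * coeff_wt (Suc d) l))"
  proof (rule mult_mono)
    have "fact l * (\<Prod>i\<in>A. fact_wt (\<gamma> i)) * real d \<le> fact d * real K ^ (1 + min d K)"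
      unfolding d using A max l_def by (intro fact_prod_fact_wt_le l K pos) auto
    also have "\<dots> \<le> fact d * real K ^ (1 + K)"
      using K by (intro mult_left_mono power_increasing) auto
    finally show "fact l * (\<Prod>i\<in>A. fact_wt (\<gamma> i)) * real d \<le> fact d * real K ^ (1 + K)" .
    \<comment> \<open>Off by one: \<gamma> has degree d, the weight belongs to degree d + 1. The
      extra factor 5/6 is why 53 \<ge> 44 * 6/5 appears.\<close>
    have "Suc d - l = Suc (\<Sum>i\<in>A. \<gamma> i)"
      by (simp add: d)
    then have "(5/6) ^ (\<Sum>i\<in>A. \<gamma> i) \<le> 53 * coeff_wt (Suc d) l"
      using l by (simp add: coeff_wt_def add_increasing)
    then show "(\<Prod>i\<in>A. coeff_wt (Suc d) (\<gamma> i)) * (5/6) ^ (\<Sum>i\<in>A. \<gamma> i) \<le>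
        (\<Prod>i\<in>A. coeff_wt (Suc d) (\<gamma> i)) * (53 * coeff_wt (Suc d) l)"
      by (intro mult_left_mono prod_nonneg) (auto simp: less_imp_le[OF coeff_wt_pos])
  qed (auto intro!: prod_nonneg mult_nonneg_nonneg less_imp_le[OF coeff_wt_pos])
  also have "\<dots> = 53 * real K ^ (1 + K) * (fact d * (\<Prod>i<n. coeff_wt (Suc d) (\<gamma> i)))"
    using A by (simp add: l_def mult_ac)
  finally show ?thesis .
qed

text \<open>The only pairs for which the \<open>L\<^sub>1\<close> bound fails to gain the factor \<open>1/m\<close> are the single
  \<open>j\<close> in \<open>\<alpha> = (m-1) e\<^sub>i + e\<^sub>j\<close>. Such a \<open>j\<close> fills one slot in \<open>m\<close>, so weighting it by
  \<open>1/m\<close> changes a geometric mean over the slots by a bounded factor only.\<close>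
definition slot_wt :: "nat \<Rightarrow> nat \<Rightarrow> nat \<Rightarrow> (nat \<Rightarrow> nat) \<Rightarrow> real" where
  "slot_wt n m j \<alpha> = (if \<exists>i<n. i \<noteq> j \<and> \<alpha> i = m - 1 then 1 / real m else 1)"

definition unit_index :: "nat \<Rightarrow> nat \<Rightarrow> nat" where
  "unit_index j i = (if i = j then 1 else 0)"

text \<open>Removing one slot j from \<alpha> leaves \<gamma> of degree m - 1. If \<gamma> meets
  several coordinates, the preceding estimate gains the factor m. If \<gamma> = (m-1) e_i, then i
  \<noteq> j because \<alpha> is off the diagonal, and \<open>slot_wt\<close> supplies the gain. The
  square of \<alpha>_j/m on the right matches the squared coefficients of a derivative in
  z_j.\<close>

lemma slot_wt_multi_fact_le:
  assumes K: "264 \<le> K" and m: "2 \<le> m" and \<alpha>: "\<alpha> \<in> multi_indices n m"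
    and off: "\<And>i. i < n \<Longrightarrow> \<alpha> i < m" and j: "j < n" "1 \<le> \<alpha> j"
  shows "slot_wt n m j \<alpha> * (multi_fact n \<alpha> / fact m) * (real (\<alpha> j) / real m) \<le>
    106 * real K ^ (1 + K) / real m *
      ((real (\<alpha> j) / real m)\<^sup>2 * (\<Prod>i<n. coeff_wt m (\<alpha> i - unit_index j i)))"
proof -
  define \<gamma> where "\<gamma> = (\<lambda>i. \<alpha> i - unit_index j i)"
  define d where "d = m - 1"
  define L where "L = 106 * real K ^ (1 + K)"
  define P where "P = (\<Prod>i<n. coeff_wt m (\<gamma> i))"
  have m_eq: "m = Suc d" and d: "1 \<le> d"
    using m by (auto simp: d_def)
  have mf: "multi_fact n \<alpha> = real (\<alpha> j) * multi_fact n \<gamma>"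
  proof -
    have "multi_fact n \<alpha> = fact (\<alpha> j) * (\<Prod>i\<in>{..<n} - {j}. fact (\<alpha> i))"
      unfolding multi_fact_def using j by (simp add: prod.remove[of _ j])
    also have "fact (\<alpha> j) = real (\<alpha> j) * fact (\<gamma> j)"
      using j by (simp add: \<gamma>_def unit_index_def fact_reduce)
    also have "(\<Prod>i\<in>{..<n} - {j}. fact (\<alpha> i)) = (\<Prod>i\<in>{..<n} - {j}. fact (\<gamma> i) :: real)"
      by (intro prod.cong) (auto simp: \<gamma>_def unit_index_def)
    also have "real (\<alpha> j) * fact (\<gamma> j) * \<dots> = real (\<alpha> j) * multi_fact n \<gamma>"
      unfolding multi_fact_def using j by (simp add: prod.remove[of _ j])
    finally show ?thesis .
  qed
  have sum: "(\<Sum>i<n. \<gamma> i) = d"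
  proof -
    have "m = (\<Sum>i<n. \<gamma> i + unit_index j i)"
      using \<alpha> j by (auto simp: multi_indices_def \<gamma>_def unit_index_def intro!: sum.cong)
    also have "\<dots> = (\<Sum>i<n. \<gamma> i) + 1"
      using j by (simp add: sum.distrib unit_index_def)
    finally show ?thesis by (simp add: d_def)
  qed
  have K1: "1 \<le> real K ^ (1 + K)"
    using K by (intro one_le_power) auto
  have main: "slot_wt n m j \<alpha> * multi_fact n \<gamma> * real m \<le> L * (fact d * P)"
  proof -
    have "finite (\<gamma> ` {..<n})" "\<gamma> ` {..<n} \<noteq> {}"
      using j by auto
    from Max_in[OF this] obtain i0 where i0: "i0 < n" "\<gamma> i0 = Max (\<gamma> ` {..<n})"
      by auto
    have max: "\<gamma> i \<le> \<gamma> i0" if "i < n" for i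
      using that i0 by simp
    have le: "\<gamma> i0 \<le> d"
      using member_le_sum[of i0 "{..<n}" \<gamma>] i0 sum by simp
    have mf_pos: "0 < multi_fact n \<gamma>"
      by (simp add: multi_fact_def prod_pos)
    show ?thesis
    proof (cases "\<gamma> i0 < d")
      case True
      have "slot_wt n m j \<alpha> * multi_fact n \<gamma> * real m \<le> 1 * multi_fact n \<gamma> * (2 * real d)"
        using mf_pos m d by (intro mult_mono) (auto simp: slot_wt_def m_eq)
      also have "\<dots> \<le> L * (fact d * P)"
        using mult_left_mono[OF multi_fact_le_coeff_wt[OF sum i0(1) max True K], of 2]
        by (simp add: P_def L_def m_eq mult_ac)
      finally show ?thesis .
    next
      case False
      with le have eq: "\<gamma> i0 = d" by simp
      have zero: "\<gamma> i = 0" if "i \<in> {..<n} - {i0}" for i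
      proof -
        have "\<gamma> i0 + (\<Sum>i\<in>{..<n} - {i0}. \<gamma> i) = d"
          using sum sum.remove[of "{..<n}" i0 \<gamma>] i0(1) by simp
        then have "(\<Sum>i\<in>{..<n} - {i0}. \<gamma> i) = 0"
          using eq by simp
        then show ?thesis using that by simp
      qed
      have "i0 \<noteq> j"
        using eq off[OF i0(1)] j m by (auto simp: \<gamma>_def unit_index_def d_def)
      then have "\<alpha> i0 = m - 1"
        using eq by (simp add: \<gamma>_def unit_index_def d_def)
      with \<open>i0 \<noteq> j\<close> i0 have "slot_wt n m j \<alpha> = 1 / real m"
        by (auto simp: slot_wt_def)
      moreover have "multi_fact n \<gamma> = fact d"
        unfolding multi_fact_def using i0 zero by (simp add: prod.remove[of _ i0] eq)
      ultimately have "slot_wt n m j \<alpha> * multi_fact n \<gamma> * real m = fact d * 1"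
        using m by simp
      also have "\<dots> \<le> fact d * (L * P)"
      proof (intro mult_left_mono)
        have "P = coeff_wt m d"
          unfolding P_def using i0 zero by (simp add: prod.remove[of _ i0] eq coeff_wt_def)
        also have "\<dots> \<ge> 1 / 53"
          using d by (simp add: coeff_wt_def m_eq add_increasing)
        finally have "1 / 53 \<le> P" .
        moreover have "53 \<le> L"
          using K1 by (simp add: L_def)
        ultimately have "53 * (1 / 53) \<le> L * P"
          by (intro mult_mono) auto
        then show "1 \<le> L * P" by simp
      qed simp
      finally show ?thesis by (simp add: mult_ac)
    qed
  qed
  have "slot_wt n m j \<alpha> * (multi_fact n \<alpha> / fact m) * (real (\<alpha> j) / real m) =
      (slot_wt n m j \<alpha> * multi_fact n \<gamma> * real m) * ((real (\<alpha> j))\<^sup>2 / (real m ^ 3 * fact d))"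
  proof -
    have "fact m = real m * fact d"
      by (simp add: m_eq)
    then show ?thesis
      using m by (simp add: mf power2_eq_square power3_eq_cube mult_ac)
  qed
  also have "\<dots> \<le> (L * (fact d * P)) * ((real (\<alpha> j))\<^sup>2 / (real m ^ 3 * fact d))"
    by (intro mult_right_mono main) auto
  also have "\<dots> = L / real m * ((real (\<alpha> j) / real m)\<^sup>2 * P)"
    by (simp add: power2_eq_square power3_eq_cube field_simps)
  finally show ?thesis
    by (simp add: L_def P_def \<gamma>_def)
qed

subsection \<open>An entropy form of Blei's inequality\<close>

lemma multi_indices_0: "multi_indices 0 m = (if m = 0 then {\<lambda>_. 0} else {})"
  by (auto simp: multi_indices_def)

lemma sum_multi_indices_Suc:
  "(\<Sum>\<alpha>\<in>multi_indices (Suc n) m. F \<alpha>) =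
    (\<Sum>k\<le>m. \<Sum>\<alpha>\<in>multi_indices n (m - k). F (\<alpha>(n := k)))"
proof -
  have "(\<Sum>\<alpha>\<in>multi_indices (Suc n) m. F \<alpha>) =
      (\<Sum>(k, \<alpha>)\<in>(SIGMA k:{..m}. multi_indices n (m - k)). F (\<alpha>(n := k)))"
    by (rule sum.reindex_bij_witness[of _ "\<lambda>(k, \<alpha>). \<alpha>(n := k)" "\<lambda>\<alpha>. (\<alpha> n, \<alpha>(n := 0))"])
       (auto simp: multi_indices_def fun_eq_iff)
  also have "\<dots> = (\<Sum>k\<le>m. \<Sum>\<alpha>\<in>multi_indices n (m - k). F (\<alpha>(n := k)))"
    by (rule sum.Sigma[symmetric]) (auto simp: finite_multi_indices)
  finally show ?thesis .
qed

text \<open>After division by m! the sum over one more coordinate is a convolution, and the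
  induction step is the binomial theorem.\<close>

lemma multinomial_aux:
  fixes t :: "nat \<Rightarrow> real"
  shows "(\<Sum>\<alpha>\<in>multi_indices n m. (\<Prod>i<n. t i ^ \<alpha> i) / multi_fact n \<alpha>) = (\<Sum>i<n. t i) ^ m / fact m"
proof (induction n arbitrary: m)
  case 0
  then show ?case by (auto simp: multi_indices_0 multi_fact_def power_0_left)
next
  case (Suc n)
  have "(\<Sum>\<alpha>\<in>multi_indices (Suc n) m. (\<Prod>i<Suc n. t i ^ \<alpha> i) / multi_fact (Suc n) \<alpha>) =
      (\<Sum>k\<le>m. t n ^ k / fact k * (\<Sum>\<alpha>\<in>multi_indices n (m - k). (\<Prod>i<n. t i ^ \<alpha> i) / multi_fact n \<alpha>))"
    unfolding sum_multi_indices_Suc sum_distrib_left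
    by (intro sum.cong refl) (simp add: multi_fact_def mult.commute)
  also have "\<dots> = (\<Sum>k\<le>m. of_nat (m choose k) * t n ^ k * (\<Sum>i<n. t i) ^ (m - k)) / fact m"
    unfolding Suc.IH sum_divide_distrib
    by (intro sum.cong refl) (simp add: binomial_fact)
  also have "\<dots> = (\<Sum>i<Suc n. t i) ^ m / fact m"
    by (simp add: binomial_ring add.commute)
  finally show ?case .
qed

lemma multi_fact_pos: "0 < multi_fact n \<alpha>"
  by (simp add: multi_fact_def prod_pos)

lemma multinomial_theorem:
  fixes t :: "nat \<Rightarrow> real"
  shows "(\<Sum>\<alpha>\<in>multi_indices n m. fact m / multi_fact n \<alpha> * (\<Prod>i<n. t i ^ \<alpha> i)) = (\<Sum>i<n. t i) ^ m"
proof -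
  have "(\<Sum>\<alpha>\<in>multi_indices n m. fact m / multi_fact n \<alpha> * (\<Prod>i<n. t i ^ \<alpha> i)) =
      fact m * (\<Sum>\<alpha>\<in>multi_indices n m. (\<Prod>i<n. t i ^ \<alpha> i) / multi_fact n \<alpha>)"
    by (simp add: sum_distrib_left)
  then show ?thesis by (simp add: multinomial_aux)
qed

lemma sum_multi_index: "\<alpha> \<in> multi_indices n m \<Longrightarrow> (\<Sum>i<n. real (\<alpha> i)) = real m"
  by (auto simp: multi_indices_def simp flip: of_nat_sum)

text \<open>A weighted Blei inequality, proved by comparing entropies: for
  \<open>p \<alpha> \<propto> (m!/\<alpha>!)\<^sup>1\<^sup>-\<^sup>q |b \<alpha>|\<^sup>q\<close> and \<open>t\<close> the law of a random slot of a random
  \<open>\<alpha>\<close>, Jensen bounds the right-hand side from below in terms of the entropies of \<open>p\<close> and \<open>t\<close>,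
  and Gibbs' inequality says that the former is at most \<open>m\<close> times the latter plus the mean of
  \<open>ln (m!/\<alpha>!)\<close>. The choice of \<open>q\<close> makes the entropy of \<open>t\<close> cancel.\<close>
lemma entropy_blei_inequality:
  fixes b :: "(nat \<Rightarrow> nat) \<Rightarrow> complex" and \<theta> :: "nat \<Rightarrow> (nat \<Rightarrow> nat) \<Rightarrow> real"
  assumes n: "1 \<le> n" and m: "1 \<le> m" and I: "I \<subseteq> multi_indices n m"
    and q: "0 < q" "1 / q = 1 / 2 + (1 / 2 - real m * \<kappa>) / real m"
    and \<kappa>: "0 \<le> \<kappa>" "real m * \<kappa> \<le> 1 / 2"
    and \<theta>: "\<And>j \<alpha>. 0 < \<theta> j \<alpha>"
    and L: "\<And>\<alpha>. \<alpha> \<in> I \<Longrightarrow> - L \<le> (\<Sum>j<n. real (\<alpha> j) / real m * ln (\<theta> j \<alpha>))"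
  obtains t :: "nat \<Rightarrow> real" where "\<And>i. 0 \<le> t i" "(\<Sum>i<n. t i) = 1"
    "(\<Sum>\<alpha>\<in>I. (fact m / multi_fact n \<alpha>) powr (1 - q) * cmod (b \<alpha>) powr q) powr (1 / q) \<le>
      exp (L / 2) * (\<Sum>j<n. sqrt (\<Sum>\<alpha>\<in>I. \<theta> j \<alpha> * (multi_fact n \<alpha> / fact m) *
        (real (\<alpha> j) / real m) * (cmod (b \<alpha>))\<^sup>2 * (\<Prod>i<n. (t i powr \<kappa>) ^ (2 * \<alpha> i))))"
proof -
  define M :: "(nat \<Rightarrow> nat) \<Rightarrow> real" where "M = (\<lambda>\<alpha>. fact m / multi_fact n \<alpha>)"
  define W where "W = (\<lambda>\<alpha>. M \<alpha> powr (1 - q) * cmod (b \<alpha>) powr q)"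
  define S where "S = (\<Sum>\<alpha>\<in>I. W \<alpha>)"
  have finI: "finite I"
    using I finite_multi_indices by (rule finite_subset)
  have M: "0 < M \<alpha>" for \<alpha>
    by (simp add: M_def multi_fact_pos)
  have W: "0 \<le> W \<alpha>" for \<alpha>
    by (simp add: W_def)
  define E where "E = (\<lambda>t j. \<Sum>\<alpha>\<in>I. \<theta> j \<alpha> * (multi_fact n \<alpha> / fact m) *
        (real (\<alpha> j) / real m) * (cmod (b \<alpha>))\<^sup>2 * (\<Prod>i<n. (t i powr \<kappa>) ^ (2 * \<alpha> i)))"
  show ?thesis
  proof (cases "S = 0")
    case True
    show ?thesis
    proof (rule that[of "\<lambda>i. if i = 0 then 1 else 0"])
      show "(\<Sum>\<alpha>\<in>I. (fact m / multi_fact n \<alpha>) powr (1 - q) * cmod (b \<alpha>) powr q) powr (1 / q) \<le>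
      exp (L / 2) * (\<Sum>j<n. sqrt (\<Sum>\<alpha>\<in>I. \<theta> j \<alpha> * (multi_fact n \<alpha> / fact m) *
        (real (\<alpha> j) / real m) * (cmod (b \<alpha>))\<^sup>2 *
        (\<Prod>i<n. ((if i = 0 then 1 else 0) powr \<kappa>) ^ (2 * \<alpha> i))))"
      proof -
        have "0 \<le> exp (L / 2) * (\<Sum>j<n. sqrt (\<Sum>\<alpha>\<in>I. \<theta> j \<alpha> * (multi_fact n \<alpha> / fact m) *
          (real (\<alpha> j) / real m) * (cmod (b \<alpha>))\<^sup>2 *
          (\<Prod>i<n. ((if i = 0 then 1 else 0) powr \<kappa>) ^ (2 * \<alpha> i))))"
          by (intro mult_nonneg_nonneg sum_nonneg real_sqrt_ge_zero prod_nonneg divide_nonneg_nonneg)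
             (auto simp: less_imp_le[OF \<theta>] less_imp_le[OF multi_fact_pos])
        moreover have "(\<Sum>\<alpha>\<in>I. (fact m / multi_fact n \<alpha>) powr (1 - q) * cmod (b \<alpha>) powr q) = 0"
          using True by (simp add: S_def W_def M_def)
        ultimately show ?thesis by (simp only: powr_0)
      qed
    qed (use n in auto)
  next
    case False
    then have S: "0 < S"
      using W by (simp add: S_def sum_nonneg order_less_le)
    \<comment> \<open>On the support of b all logarithms below are genuine: \<open>t i\<close> can
      vanish only if \<alpha> i = 0 for every \<alpha> in J.\<close>
    define J where "J = {\<alpha>\<in>I. b \<alpha> \<noteq> 0}"
    define p where "p = (\<lambda>\<alpha>. W \<alpha> / S)"
    define t where "t = (\<lambda>j. \<Sum>\<alpha>\<in>J. p \<alpha> * (real (\<alpha> j) / real m))"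
    define T where "T = (\<Sum>j<n. t j * ln (t j))"
    define c where "c = (\<lambda>\<alpha>. (cmod (b \<alpha>))\<^sup>2 / M \<alpha>)"
    define X where "X = (\<lambda>\<alpha>. \<Prod>i<n. (t i powr \<kappa>) ^ (2 * \<alpha> i))"
    have finJ: "finite J" and JI: "J \<subseteq> I"
      using finI by (auto simp: J_def)
    have Jm: "(\<Sum>i<n. real (\<alpha> i)) = real m" if "\<alpha> \<in> J" for \<alpha>
      using that I JI sum_multi_index by blast
    have p: "0 < p \<alpha>" if "\<alpha> \<in> J" for \<alpha>
      using that S M[of \<alpha>] by (auto simp: p_def W_def J_def)
    have p1: "(\<Sum>\<alpha>\<in>J. p \<alpha>) = 1"
    proof -
      have "S = (\<Sum>\<alpha>\<in>J. W \<alpha>)"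
        unfolding S_def by (rule sum.mono_neutral_right) (use finI in \<open>auto simp: J_def W_def\<close>)
      then show ?thesis
        using S by (simp add: p_def sum_divide_distrib[symmetric])
    qed
    have t0: "0 \<le> t j" for j
      unfolding t_def by (intro sum_nonneg mult_nonneg_nonneg less_imp_le[OF p]) auto
    have t_pos: "0 < t i" if "\<alpha> \<in> J" "0 < \<alpha> i" for \<alpha> i
    proof -
      have "0 < p \<alpha> * (real (\<alpha> i) / real m)"
        using p[OF that(1)] that(2) m by auto
      also have "\<dots> \<le> t i"
        unfolding t_def using finJ that(1)
        by (intro member_le_sum mult_nonneg_nonneg less_imp_le[OF p]) auto
      finally show ?thesis .
    qed
    have slots: "(\<Sum>j<n. p \<alpha> * (real (\<alpha> j) / real m)) = p \<alpha>" if "\<alpha> \<in> J" for \<alpha>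
    proof -
      have "(\<Sum>j<n. p \<alpha> * (real (\<alpha> j) / real m)) = p \<alpha> * ((\<Sum>j<n. real (\<alpha> j)) / real m)"
        by (simp add: sum_distrib_left sum_divide_distrib)
      also have "(\<Sum>j<n. real (\<alpha> j)) = real m"
        by (rule Jm[OF that])
      finally show ?thesis using m by simp
    qed
    have t1: "(\<Sum>j<n. t j) = 1"
    proof -
      have "(\<Sum>j<n. t j) = (\<Sum>\<alpha>\<in>J. p \<alpha>)"
        unfolding t_def by (subst sum.swap) (intro sum.cong refl slots)
      then show ?thesis using p1 by simp
    qed
    have c_pos: "0 < c \<alpha>" if "\<alpha> \<in> J" for \<alpha>
      using that M[of \<alpha>] by (auto simp: c_def J_def)
    have x_pos: "0 < (t i powr \<kappa>) ^ (2 * \<alpha> i)" if "\<alpha> \<in> J" for \<alpha> i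
      using t_pos[OF that, of i] by (cases "\<alpha> i = 0") auto
    have X_pos: "0 < X \<alpha>" if "\<alpha> \<in> J" for \<alpha>
      unfolding X_def by (intro prod_pos ballI x_pos that)
    have lnX: "ln (X \<alpha>) = 2 * \<kappa> * (\<Sum>i<n. real (\<alpha> i) * ln (t i))" if "\<alpha> \<in> J" for \<alpha>
    proof -
      have "ln (X \<alpha>) = (\<Sum>i<n. ln ((t i powr \<kappa>) ^ (2 * \<alpha> i)))"
        unfolding X_def
      proof (rule ln_prod)
        fix i
        show "(t i powr \<kappa>) ^ (2 * \<alpha> i) \<noteq> 0"
          using x_pos[OF that, of i] by linarith
      qed simp
      also have "\<dots> = (\<Sum>i<n. 2 * \<kappa> * (real (\<alpha> i) * ln (t i)))"
      proof (intro sum.cong refl)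
        fix i
        show "ln ((t i powr \<kappa>) ^ (2 * \<alpha> i)) = 2 * \<kappa> * (real (\<alpha> i) * ln (t i))"
          using t_pos[OF that, of i] by (cases "\<alpha> i = 0") (auto simp: ln_realpow ln_powr)
      qed
      finally show ?thesis by (simp add: sum_distrib_left)
    qed
    have mean_ln_t: "(\<Sum>\<alpha>\<in>J. p \<alpha> * (\<Sum>i<n. real (\<alpha> i) * ln (t i))) = real m * T"
    proof -
      have "(\<Sum>\<alpha>\<in>J. p \<alpha> * (\<Sum>i<n. real (\<alpha> i) * ln (t i))) =
          (\<Sum>\<alpha>\<in>J. \<Sum>i<n. real m * (p \<alpha> * (real (\<alpha> i) / real m)) * ln (t i))"
        unfolding sum_distrib_left using m by (intro sum.cong refl) simp
      also have "\<dots> = (\<Sum>i<n. \<Sum>\<alpha>\<in>J. real m * (p \<alpha> * (real (\<alpha> i) / real m)) * ln (t i))"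
        by (rule sum.swap)
      also have "\<dots> = (\<Sum>i<n. real m * t i * ln (t i))"
        unfolding t_def by (simp add: sum_distrib_left sum_distrib_right)
      also have "\<dots> = real m * T"
        by (simp add: T_def sum_distrib_left mult_ac)
      finally show ?thesis .
    qed
    have gibbs: "real m * T \<le> (\<Sum>\<alpha>\<in>J. p \<alpha> * (ln (p \<alpha>) - ln (M \<alpha>)))"
    proof -
      \<comment> \<open>The comparison measure in Gibbs' inequality: the law of the multi-index of m
        independent draws from t, of total mass 1 by the multinomial theorem.\<close>
      define v where "v = (\<lambda>\<alpha>. M \<alpha> * (\<Prod>i<n. t i ^ \<alpha> i))"
      have v: "0 < v \<alpha>" "ln (v \<alpha>) = ln (M \<alpha>) + (\<Sum>i<n. real (\<alpha> i) * ln (t i))" if "\<alpha> \<in> J" for \<alpha>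
      proof -
        have pos: "0 < t i ^ \<alpha> i" for i
          using t_pos[OF that, of i] by (cases "\<alpha> i = 0") auto
        then have pr: "0 < (\<Prod>i<n. t i ^ \<alpha> i)"
          by (intro prod_pos) auto
        then show "0 < v \<alpha>" using M by (simp add: v_def)
        have "ln (v \<alpha>) = ln (M \<alpha>) + ln (\<Prod>i<n. t i ^ \<alpha> i)"
          using pr M[of \<alpha>] unfolding v_def by (intro ln_mult_pos) auto
        also have "ln (\<Prod>i<n. t i ^ \<alpha> i) = (\<Sum>i<n. ln (t i ^ \<alpha> i))"
          using pos by (intro ln_prod) (auto simp: order_less_imp_not_eq2 simp del: power_eq_0_iff)
        also have "\<dots> = (\<Sum>i<n. real (\<alpha> i) * ln (t i))"
        proof (intro sum.cong refl)
          fix i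
          show "ln (t i ^ \<alpha> i) = real (\<alpha> i) * ln (t i)"
            using t_pos[OF that, of i] by (cases "\<alpha> i = 0") (auto simp: ln_realpow)
        qed
        finally show "ln (v \<alpha>) = ln (M \<alpha>) + (\<Sum>i<n. real (\<alpha> i) * ln (t i))" .
      qed
      have "(\<Sum>\<alpha>\<in>J. v \<alpha>) \<le> (\<Sum>\<alpha>\<in>multi_indices n m. v \<alpha>)"
        using JI I M finite_multi_indices
        by (intro sum_mono2) (auto simp: v_def t0 intro!: mult_nonneg_nonneg prod_nonneg less_imp_le[OF M])
      also have "\<dots> = 1"
        using multinomial_theorem[where t = t and n = n and m = m] by (simp add: v_def M_def t1)
      finally have "0 \<le> (\<Sum>\<alpha>\<in>J. p \<alpha> - v \<alpha>)"
        by (simp add: sum_subtractf p1)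
      also have "\<dots> \<le> (\<Sum>\<alpha>\<in>J. p \<alpha> * (ln (p \<alpha>) - ln (v \<alpha>)))"
      proof (rule sum_mono)
        fix \<alpha> assume \<alpha>: "\<alpha> \<in> J"
        have "ln (v \<alpha> / p \<alpha>) \<le> v \<alpha> / p \<alpha> - 1"
          using v[OF \<alpha>] p[OF \<alpha>] by (intro ln_le_minus_one) auto
        then have "p \<alpha> * (1 - v \<alpha> / p \<alpha>) \<le> p \<alpha> * (ln (p \<alpha>) - ln (v \<alpha>))"
          using v[OF \<alpha>] p[OF \<alpha>] by (intro mult_left_mono) (auto simp: ln_div)
        moreover have "p \<alpha> * (1 - v \<alpha> / p \<alpha>) = p \<alpha> - v \<alpha>"
          using p[OF \<alpha>] by (simp add: right_diff_distrib)
        ultimately show "p \<alpha> - v \<alpha> \<le> p \<alpha> * (ln (p \<alpha>) - ln (v \<alpha>))"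
          by simp
      qed
      also have "\<dots> = (\<Sum>\<alpha>\<in>J. p \<alpha> * (ln (p \<alpha>) - ln (M \<alpha>))) -
          (\<Sum>\<alpha>\<in>J. p \<alpha> * (\<Sum>i<n. real (\<alpha> i) * ln (t i)))"
        unfolding sum_subtractf[symmetric] by (intro sum.cong refl) (simp add: v algebra_simps)
      finally show ?thesis using mean_ln_t by simp
    qed
    have ln_c: "ln (c \<alpha>) - ln (p \<alpha>) = 2 / q * ln S + (2 / q - 1) * (ln (p \<alpha>) - ln (M \<alpha>))"
      if "\<alpha> \<in> J" for \<alpha>
    proof -
      have b: "b \<alpha> \<noteq> 0" using that by (simp add: J_def)
      have "ln (p \<alpha>) = ln (W \<alpha>) - ln S"
        using p[OF that] S by (simp add: p_def ln_div zero_less_divide_iff)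
      also have "ln (W \<alpha>) = (1 - q) * ln (M \<alpha>) + q * ln (cmod (b \<alpha>))"
        using b M[of \<alpha>] by (simp add: W_def ln_mult_pos ln_powr)
      finally have 1: "ln (cmod (b \<alpha>)) = (ln (p \<alpha>) + ln S - (1 - q) * ln (M \<alpha>)) / q"
        using q by (simp add: field_simps)
      have "ln (c \<alpha>) = 2 * ln (cmod (b \<alpha>)) - ln (M \<alpha>)"
        using b M[of \<alpha>] by (simp add: c_def ln_div ln_realpow)
      then show ?thesis
        unfolding 1 using q(1) by (simp add: field_simps)
    qed
    \<comment> \<open>Under the joint law \<pi> of \<alpha> and slot, the mean of y is at most the
      sum of the \<open>sqrt (E t j)\<close>: for fixed j, \<open>\<pi> j \<alpha> / t j\<close> is
      a conditional law, and Cauchy-Schwarz in \<alpha> leaves \<open>E t j\<close>.\<close>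
    define y where "y = (\<lambda>j \<alpha>. sqrt (\<theta> j \<alpha> * c \<alpha> * X \<alpha> / p \<alpha> / t j))"
    \<comment> \<open>The pairs of positive \<pi>-mass, the only ones at which
      \<open>ln (y j \<alpha>)\<close> is under control.\<close>
    define Z where "Z = (SIGMA j:{..<n}. {\<alpha>\<in>J. 0 < \<alpha> j})"
    define \<pi> where "\<pi> = (\<lambda>j \<alpha>. p \<alpha> * (real (\<alpha> j) / real m))"
    have \<pi>0: "0 \<le> \<pi> j \<alpha>" if "\<alpha> \<in> J" for j \<alpha>
      using p[OF that] by (simp add: \<pi>_def)
    have sumZ: "(\<Sum>(j, \<alpha>)\<in>Z. \<pi> j \<alpha> * h j \<alpha>) = (\<Sum>j<n. \<Sum>\<alpha>\<in>J. \<pi> j \<alpha> * h j \<alpha>)" for h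
    proof -
      have "(\<Sum>j<n. \<Sum>\<alpha>\<in>J. \<pi> j \<alpha> * h j \<alpha>) = (\<Sum>j<n. \<Sum>\<alpha>\<in>{\<alpha>\<in>J. 0 < \<alpha> j}. \<pi> j \<alpha> * h j \<alpha>)"
        using finJ by (intro sum.cong refl sum.mono_neutral_right) (auto simp: \<pi>_def)
      also have "\<dots> = (\<Sum>(j, \<alpha>)\<in>Z. \<pi> j \<alpha> * h j \<alpha>)"
        unfolding Z_def using finJ by (intro sum.Sigma) auto
      finally show ?thesis by simp
    qed
    have y_pos: "0 < y j \<alpha>" if "\<alpha> \<in> J" "0 < \<alpha> j" for j \<alpha>
      using \<theta> c_pos[OF that(1)] X_pos[OF that(1)] p[OF that(1)] t_pos[OF that] by (simp add: y_def)
    have ln_y: "2 * ln (y j \<alpha>) = ln (\<theta> j \<alpha>) + (ln (c \<alpha>) - ln (p \<alpha>)) + ln (X \<alpha>) - ln (t j)"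
      if "\<alpha> \<in> J" "0 < \<alpha> j" for j \<alpha>
      using \<theta>[of j \<alpha>] c_pos[OF that(1)] X_pos[OF that(1)] p[OF that(1)] t_pos[OF that]
      by (simp add: y_def ln_sqrt ln_div ln_mult_pos)
    define Y where "Y = (\<Sum>j<n. \<Sum>\<alpha>\<in>J. \<pi> j \<alpha> * y j \<alpha>)"
    have sqrt_split: "a * sqrt (w / s) = \<bar>sqrt (a / s)\<bar> * \<bar>sqrt (a * w)\<bar>"
      if "0 \<le> w" "0 \<le> a" "0 \<le> s" for a s w :: real
    proof -
      have "\<bar>sqrt (a / s)\<bar> * \<bar>sqrt (a * w)\<bar> = sqrt ((a / s) * (a * w))"
        using that by (simp only: real_sqrt_mult[of "a / s" "a * w"] abs_of_nonneg
          real_sqrt_ge_zero divide_nonneg_nonneg mult_nonneg_nonneg)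
      also have "(a / s) * (a * w) = a\<^sup>2 * (w / s)"
        by (simp add: power2_eq_square)
      also have "sqrt \<dots> = a * sqrt (w / s)"
        using that by (simp only: real_sqrt_mult[of "a\<^sup>2"] real_sqrt_abs abs_of_nonneg)
      finally show ?thesis by simp
    qed
    have Y_le: "Y \<le> (\<Sum>j<n. sqrt (E t j))"
      unfolding Y_def
    proof (rule sum_mono)
      fix j
      have "(\<Sum>\<alpha>\<in>J. \<pi> j \<alpha> * y j \<alpha>) =
          (\<Sum>\<alpha>\<in>J. \<bar>sqrt (\<pi> j \<alpha> / t j)\<bar> * \<bar>sqrt (\<pi> j \<alpha> * (\<theta> j \<alpha> * c \<alpha> * X \<alpha> / p \<alpha>))\<bar>)"
      proof (intro sum.cong refl)
        fix \<alpha> assume \<alpha>: "\<alpha> \<in> J"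
        have "0 \<le> \<theta> j \<alpha> * c \<alpha> * X \<alpha> / p \<alpha>"
          using \<theta>[of j \<alpha>] c_pos[OF \<alpha>] X_pos[OF \<alpha>] p[OF \<alpha>] by simp
        then show "\<pi> j \<alpha> * y j \<alpha> =
            \<bar>sqrt (\<pi> j \<alpha> / t j)\<bar> * \<bar>sqrt (\<pi> j \<alpha> * (\<theta> j \<alpha> * c \<alpha> * X \<alpha> / p \<alpha>))\<bar>"
          using \<pi>0[OF \<alpha>, of j] t0[of j] unfolding y_def by (rule sqrt_split)
      qed
      also have "\<dots> \<le> L2_set (\<lambda>\<alpha>. sqrt (\<pi> j \<alpha> / t j)) J *
          L2_set (\<lambda>\<alpha>. sqrt (\<pi> j \<alpha> * (\<theta> j \<alpha> * c \<alpha> * X \<alpha> / p \<alpha>))) J"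
        by (rule L2_set_mult_ineq)
      also have "\<dots> \<le> 1 * sqrt (E t j)"
      proof (rule mult_mono)
        have "(\<Sum>\<alpha>\<in>J. \<pi> j \<alpha> / t j) = t j / t j"
          by (simp add: sum_divide_distrib[symmetric] t_def \<pi>_def)
        also have "\<dots> \<le> 1" by simp
        finally show "L2_set (\<lambda>\<alpha>. sqrt (\<pi> j \<alpha> / t j)) J \<le> 1"
          using \<pi>0 t0 by (simp add: L2_set_def)
        have "(\<Sum>\<alpha>\<in>J. \<pi> j \<alpha> * (\<theta> j \<alpha> * c \<alpha> * X \<alpha> / p \<alpha>)) =
            (\<Sum>\<alpha>\<in>J. \<theta> j \<alpha> * (multi_fact n \<alpha> / fact m) * (real (\<alpha> j) / real m) * (cmod (b \<alpha>))\<^sup>2 * X \<alpha>)"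
        proof (intro sum.cong refl)
          fix \<alpha> assume "\<alpha> \<in> J"
          from p[OF this] show "\<pi> j \<alpha> * (\<theta> j \<alpha> * c \<alpha> * X \<alpha> / p \<alpha>) =
              \<theta> j \<alpha> * (multi_fact n \<alpha> / fact m) * (real (\<alpha> j) / real m) * (cmod (b \<alpha>))\<^sup>2 * X \<alpha>"
            by (simp add: \<pi>_def c_def M_def mult_ac)
        qed
        also have "\<dots> \<le> E t j"
          unfolding E_def X_def
        proof (rule sum_mono2[OF finI JI])
          fix \<alpha>
          show "0 \<le> \<theta> j \<alpha> * (multi_fact n \<alpha> / fact m) * (real (\<alpha> j) / real m) *
              (cmod (b \<alpha>))\<^sup>2 * (\<Prod>i<n. (t i powr \<kappa>) ^ (2 * \<alpha> i))"
            by (intro mult_nonneg_nonneg prod_nonneg divide_nonneg_nonneg)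
              (auto simp: less_imp_le[OF \<theta>] less_imp_le[OF multi_fact_pos])
        qed
        finally have le: "(\<Sum>\<alpha>\<in>J. \<pi> j \<alpha> * (\<theta> j \<alpha> * c \<alpha> * X \<alpha> / p \<alpha>)) \<le> E t j" .
        show "L2_set (\<lambda>\<alpha>. sqrt (\<pi> j \<alpha> * (\<theta> j \<alpha> * c \<alpha> * X \<alpha> / p \<alpha>))) J \<le> sqrt (E t j)"
        proof -
          have "0 \<le> \<pi> j \<alpha> * (\<theta> j \<alpha> * c \<alpha> * X \<alpha> / p \<alpha>)" if "\<alpha> \<in> J" for \<alpha>
            using \<pi>0 \<theta> c_pos X_pos p that
            by (intro mult_nonneg_nonneg divide_nonneg_nonneg) (auto intro: less_imp_le)
          then have "L2_set (\<lambda>\<alpha>. sqrt (\<pi> j \<alpha> * (\<theta> j \<alpha> * c \<alpha> * X \<alpha> / p \<alpha>))) J =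
              sqrt (\<Sum>\<alpha>\<in>J. \<pi> j \<alpha> * (\<theta> j \<alpha> * c \<alpha> * X \<alpha> / p \<alpha>))"
            unfolding L2_set_def by (intro arg_cong[where f = sqrt] sum.cong refl real_sqrt_pow2)
          with le show ?thesis by simp
        qed
      qed auto
      finally show "(\<Sum>\<alpha>\<in>J. \<pi> j \<alpha> * y j \<alpha>) \<le> sqrt (E t j)" by simp
    qed
    have \<pi>1: "(\<Sum>j<n. \<Sum>\<alpha>\<in>J. \<pi> j \<alpha>) = 1"
      using t1 by (simp add: t_def \<pi>_def)
    have fin: "finite Z"
      using finJ by (simp add: Z_def)
    have Z1: "(\<Sum>(j, \<alpha>)\<in>Z. \<pi> j \<alpha>) = 1"
      using sumZ[of "\<lambda>_ _. 1"] \<pi>1 by simp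
    have Y_pos: "0 < Y"
    proof -
      have "0 < (\<Sum>(j, \<alpha>)\<in>Z. \<pi> j \<alpha> * y j \<alpha>)"
      proof (rule sum_pos)
        show "Z \<noteq> {}" using Z1 by auto
        fix x assume "x \<in> Z"
        then show "0 < (case x of (j, \<alpha>) \<Rightarrow> \<pi> j \<alpha> * y j \<alpha>)"
          using p y_pos m by (auto simp: Z_def \<pi>_def)
      qed (rule fin)
      then show ?thesis by (simp add: sumZ Y_def)
    qed
    have jensen: "(\<Sum>(j, \<alpha>)\<in>Z. \<pi> j \<alpha> * ln (y j \<alpha>)) \<le> ln Y"
    proof -
      have "(\<Sum>(j, \<alpha>)\<in>Z. \<pi> j \<alpha> * ln (y j \<alpha>)) \<le>
          (\<Sum>(j, \<alpha>)\<in>Z. \<pi> j \<alpha> * (ln Y - 1 + y j \<alpha> / Y))"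
      proof (rule sum_mono, clarify)
        fix j \<alpha> assume "(j, \<alpha>) \<in> Z"
        then have *: "\<alpha> \<in> J" "0 < \<alpha> j" by (auto simp: Z_def)
        have "ln (y j \<alpha> / Y) \<le> y j \<alpha> / Y - 1"
          using y_pos[OF *] Y_pos by (intro ln_le_minus_one) auto
        then show "\<pi> j \<alpha> * ln (y j \<alpha>) \<le> \<pi> j \<alpha> * (ln Y - 1 + y j \<alpha> / Y)"
          using y_pos[OF *] Y_pos \<pi>0[OF *(1)] by (intro mult_left_mono) (auto simp: ln_div)
      qed
      also have "\<dots> = (\<Sum>j<n. \<Sum>\<alpha>\<in>J. \<pi> j \<alpha> * (ln Y - 1 + y j \<alpha> / Y))"
        by (rule sumZ)
      also have "\<dots> = (\<Sum>j<n. \<Sum>\<alpha>\<in>J. \<pi> j \<alpha>) * (ln Y - 1) +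
          (\<Sum>j<n. \<Sum>\<alpha>\<in>J. \<pi> j \<alpha> * y j \<alpha>) / Y"
        by (simp add: sum_distrib_right sum_divide_distrib distrib_left sum.distrib)
      also have "\<dots> = ln Y"
        using Y_pos by (simp add: \<pi>1 Y_def[symmetric])
      finally show ?thesis .
    qed
    have sum_alpha: "(\<Sum>j<n. \<Sum>\<alpha>\<in>J. \<pi> j \<alpha> * h \<alpha>) = (\<Sum>\<alpha>\<in>J. p \<alpha> * h \<alpha>)" for h
    proof -
      have "(\<Sum>j<n. \<Sum>\<alpha>\<in>J. \<pi> j \<alpha> * h \<alpha>) = (\<Sum>\<alpha>\<in>J. (\<Sum>j<n. p \<alpha> * (real (\<alpha> j) / real m)) * h \<alpha>)"
        unfolding \<pi>_def sum_distrib_right by (rule sum.swap)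
      also have "\<dots> = (\<Sum>\<alpha>\<in>J. p \<alpha> * h \<alpha>)"
        by (intro sum.cong refl) (simp only: slots)
      finally show ?thesis .
    qed
    have sum_j: "(\<Sum>j<n. \<Sum>\<alpha>\<in>J. \<pi> j \<alpha> * h j) = (\<Sum>j<n. t j * h j)" for h
      by (simp add: \<pi>_def t_def sum_distrib_right)
    have "2 * (\<Sum>(j, \<alpha>)\<in>Z. \<pi> j \<alpha> * ln (y j \<alpha>)) = (\<Sum>(j, \<alpha>)\<in>Z. \<pi> j \<alpha> *
        (ln (\<theta> j \<alpha>) + (ln (c \<alpha>) - ln (p \<alpha>)) + ln (X \<alpha>) - ln (t j)))"
      unfolding sum_distrib_left by (intro sum.cong refl) (auto simp: Z_def ln_y[symmetric])
    also have "\<dots> = (\<Sum>j<n. \<Sum>\<alpha>\<in>J. \<pi> j \<alpha> *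
        (ln (\<theta> j \<alpha>) + (ln (c \<alpha>) - ln (p \<alpha>)) + ln (X \<alpha>) - ln (t j)))"
      by (rule sumZ)
    also have "\<dots> = (\<Sum>j<n. \<Sum>\<alpha>\<in>J. \<pi> j \<alpha> * ln (\<theta> j \<alpha>)) +
        (\<Sum>j<n. \<Sum>\<alpha>\<in>J. \<pi> j \<alpha> * (ln (c \<alpha>) - ln (p \<alpha>))) +
        (\<Sum>j<n. \<Sum>\<alpha>\<in>J. \<pi> j \<alpha> * ln (X \<alpha>)) - (\<Sum>j<n. \<Sum>\<alpha>\<in>J. \<pi> j \<alpha> * ln (t j))"
      by (simp add: ring_distribs sum.distrib sum_subtractf)
    also have "(\<Sum>j<n. \<Sum>\<alpha>\<in>J. \<pi> j \<alpha> * ln (t j)) = T"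
      by (simp add: sum_j T_def)
    also have "(\<Sum>j<n. \<Sum>\<alpha>\<in>J. \<pi> j \<alpha> * ln (X \<alpha>)) = 2 * \<kappa> * (real m * T)"
    proof -
      have "(\<Sum>\<alpha>\<in>J. p \<alpha> * ln (X \<alpha>)) =
          2 * \<kappa> * (\<Sum>\<alpha>\<in>J. p \<alpha> * (\<Sum>i<n. real (\<alpha> i) * ln (t i)))"
        unfolding sum_distrib_left[of "2 * \<kappa>"] by (intro sum.cong refl) (simp add: lnX)
      then show ?thesis by (simp only: sum_alpha mean_ln_t)
    qed
    also have "(\<Sum>j<n. \<Sum>\<alpha>\<in>J. \<pi> j \<alpha> * (ln (c \<alpha>) - ln (p \<alpha>))) =
        2 / q * ln S + (2 / q - 1) * (\<Sum>\<alpha>\<in>J. p \<alpha> * (ln (p \<alpha>) - ln (M \<alpha>)))"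
    proof -
      have "(\<Sum>\<alpha>\<in>J. p \<alpha> * (ln (c \<alpha>) - ln (p \<alpha>))) =
          (\<Sum>\<alpha>\<in>J. p \<alpha> * (2 / q * ln S) + (2 / q - 1) * (p \<alpha> * (ln (p \<alpha>) - ln (M \<alpha>))))"
        by (intro sum.cong refl) (simp only: ln_c, simp add: algebra_simps)
      also have "\<dots> = (\<Sum>\<alpha>\<in>J. p \<alpha>) * (2 / q * ln S) +
          (2 / q - 1) * (\<Sum>\<alpha>\<in>J. p \<alpha> * (ln (p \<alpha>) - ln (M \<alpha>)))"
        unfolding sum.distrib sum_distrib_left sum_distrib_right ..
      finally show ?thesis by (simp add: sum_alpha p1)
    qed
    finally have eq: "2 * (\<Sum>(j, \<alpha>)\<in>Z. \<pi> j \<alpha> * ln (y j \<alpha>)) =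
        (\<Sum>j<n. \<Sum>\<alpha>\<in>J. \<pi> j \<alpha> * ln (\<theta> j \<alpha>)) +
        (2 / q * ln S + (2 / q - 1) * (\<Sum>\<alpha>\<in>J. p \<alpha> * (ln (p \<alpha>) - ln (M \<alpha>)))) +
        2 * \<kappa> * (real m * T) - T" .
    have "- L \<le> (\<Sum>j<n. \<Sum>\<alpha>\<in>J. \<pi> j \<alpha> * ln (\<theta> j \<alpha>))"
    proof -
      have "- L = (\<Sum>\<alpha>\<in>J. p \<alpha> * (- L))"
        by (simp only: sum_distrib_right[symmetric] p1 mult_1)
      also have "\<dots> \<le> (\<Sum>\<alpha>\<in>J. p \<alpha> * (\<Sum>j<n. real (\<alpha> j) / real m * ln (\<theta> j \<alpha>)))"
        using JI L by (intro sum_mono mult_left_mono less_imp_le[OF p]) auto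
      also have "\<dots> = (\<Sum>j<n. \<Sum>\<alpha>\<in>J. \<pi> j \<alpha> * ln (\<theta> j \<alpha>))"
        unfolding sum_distrib_left by (subst sum.swap) (simp add: \<pi>_def mult_ac)
      finally show ?thesis .
    qed
    moreover have q2: "2 / q - 1 = (1 - 2 * (real m * \<kappa>)) / real m"
    proof -
      have "2 / q = 2 * (1 / q)" by simp
      also have "\<dots> = 2 * (1 / 2 + (1 / 2 - real m * \<kappa>) / real m)"
        by (simp only: q(2))
      finally show ?thesis by (simp add: diff_divide_distrib)
    qed
    \<comment> \<open>The coefficient is (1 - 2m\<kappa>)/m \<ge> 0, so Gibbs' inequality
      contributes (1 - 2m\<kappa>) T. This cancels the terms 2\<kappa>mT - T from X and t, and the
      cancellation determines q.\<close>
    have "(2 / q - 1) * (real m * T) \<le> (2 / q - 1) * (\<Sum>\<alpha>\<in>J. p \<alpha> * (ln (p \<alpha>) - ln (M \<alpha>)))"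
      using gibbs \<kappa> by (intro mult_left_mono) (auto simp: q2)
    moreover have "(2 / q - 1) * (real m * T) = T - 2 * \<kappa> * (real m * T)"
      unfolding q2 using m by (simp add: field_simps)
    ultimately have "- L + 2 / q * ln S \<le> 2 * ln Y"
      using eq jensen by linarith
    then have "1 / q * ln S \<le> L / 2 + ln Y"
      by simp
    then have "exp (1 / q * ln S) \<le> exp (L / 2 + ln Y)"
      by simp
    then have "S powr (1 / q) \<le> exp (L / 2) * Y"
      using S Y_pos by (simp add: powr_def exp_add)
    also have "\<dots> \<le> exp (L / 2) * (\<Sum>j<n. sqrt (E t j))"
      by (intro mult_left_mono Y_le) simp
    finally show ?thesis
      by (intro that[of t] t0 t1) (simp add: S_def W_def M_def E_def)
  qed
qed

subsection \<open>Homogeneous polynomials and their diagonal coefficients\<close>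

lemma coeff_prod_linear:
  fixes e :: "nat \<Rightarrow> complex"
  assumes "finite A"
  shows "coeff (\<Prod>i\<in>A. [:1, e i:] ^ \<alpha> i) 0 = 1"
    and "coeff (\<Prod>i\<in>A. [:1, e i:] ^ \<alpha> i) 1 = (\<Sum>i\<in>A. of_nat (\<alpha> i) * e i)"
proof -
  have c1: "coeff (p * q) 1 = coeff p 0 * coeff q 1 + coeff p 1 * coeff q 0" for p q :: "complex poly"
    by (simp add: coeff_mult)
  have pow0: "coeff ([:1, c:] ^ k) 0 = 1" for c :: complex and k
    by (induction k) (simp_all add: coeff_mult)
  have pow1: "coeff ([:1, c:] ^ k) 1 = of_nat k * c" for c :: complex and k
    by (induction k) (simp_all add: c1 pow0 algebra_simps del: One_nat_def, simp_all add: pow0)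
  show 0: "coeff (\<Prod>i\<in>A. [:1, e i:] ^ \<alpha> i) 0 = 1"
    using assms by (induction A rule: finite_induct) (simp_all add: coeff_mult pow0)
  show "coeff (\<Prod>i\<in>A. [:1, e i:] ^ \<alpha> i) 1 = (\<Sum>i\<in>A. of_nat (\<alpha> i) * e i)"
    using assms
  proof (induction A rule: finite_induct)
    case (insert x A)
    have "coeff (\<Prod>i\<in>A. [:1, e i:] ^ \<alpha> i) 0 = 1"
      using insert.hyps(1) by (induction A rule: finite_induct) (simp_all add: coeff_mult pow0)
    with insert show ?case
      by (simp add: c1 pow0 pow1 del: One_nat_def)
  qed simp
qed

text \<open>\<open>\<bar>P\<bar> \<le> 1\<close> on the unit ball of \<open>\<ell>\<^sub>p\<close>, extended by homogeneity, with \<open>\<kappa> = 1/p\<close>. For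
  \<open>\<kappa> = 0\<close> this is the polydisc, apart from \<open>0 powr 0 = 0\<close>, which forces \<open>z i = 0\<close> where
  \<open>t i = 0\<close>.\<close>
definition kappa_bounded :: "nat \<Rightarrow> nat \<Rightarrow> real \<Rightarrow> ((nat \<Rightarrow> nat) \<Rightarrow> complex) \<Rightarrow> bool" where
  "kappa_bounded n m \<kappa> b \<longleftrightarrow> (\<forall>t T z. (\<forall>i<n. 0 \<le> t i) \<and> (\<Sum>i<n. t i) \<le> T \<and> 0 < T \<and>
     (\<forall>i<n. cmod (z i) \<le> t i powr \<kappa>) \<longrightarrow> cmod (hpoly n m b z) \<le> T powr (real m * \<kappa>))"

definition diag_index :: "nat \<Rightarrow> nat \<Rightarrow> nat \<Rightarrow> nat" where
  "diag_index m j i = (if i = j then m else 0)"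

definition offdiag :: "nat \<Rightarrow> nat \<Rightarrow> (nat \<Rightarrow> nat) set" where
  "offdiag n m = {\<alpha>\<in>multi_indices n m. \<forall>i<n. \<alpha> i < m}"

lemma diag_index_in: "j < n \<Longrightarrow> diag_index m j \<in> multi_indices n m"
  by (auto simp: diag_index_def multi_indices_def)

lemma inj_on_diag_index: "1 \<le> m \<Longrightarrow> inj_on (diag_index m) {..<n}"
  by (auto simp: inj_on_def diag_index_def fun_eq_iff split: if_splits)

lemma multi_index_le: "\<alpha> \<in> multi_indices n m \<Longrightarrow> i < n \<Longrightarrow> \<alpha> i \<le> m"
  using member_le_sum[of i "{..<n}" \<alpha>] by (auto simp: multi_indices_def)

lemma multi_index_rest:
  "\<alpha> \<in> multi_indices n m \<Longrightarrow> j < n \<Longrightarrow> \<alpha> j + (\<Sum>i\<in>{..<n} - {j}. \<alpha> i) = m"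
  by (simp add: multi_indices_def sum.remove[symmetric, of "{..<n}" j \<alpha>])

lemma multi_index_eq_diag:
  assumes "\<alpha> \<in> multi_indices n m" "j < n" "\<alpha> j = m"
  shows "\<alpha> = diag_index m j"
proof
  fix i
  have "(\<Sum>i\<in>{..<n} - {j}. \<alpha> i) = 0"
    using multi_index_rest[OF assms(1,2)] assms(3) by simp
  then show "\<alpha> i = diag_index m j i"
    using assms by (cases "i < n") (auto simp: diag_index_def multi_indices_def)
qed

lemma multi_indices_subset_exponent_box: "multi_indices n m \<subseteq> exponent_box n m"
  using multi_index_le by (fastforce simp: exponent_box_def funs_upto_def multi_indices_def)

lemma hpoly_monom_at: "hpoly n m b z = (\<Sum>\<alpha>\<in>multi_indices n m. b \<alpha> * monom_at n z \<alpha>)"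
  by (simp add: hpoly_def monom_at_def)

definition real_monom :: "nat \<Rightarrow> (nat \<Rightarrow> real) \<Rightarrow> (nat \<Rightarrow> nat) \<Rightarrow> real" where
  "real_monom n v \<alpha> = (\<Prod>i<n. v i ^ \<alpha> i)"

lemma monom_at_mult: "monom_at n (\<lambda>i. y i * z i) \<alpha> = monom_at n y \<alpha> * monom_at n z \<alpha>"
  by (simp add: monom_at_def power_mult_distrib prod.distrib)

lemma monom_at_of_real: "monom_at n (\<lambda>i. of_real (v i)) \<alpha> = of_real (real_monom n v \<alpha>)"
  by (simp add: monom_at_def real_monom_def)

lemma real_monom_nonneg: "(\<And>i. 0 \<le> v i) \<Longrightarrow> 0 \<le> real_monom n v \<alpha>"
  by (simp add: real_monom_def prod_nonneg)

lemma real_monom_le: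
  assumes "\<alpha> \<in> multi_indices n m" and "\<And>i. i < n \<Longrightarrow> 0 \<le> x i \<and> x i \<le> g * v i"
  shows "real_monom n x \<alpha> \<le> g ^ m * real_monom n v \<alpha>"
proof -
  have "real_monom n x \<alpha> \<le> (\<Prod>i<n. (g * v i) ^ \<alpha> i)"
    unfolding real_monom_def using assms(2) by (intro prod_mono) (auto intro: power_mono)
  also have "\<dots> = g ^ m * real_monom n v \<alpha>"
    using assms(1) by (simp add: real_monom_def power_mult_distrib prod.distrib power_sum[symmetric] multi_indices_def)
  finally show ?thesis .
qed

lemma monom_at_diag_index: "j < n \<Longrightarrow> monom_at n z (diag_index m j) = z j ^ m"
  by (simp add: monom_at_def diag_index_def if_distrib[of "\<lambda>k. _ ^ k"] cong: if_cong)

lemma tavg_hpoly_coeff: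
  assumes "m < N" "j < n"
  shows "tavg N n (\<lambda>z. cnj (z j ^ m) * hpoly n m b z) = b (diag_index m j)"
proof -
  have N: "0 < N" using assms by simp
  have "tavg N n (\<lambda>z. cnj (z j ^ m) * hpoly n m b z) =
      tavg N n (\<lambda>z. \<Sum>\<alpha>\<in>multi_indices n m. b \<alpha> * (monom_at n z \<alpha> * cnj (monom_at n z (diag_index m j))))"
    unfolding hpoly_monom_at monom_at_diag_index[OF assms(2)] by (simp add: sum_distrib_left mult_ac)
  also have "\<dots> = (\<Sum>\<alpha>\<in>multi_indices n m. b \<alpha> * (if \<alpha> = diag_index m j then 1 else 0))"
    unfolding tavg_sum tavg_cmult
  proof (intro sum.cong refl)
    fix \<alpha> assume \<alpha>: "\<alpha> \<in> multi_indices n m"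
    have "\<alpha> = diag_index m j" if "\<forall>i<n. \<alpha> i mod N = diag_index m j i mod N"
      using that multi_index_le[OF \<alpha> assms(2)] assms
      by (intro multi_index_eq_diag[OF \<alpha> assms(2)]) (auto simp: diag_index_def dest: spec[of _ j])
    then show "b \<alpha> * tavg N n (\<lambda>z. monom_at n z \<alpha> * cnj (monom_at n z (diag_index m j))) =
        b \<alpha> * (if \<alpha> = diag_index m j then 1 else 0)"
      by (auto simp: tavg_character[OF N])
  qed
  also have "\<dots> = b (diag_index m j)"
    using diag_index_in[OF assms(2)] finite_multi_indices
    by (simp add: if_distrib[of "\<lambda>x. _ * x"] cong: if_cong)
  finally show ?thesis .
qed

section \<open>Phases, factorial quotients and slot weights\<close>

lemma ex_unimodular_mult_norm:
  obtains u :: complex where "cmod u = 1" "u * a = of_real (cmod a)"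
proof (cases "a = 0")
  case True
  then show ?thesis by (intro that[of 1]) auto
next
  case False
  have "cnj (sgn a) * a = of_real (cmod a)"
    using False complex_norm_square[of a] by (simp add: sgn_eq power2_eq_square field_simps)
  then show ?thesis
    using False by (intro that[of "cnj (sgn a)"]) (auto simp: norm_sgn)
qed

lemma prod_fact_le: "finite A \<Longrightarrow> (\<Prod>i\<in>A. fact (\<alpha> i)) \<le> (fact (\<Sum>i\<in>A. \<alpha> i) :: real)"
proof (induction A rule: finite_induct)
  case (insert x A)
  have "(\<Prod>i\<in>insert x A. fact (\<alpha> i)) \<le> fact (\<alpha> x) * (fact (\<Sum>i\<in>A. \<alpha> i) :: real)"
    using insert by (simp add: mult_left_mono)
  also have "\<dots> \<le> fact (\<alpha> x + (\<Sum>i\<in>A. \<alpha> i))"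
    using dvd_imp_le[OF fact_fact_dvd_fact[of "\<alpha> x" "\<Sum>i\<in>A. \<alpha> i", where 'a = nat]]
    by (metis fact_gt_zero of_nat_fact of_nat_le_iff of_nat_mult)
  finally show ?case using insert by simp
qed simp

lemma multi_fact_div_le:
  assumes "\<alpha> \<in> multi_indices n m" "j < n" "\<alpha> j = m - k" "k \<le> m"
  shows "multi_fact n \<alpha> / fact m \<le> 1 / real (m choose k)"
proof -
  have "(\<Sum>i\<in>{..<n} - {j}. \<alpha> i) = k"
    using multi_index_rest[OF assms(1,2)] assms(3,4) by simp
  then have "multi_fact n \<alpha> \<le> fact (m - k) * fact k"
    using prod_fact_le[of "{..<n} - {j}" \<alpha>] assms
    by (simp add: multi_fact_def prod.remove[of "{..<n}" j] mult_left_mono)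
  then have "multi_fact n \<alpha> / fact m \<le> (fact (m - k) * fact k) / fact m"
    by (intro divide_right_mono) auto
  also have "\<dots> = 1 / real (m choose k)"
    using assms by (simp add: binomial_fact field_simps)
  finally show ?thesis .
qed

text \<open>Only k = 1 and k = m - 1 reach the size 1/m; each of the m - 3 terms between them is at
  most 1 / (m choose 2).\<close>

lemma sum_inverse_binomial_le:
  assumes "3 \<le> m"
  shows "(\<Sum>k=1..m-1. 1 / real (m choose k)) \<le> 4 / real m"
proof -
  have "(\<Sum>k=1..m-1. 1 / real (m choose k)) =
      (\<Sum>k\<in>insert 1 (insert (m - 1) {2..m-2}). 1 / real (m choose k))"
    using assms by (intro sum.cong) auto
  also have "\<dots> = 2 / real m + (\<Sum>k=2..m-2. 1 / real (m choose k))"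
  proof -
    have "m choose (m - 1) = m"
      using binomial_symmetric[of 1 m] assms by simp
    moreover have "1 \<notin> insert (m - 1) {2..m-2}" "m - 1 \<notin> {2..m-2}"
      using assms by auto
    ultimately show ?thesis by simp
  qed
  also have "(\<Sum>k=2..m-2. 1 / real (m choose k)) \<le> (\<Sum>k=2..m-2. 2 / (real m * (real m - 1)))"
  proof (rule sum_mono)
    fix k assume k: "k \<in> {2..m-2}"
    have "m choose 2 \<le> m choose k"
    proof (cases "2 * k \<le> m")
      case True
      then show ?thesis using k by (intro binomial_mono) auto
    next
      case False
      then have "m choose 2 \<le> m choose (m - k)"
        using k by (intro binomial_mono) auto
      moreover have "k \<le> m" using k by auto
      ultimately show ?thesis
        using binomial_symmetric[of k m] by simp
    qed
    moreover have "real (m choose 2) = real m * (real m - 1) / 2"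
      using assms by (simp add: choose_two real_of_nat_div of_nat_diff)
    ultimately have "real m * (real m - 1) / 2 \<le> real (m choose k)"
      by (metis of_nat_le_iff)
    moreover have "0 < real m * (real m - 1) / 2"
      using assms by simp
    ultimately have "1 / real (m choose k) \<le> 1 / (real m * (real m - 1) / 2)"
      by (intro frac_le) auto
    then show "1 / real (m choose k) \<le> 2 / (real m * (real m - 1))" by simp
  qed
  also have "\<dots> = real (m - 3) * (2 / (real m * (real m - 1)))"
    using assms by (simp add: numeral_eq_Suc)
  also have "\<dots> \<le> (real m - 1) * (2 / (real m * (real m - 1)))"
    using assms by (intro mult_right_mono) auto
  also have "\<dots> = 2 / real m"
  proof -
    have cancel: "(r - 1) * (2 / (r * (r - 1))) = 2 / r" if "r \<noteq> 0" "r - 1 \<noteq> 0" for r :: real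
    proof -
      have "(r - 1) * (2 / (r * (r - 1))) = (r - 1) / (r - 1) * (2 / r)"
        by (simp only: times_divide_times_eq times_divide_eq_right times_divide_eq_left
          divide_divide_eq_left mult.commute[of r])
      then show ?thesis using that by simp
    qed
    show ?thesis using assms by (intro cancel) auto
  qed
  finally show ?thesis by simp
qed

lemma sum_slot_wt_ge:
  assumes m: "3 \<le> m" and \<alpha>: "\<alpha> \<in> multi_indices n m"
  shows "- 1 \<le> (\<Sum>j<n. real (\<alpha> j) / real m * ln (slot_wt n m j \<alpha>))"
proof (cases "\<exists>i<n. \<alpha> i = m - 1")
  case False
  then have "slot_wt n m j \<alpha> = 1" for j
    by (auto simp: slot_wt_def)
  then show ?thesis by simp
next
  case True
  then obtain i where i: "i < n" "\<alpha> i = m - 1" by auto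
  have rest: "(\<Sum>j\<in>{..<n} - {i}. \<alpha> j) = 1"
    using multi_index_rest[OF \<alpha> i(1)] i m by simp
  have "\<alpha> j \<le> 1" if "j < n" "j \<noteq> i" for j
    using member_le_sum[of j "{..<n} - {i}" \<alpha>] that rest by simp
  \<comment> \<open>Here m \<ge> 3 matters: for m = 2 both entries of e_i + e_j equal m - 1, and the
    slot i would lose weight too.\<close>
  then have "slot_wt n m i \<alpha> = 1"
    using m by (force simp: slot_wt_def)
  then have "(\<Sum>j<n. real (\<alpha> j) / real m * ln (slot_wt n m j \<alpha>)) =
      (\<Sum>j\<in>{..<n} - {i}. real (\<alpha> j) / real m * ln (slot_wt n m j \<alpha>))"
    using i by (simp add: sum.remove)
  also have "\<dots> \<ge> (\<Sum>j\<in>{..<n} - {i}. real (\<alpha> j) / real m * (- ln (real m)))"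
    using m by (intro sum_mono mult_left_mono) (auto simp: slot_wt_def ln_div)
  also have "(\<Sum>j\<in>{..<n} - {i}. real (\<alpha> j) / real m * (- ln (real m))) =
      real (\<Sum>j\<in>{..<n} - {i}. \<alpha> j) / real m * (- ln (real m))"
    by (simp add: sum_divide_distrib sum_distrib_right sum_negf)
  also have "\<dots> = - (ln (real m) / real m)"
    by (simp only: rest) simp
  also have "\<dots> \<ge> - 1"
    using m ln_le_minus_one[of "real m"] by (simp add: divide_le_eq)
  finally show ?thesis by simp
qed

subsection \<open>Polynomials with a large diagonal coefficient\<close>

text \<open>\<tau> is a positive upper bound for the deficit of the large coefficient and not the
  deficit itself, so that negative powers of \<tau> make sense even when the deficit is 0.\<close>

locale near_monomial =
  fixes n m i1 :: nat and \<kappa> \<tau> :: real and t :: "nat \<Rightarrow> real" and b :: "(nat \<Rightarrow> nat) \<Rightarrow> complex"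
  assumes m: "3 \<le> m" and i1: "i1 < n"
    and kappa: "0 \<le> \<kappa>" "real m * \<kappa> \<le> 1 / 2"
    and tau: "0 < \<tau>" "\<tau> \<le> 1" "1 - \<tau> \<le> cmod (b (diag_index m i1))"
    and t: "\<And>i. 0 \<le> t i" "(\<Sum>i<n. t i) = 1"
    and bounded: "kappa_bounded n m \<kappa> b"
begin

text \<open>Below, \<open>x\<close> is the rescaling produced by the Blei-type inequality. The polyradius \<open>y\<close> has
  \<open>i1\<close>-th entry \<open>1\<close>, so that the large coefficient is visible on it, at the price of shrinking
  the mass of \<open>t\<close> to \<open>\<tau>\<close>; passing from \<open>x\<close> to \<open>y\<close> costs a factor
  \<open>\<tau>\<^sup>-\<^sup>m\<^sup>\<kappa>\<close>.\<close>
definition x :: "nat \<Rightarrow> real" where "x i = t i powr \<kappa>"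
definition y :: "nat \<Rightarrow> real" where "y i = (if i = i1 then 1 else \<tau> powr \<kappa> * x i)"

lemma x_bounds: "0 \<le> x i" "i < n \<Longrightarrow> x i \<le> 1"
proof -
  assume "i < n"
  then have "t i \<le> 1"
    using member_le_sum[of i "{..<n}" t] t by simp
  then show "x i \<le> 1"
    unfolding x_def using t kappa by (intro powr_le1) auto
qed (simp add: x_def)

lemma dilation: "real m / (real m + 1) * (1 + 1 / real m) = 1"
proof -
  have "1 + 1 / real m = (real m + 1) / real m"
    using m by (simp add: add_divide_distrib)
  moreover have "real m + 1 \<noteq> 0" by linarith
  ultimately show ?thesis using m by simp
qed

lemma y_nonneg: "0 \<le> y i"
  by (simp add: y_def x_bounds)

lemma tau_powr_le_1: "\<tau> powr \<kappa> \<le> 1"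
  using tau kappa by (intro powr_le1) auto

text \<open>The polyradius y belongs to masses of total at most 1 + \<tau>, and m\<kappa> \<le> 1/2,
  that is p \<ge> 2m, turns this into the bound sqrt (1 + \<tau>).\<close>

lemma norm_hpoly_le:
  assumes "\<And>i. i < n \<Longrightarrow> cmod (z i) \<le> y i"
  shows "cmod (hpoly n m b z) \<le> 1 + \<tau> / 2"
proof -
  define t' where "t' = (\<lambda>i. if i = i1 then 1 else \<tau> * t i)"
  have "(\<Sum>i<n. t' i) = 1 + (\<Sum>i\<in>{..<n} - {i1}. \<tau> * t i)"
    using i1 by (simp add: t'_def sum.remove[of "{..<n}" i1])
  also have "(\<Sum>i\<in>{..<n} - {i1}. \<tau> * t i) \<le> (\<Sum>i<n. \<tau> * t i)"
    using t tau by (intro sum_mono2) auto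
  also have "\<dots> = \<tau>"
    by (simp add: sum_distrib_left[symmetric] t)
  finally have "(\<Sum>i<n. t' i) \<le> 1 + \<tau>" by simp
  moreover have "\<forall>i<n. 0 \<le> t' i"
    using t tau by (simp add: t'_def)
  moreover have "\<forall>i<n. cmod (z i) \<le> t' i powr \<kappa>"
  proof (intro allI impI)
    fix i assume "i < n"
    from assms[OF this] show "cmod (z i) \<le> t' i powr \<kappa>"
      using t tau by (simp add: t'_def y_def x_def powr_mult split: if_splits)
  qed
  ultimately have "cmod (hpoly n m b z) \<le> (1 + \<tau>) powr (real m * \<kappa>)"
    using bounded tau unfolding kappa_bounded_def by (meson add_pos_pos zero_less_one)
  also have "\<dots> \<le> (1 + \<tau>) powr (1 / 2)"
    using kappa tau by (intro powr_mono) auto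
  also have "\<dots> = sqrt (1 + \<tau>)"
    using tau by (simp add: powr_half_sqrt)
  also have "\<dots> \<le> 1 + \<tau> / 2"
    using tau by (intro real_le_lsqrt) (auto simp: power2_eq_square field_simps)
  finally show ?thesis .
qed

definition phase :: complex where
  "phase = (SOME u. cmod u = 1 \<and> u * b (diag_index m i1) = of_real (cmod (b (diag_index m i1))))"

lemma phase: "cmod phase = 1" "phase * b (diag_index m i1) = of_real (cmod (b (diag_index m i1)))"
proof -
  have "\<exists>u. cmod u = 1 \<and> u * b (diag_index m i1) = of_real (cmod (b (diag_index m i1)))"
    by (rule ex_unimodular_mult_norm) auto
  from someI_ex[OF this] show "cmod phase = 1"
    "phase * b (diag_index m i1) = of_real (cmod (b (diag_index m i1)))"
    by (auto simp: phase_def)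
qed

text \<open>The point z only supplies the unimodular factor inverse to z_i1^m. Keeping it apart from
  w makes the expression polynomial along curves of points w.\<close>

definition defect :: "(nat \<Rightarrow> complex) \<Rightarrow> (nat \<Rightarrow> complex) \<Rightarrow> complex" where
  "defect z w = of_real (1 + \<tau> / 2) - phase * cnj (z i1 ^ m) * hpoly n m b w"

lemma Re_defect_nonneg:
  assumes "cmod (z i1) = 1" "\<And>i. i < n \<Longrightarrow> cmod (w i) \<le> y i"
  shows "0 \<le> Re (defect z w)"
proof -
  have "Re (phase * cnj (z i1 ^ m) * hpoly n m b w) \<le> cmod (phase * cnj (z i1 ^ m) * hpoly n m b w)"
    by (rule complex_Re_le_cmod)
  also have "\<dots> \<le> 1 + \<tau> / 2"
    using norm_hpoly_le[OF assms(2)] by (simp add: norm_mult norm_power phase assms(1))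
  finally show ?thesis by (simp add: defect_def)
qed

text \<open>Shrinking by m/(m+1) leaves room for a dilation by 1 + 1/m inside the polyradius y. At
  degree m the loss is at most (1 + 1/m)^m \<le> 3.\<close>

definition v :: "nat \<Rightarrow> real" where
  "v i = (if i = i1 then 1 else y i * (real m / (real m + 1)))"

text \<open>This is (1/m) z_j dP/dz_j, taken at the point with coordinates v_i z_i.\<close>

definition slope :: "nat \<Rightarrow> (nat \<Rightarrow> complex) \<Rightarrow> complex" where
  "slope j z = (\<Sum>\<alpha>\<in>multi_indices n m. b \<alpha> * of_real (real (\<alpha> j) / real m * real_monom n v \<alpha>) * monom_at n z \<alpha>)"

text \<open>Moving the coordinates other than \<open>i1\<close> of the point \<open>v z\<close> by the relative amount
  \<open>s e\<close> keeps it in the domain as long as \<open>\<bar>s\<bar> \<le> 1/m\<close>; the derivative at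
  \<open>s = 0\<close> of the resulting polynomial of nonnegative real part is controlled by its value there.\<close>
lemma sum_norm_slope_le:
  assumes z: "\<And>i. cmod (z i) = 1"
  shows "(\<Sum>j\<in>{..<n} - {i1}. cmod (slope j z)) \<le> 2 * Re (defect z (\<lambda>i. of_real (v i) * z i))"
proof -
  have "\<forall>j. \<exists>u. cmod u = 1 \<and> u * slope j z = of_real (cmod (slope j z))"
    using ex_unimodular_mult_norm by metis
  then obtain u where u: "\<And>j. cmod (u j) = 1" "\<And>j. u j * slope j z = of_real (cmod (slope j z))"
    by metis
  \<comment> \<open>These phases align the partial derivatives: up to a unimodular factor, the
    linear coefficient in s is m times the sum of the moduli, and the radius 1/m in Caratheodory's
    bound removes the m.\<close>
  define e where "e = (\<lambda>i. if i = i1 then 0 else u i)"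
  define c where "c = (\<lambda>\<alpha>. b \<alpha> * of_real (real_monom n v \<alpha>) * monom_at n z \<alpha>)"
  define f where "f = phase * cnj (z i1 ^ m)"
  define p where "p = [:of_real (1 + \<tau> / 2):] -
    smult f (\<Sum>\<alpha>\<in>multi_indices n m. smult (c \<alpha>) (\<Prod>i<n. [:1, e i:] ^ \<alpha> i))"
  have f: "cmod f = 1"
    by (simp add: f_def norm_mult norm_power phase z)
  have poly_p: "poly p s = defect z (\<lambda>i. of_real (v i) * z i * (1 + s * e i))" for s
    by (simp add: p_def defect_def f_def hpoly_monom_at poly_sum poly_prod c_def monom_at_mult
        monom_at_of_real mult.assoc mult.left_commute) (simp add: monom_at_def)
  have "cmod (coeff p 1) * (1 / real m) ^ 1 \<le> 2 * Re (coeff p 0)"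
  proof (rule caratheodory_coeff_le)
    fix \<zeta> :: complex assume "cmod \<zeta> = 1"
    then have "cmod (1 + of_real (1 / real m) * \<zeta> * e i) \<le> 1 + 1 / real m" for i
      using norm_triangle_ineq[of 1 "of_real (1 / real m) * \<zeta> * e i"] u(1)[of i]
      by (auto simp: norm_mult norm_divide e_def)
    then have "cmod (of_real (v i) * z i * (1 + of_real (1 / real m) * \<zeta> * e i)) \<le> y i" for i
    proof (cases "i = i1")
      case True
      then show ?thesis by (simp add: v_def y_def z e_def norm_mult)
    next
      case False
      have "cmod (of_real (v i) * z i * (1 + of_real (1 / real m) * \<zeta> * e i)) =
          v i * cmod (1 + of_real (1 / real m) * \<zeta> * e i)"
        using y_nonneg[of i] by (simp add: norm_mult z v_def)
      also have "\<dots> \<le> v i * (1 + 1 / real m)"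
        using y_nonneg[of i]
        by (intro mult_left_mono \<open>\<And>i. cmod (1 + of_real (1 / real m) * \<zeta> * e i) \<le> 1 + 1 / real m\<close>)
          (simp add: v_def)
      also have "\<dots> = y i * (real m / (real m + 1) * (1 + 1 / real m))"
        using False by (simp add: v_def)
      finally show ?thesis by (simp only: dilation mult_1_right)
    qed
    then show "0 \<le> Re (poly p (of_real (1 / real m) * \<zeta>))"
      unfolding poly_p by (intro Re_defect_nonneg z)
  qed auto
  also have "coeff p 0 = defect z (\<lambda>i. of_real (v i) * z i)"
    using poly_p[of 0] by (simp add: poly_0_coeff_0)
  also have "cmod (coeff p 1) * (1 / real m) ^ 1 = (\<Sum>j\<in>{..<n} - {i1}. cmod (slope j z))"
  proof -
    have "coeff p 1 = - f * (\<Sum>\<alpha>\<in>multi_indices n m. c \<alpha> * (\<Sum>i<n. of_nat (\<alpha> i) * e i))"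
      by (simp add: p_def coeff_sum coeff_prod_linear(2)[unfolded One_nat_def] coeff_pCons)
    also have "(\<Sum>\<alpha>\<in>multi_indices n m. c \<alpha> * (\<Sum>i<n. of_nat (\<alpha> i) * e i)) =
        (\<Sum>i<n. \<Sum>\<alpha>\<in>multi_indices n m. e i * (c \<alpha> * of_nat (\<alpha> i)))"
      unfolding sum_distrib_left by (subst sum.swap) (simp add: mult_ac)
    also have "\<dots> = (\<Sum>i<n. e i * (of_nat m * slope i z))"
      using m by (intro sum.cong refl) (simp add: slope_def c_def sum_distrib_left mult_ac)
    also have "\<dots> = (\<Sum>i\<in>{..<n} - {i1}. of_nat m * (u i * slope i z))"
      using i1 by (simp add: sum.remove[of "{..<n}" i1] e_def mult_ac)
    also have "\<dots> = of_real (real m * (\<Sum>j\<in>{..<n} - {i1}. cmod (slope j z)))"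
      by (simp add: u sum_distrib_left)
    finally have "cmod (coeff p 1) = real m * (\<Sum>j\<in>{..<n} - {i1}. cmod (slope j z))"
      using f by (simp add: norm_mult sum_nonneg del: of_real_mult of_real_sum)
    then show ?thesis using m by simp
  qed
  finally show ?thesis .
qed

lemma tavg_Re_defect:
  assumes N: "m < N"
  shows "tavg N n (\<lambda>z. Re (defect z (\<lambda>i. of_real (v i) * z i))) \<le> 3 / 2 * \<tau>"
proof -
  have N0: "0 < N" using N by simp
  define b' where "b' = (\<lambda>\<alpha>. b \<alpha> * of_real (real_monom n v \<alpha>))"
  have hp: "hpoly n m b (\<lambda>i. of_real (v i) * z i) = hpoly n m b' z" for z
    by (simp add: hpoly_monom_at monom_at_mult monom_at_of_real b'_def mult.assoc)
  have diag: "b' (diag_index m i1) = b (diag_index m i1)"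
    using i1 by (simp add: b'_def real_monom_def diag_index_def v_def
        if_distrib[of "\<lambda>k. _ ^ k"] cong: if_cong)
  have "tavg N n (\<lambda>z. defect z (\<lambda>i. of_real (v i) * z i)) =
      tavg N n (\<lambda>z. of_real (1 + \<tau> / 2)) - phase * tavg N n (\<lambda>z. cnj (z i1 ^ m) * hpoly n m b' z)"
    unfolding tavg_cmult[symmetric] tavg_diff[symmetric] by (simp add: defect_def hp mult.assoc)
  also have "\<dots> = of_real (1 + \<tau> / 2 - cmod (b (diag_index m i1)))"
    by (simp only: tavg_const[OF N0] tavg_hpoly_coeff[OF N i1] diag phase) simp
  finally have "Re (tavg N n (\<lambda>z. defect z (\<lambda>i. of_real (v i) * z i))) =
      1 + \<tau> / 2 - cmod (b (diag_index m i1))" by simp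
  then show ?thesis
    using tau(3) by (simp add: Re_tavg)
qed

lemma sum_tavg_slope_le:
  assumes N: "m < N"
  shows "(\<Sum>j\<in>{..<n} - {i1}. tavg N n (\<lambda>z. cmod (slope j z))) \<le> 3 * \<tau>"
proof -
  have N0: "0 < N" using N by simp
  have "(\<Sum>j\<in>{..<n} - {i1}. tavg N n (\<lambda>z. cmod (slope j z))) =
      tavg N n (\<lambda>z. \<Sum>j\<in>{..<n} - {i1}. cmod (slope j z))"
    by (simp add: tavg_sum)
  also have "\<dots> \<le> tavg N n (\<lambda>z. 2 * Re (defect z (\<lambda>i. of_real (v i) * z i)))"
    by (intro tavg_mono sum_norm_slope_le norm_grid[OF N0])
  also have "\<dots> \<le> 3 * \<tau>"
    using tavg_Re_defect[OF N] by (simp add: tavg_cmult)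
  finally show ?thesis .
qed

section \<open>Layers by the degree missing from the distinguished variable\<close>

definition layer :: "nat \<Rightarrow> (nat \<Rightarrow> nat) set" where
  "layer k = {\<alpha>\<in>multi_indices n m. \<alpha> i1 = m - k}"

text \<open>Multiplying all coordinates except i1 by s turns the defect into a polynomial in s. Its
  k-th coefficient is, up to a unimodular factor, the sum over layer k, so Caratheodory's bound on
  the unit circle applies.\<close>

lemma norm_layer_le:
  assumes z: "\<And>i. cmod (z i) = 1" and k: "1 \<le> k" "k \<le> m"
  shows "cmod (\<Sum>\<alpha>\<in>layer k. b \<alpha> * of_real (real_monom n y \<alpha>) * monom_at n z \<alpha>) \<le> 3 * \<tau>"
proof -
  define c where "c = (\<lambda>\<alpha>. b \<alpha> * of_real (real_monom n y \<alpha>) * monom_at n z \<alpha>)"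
  define f where "f = phase * cnj (z i1 ^ m)"
  define p where "p = [:of_real (1 + \<tau> / 2):] -
    smult f (\<Sum>\<alpha>\<in>multi_indices n m. monom (c \<alpha>) (m - \<alpha> i1))"
  have f: "cmod f = 1"
    by (simp add: f_def norm_mult norm_power phase z)
  have poly_p: "poly p s = defect z (\<lambda>i. of_real (y i) * z i * (if i = i1 then 1 else s))" for s
  proof -
    have "monom_at n (\<lambda>i. if i = i1 then 1 else s) \<alpha> = s ^ (m - \<alpha> i1)"
      if "\<alpha> \<in> multi_indices n m" for \<alpha>
    proof -
      have "monom_at n (\<lambda>i. if i = i1 then 1 else s) \<alpha> = (\<Prod>i\<in>{..<n} - {i1}. s ^ \<alpha> i)"
        using i1 by (simp add: monom_at_def prod.remove[of "{..<n}" i1])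
      also have "\<dots> = s ^ (\<Sum>i\<in>{..<n} - {i1}. \<alpha> i)"
        by (simp add: power_sum)
      also have "(\<Sum>i\<in>{..<n} - {i1}. \<alpha> i) = m - \<alpha> i1"
        using multi_index_rest[OF that i1] by simp
      finally show ?thesis .
    qed
    then show ?thesis
      by (simp add: p_def defect_def f_def hpoly_monom_at poly_sum poly_monom c_def monom_at_mult
        monom_at_of_real mult.assoc)
  qed
  have coeff_p: "coeff p l = (if l = 0 then of_real (1 + \<tau> / 2) else 0) - f * (\<Sum>\<alpha>\<in>layer l. c \<alpha>)"
    if "l \<le> m" for l
  proof -
    have "(\<Sum>\<alpha>\<in>multi_indices n m. if m - \<alpha> i1 = l then c \<alpha> else 0) = (\<Sum>\<alpha>\<in>layer l. c \<alpha>)"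
      unfolding layer_def using that finite_multi_indices
      by (subst sum.inter_filter[symmetric])
        (auto intro!: sum.cong dest: multi_index_le[OF _ i1])
    then show ?thesis
      by (simp add: p_def coeff_sum coeff_pCons split: nat.split)
  qed
  have "cmod (coeff p k) * 1 ^ k \<le> 2 * Re (coeff p 0)"
  proof (rule caratheodory_coeff_le)
    fix \<zeta> :: complex assume "cmod \<zeta> = 1"
    then show "0 \<le> Re (poly p (of_real 1 * \<zeta>))"
      unfolding poly_p using y_nonneg by (intro Re_defect_nonneg z) (simp add: norm_mult z)
  qed (use k in auto)
  also have "coeff p 0 = of_real (1 + \<tau> / 2 - cmod (b (diag_index m i1)))"
  proof -
    have "layer 0 = {diag_index m i1}"
      using multi_index_eq_diag[OF _ i1] diag_index_in[OF i1] by (auto simp: layer_def diag_index_def)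
    moreover have "real_monom n y (diag_index m i1) = 1"
      using i1 by (simp add: real_monom_def diag_index_def y_def
        if_distrib[of "\<lambda>k. _ ^ k"] cong: if_cong)
    ultimately have "f * (\<Sum>\<alpha>\<in>layer 0. c \<alpha>) =
        (phase * b (diag_index m i1)) * (z i1 ^ m * cnj (z i1 ^ m))"
      by (simp add: c_def f_def monom_at_diag_index[OF i1] mult_ac)
    also have "\<dots> = of_real (cmod (b (diag_index m i1)))"
      using unimodular_mult_cnj[of "z i1 ^ m"] by (simp only: phase z norm_power) simp
    finally show ?thesis using coeff_p[of 0] by simp
  qed
  also have "2 * Re (of_real (1 + \<tau> / 2 - cmod (b (diag_index m i1)))) \<le> 3 * \<tau>"
    using tau(3) by simp
  finally show ?thesis
    using k coeff_p[of k] f by (simp add: norm_mult c_def)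
qed

lemma sum_layer_le:
  assumes "1 \<le> k" "k \<le> m"
  shows "(\<Sum>\<alpha>\<in>layer k. (cmod (b \<alpha>) * real_monom n y \<alpha>)\<^sup>2) \<le> 9 * \<tau>\<^sup>2"
proof -
  let ?N = "m + 1"
  have "layer k \<subseteq> exponent_box n m"
    using multi_indices_subset_exponent_box by (auto simp: layer_def)
  then have "(\<Sum>\<alpha>\<in>layer k. (cmod (b \<alpha> * of_real (real_monom n y \<alpha>)))\<^sup>2) =
     tavg ?N n (\<lambda>z. (cmod (\<Sum>\<alpha>\<in>layer k. b \<alpha> * of_real (real_monom n y \<alpha>) * monom_at n z \<alpha>))\<^sup>2)"
    by (intro tavg_bessel[symmetric]) auto
  also have "\<dots> \<le> tavg ?N n (\<lambda>z. (3 * \<tau>)\<^sup>2)"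
    by (intro tavg_mono power_mono norm_layer_le assms norm_grid[of ?N]) auto
  also have "\<dots> = 9 * \<tau>\<^sup>2"
    by (subst tavg_const) (auto simp: power2_eq_square)
  finally show ?thesis
    by (simp add: norm_mult real_monom_nonneg y_nonneg)
qed

section \<open>The right-hand side of the entropy inequality\<close>

definition slot_term :: "nat \<Rightarrow> (nat \<Rightarrow> nat) \<Rightarrow> real" where
  "slot_term j \<alpha> = slot_wt n m j \<alpha> * (multi_fact n \<alpha> / fact m) * (real (\<alpha> j) / real m) *
     (cmod (b \<alpha>))\<^sup>2 * (\<Prod>i<n. (t i powr \<kappa>) ^ (2 * \<alpha> i))"

lemma slot_term_eq:
  "slot_term j \<alpha> = slot_wt n m j \<alpha> * (multi_fact n \<alpha> / fact m) * (real (\<alpha> j) / real m) *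
     (cmod (b \<alpha>) * real_monom n x \<alpha>)\<^sup>2"
proof -
  have "(\<Prod>i<n. (t i powr \<kappa>) ^ (2 * \<alpha> i)) = (real_monom n x \<alpha>)\<^sup>2"
    by (simp add: real_monom_def x_def prod_power_distrib power_mult[symmetric] mult.commute)
  then show ?thesis by (simp add: slot_term_def power_mult_distrib)
qed

lemma slot_wt_bounds: "0 \<le> slot_wt n m j \<alpha>" "slot_wt n m j \<alpha> \<le> 1"
  using m by (auto simp: slot_wt_def)

text \<open>Replacing x by v costs g^m \<le> 3 \<tau>^(-m\<kappa>). The slot weights are then
  dominated by (1/m) times products of \<open>coeff_wt\<close>, for which the l2 norm of the
  coefficients of \<open>slope j\<close> is at most its L1 norm. The constant is 954 = 9 *
  106.\<close>

lemma sum_slot_term_other: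
  assumes K: "264 \<le> K" and j: "j < n" "j \<noteq> i1" and N: "2 * m < N"
  shows "(\<Sum>\<alpha>\<in>offdiag n m. slot_term j \<alpha>) \<le>
    954 * real K ^ (1 + K) / real m * (\<tau> powr (- real m * \<kappa>) * tavg N n (\<lambda>z. cmod (slope j z)))\<^sup>2"
proof -
  define L where "L = 106 * real K ^ (1 + K) / real m"
  define g where "g = \<tau> powr (- \<kappa>) * (1 + 1 / real m)"
  define W where "W = (\<lambda>\<alpha>. \<Prod>i<n. coeff_wt m (\<alpha> i - unit_index j i))"
  define h where "h = (\<lambda>\<alpha>. real (\<alpha> j) / real m * real_monom n v \<alpha>)"
  define b' where "b' = (\<lambda>\<alpha>. if \<alpha> \<in> multi_indices n m then b \<alpha> * of_real (h \<alpha>) else 0)"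
  have L: "0 \<le> L" by (simp add: L_def)
  have W: "0 \<le> W \<alpha>" for \<alpha>
    by (auto simp: W_def intro!: prod_nonneg less_imp_le[OF coeff_wt_pos])
  have v0: "0 \<le> v i" for i
    using y_nonneg by (simp add: v_def)
  have h0: "0 \<le> h \<alpha>" for \<alpha>
    by (simp add: h_def real_monom_nonneg v0)
  have tau_inv: "1 \<le> \<tau> powr (- \<kappa>)"
    using tau_powr_le_1 tau by (simp add: powr_minus one_le_inverse_iff)
  have gm: "g ^ m \<le> 3 * \<tau> powr (- real m * \<kappa>)"
  proof -
    have pw: "(\<tau> powr (- \<kappa>)) ^ m = \<tau> powr (- real m * \<kappa>)"
      using tau by (simp add: powr_realpow[symmetric] powr_powr mult.commute)
    have "(1 + 1 / real m) ^ m \<le> exp (1 / real m) ^ m"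
      using exp_ge_add_one_self[of "1 / real m"] by (intro power_mono) auto
    also have "\<dots> = exp 1"
      using m by (simp add: exp_of_nat_mult[symmetric])
    also have "\<dots> \<le> 3" by (rule exp_le)
    finally have "(1 + 1 / real m) ^ m \<le> 3" .
    then have "(\<tau> powr (- \<kappa>)) ^ m * (1 + 1 / real m) ^ m \<le> (\<tau> powr (- \<kappa>)) ^ m * 3"
      by (intro mult_left_mono) auto
    then show ?thesis
      unfolding g_def power_mult_distrib pw by (simp only: mult.commute)
  qed
  have xg: "0 \<le> x i \<and> x i \<le> g * v i" if "i < n" for i
  proof (cases "i = i1")
    case True
    have "1 * 1 \<le> \<tau> powr (- \<kappa>) * (1 + 1 / real m)"
      using tau_inv by (intro mult_mono) auto
    then show ?thesis
      using x_bounds(1)[of i] x_bounds(2)[OF that] True by (simp add: g_def v_def)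
  next
    case False
    have "\<tau> powr (- \<kappa>) * \<tau> powr \<kappa> = 1"
      using tau by (simp add: powr_add[symmetric])
    moreover have "(1 + 1 / real m) * (real m / (real m + 1)) = 1"
      using dilation by (simp only: mult.commute)
    moreover have "g * v i = (\<tau> powr (- \<kappa>) * \<tau> powr \<kappa>) *
        ((1 + 1 / real m) * (real m / (real m + 1))) * x i"
      using False by (simp add: g_def v_def y_def mult_ac)
    ultimately have "g * v i = x i"
      by (simp only: mult_1)
    then show ?thesis using x_bounds(1)[of i] by simp
  qed
  have termwise: "slot_term j \<alpha> \<le> L * (9 * (\<tau> powr (- real m * \<kappa>))\<^sup>2) * (W \<alpha> * (cmod (b \<alpha>) * h \<alpha>)\<^sup>2)"
    if \<alpha>: "\<alpha> \<in> offdiag n m" for \<alpha>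
  proof (cases "\<alpha> j = 0")
    case True
    then show ?thesis by (simp add: slot_term_def h_def)
  next
    case False
    have mi: "\<alpha> \<in> multi_indices n m" and off: "\<And>i. i < n \<Longrightarrow> \<alpha> i < m"
      using \<alpha> by (auto simp: offdiag_def)
    have "real_monom n x \<alpha> \<le> g ^ m * real_monom n v \<alpha>"
      by (intro real_monom_le[OF mi] xg)
    also have "\<dots> \<le> (3 * \<tau> powr (- real m * \<kappa>)) * real_monom n v \<alpha>"
      by (intro mult_right_mono gm real_monom_nonneg v0)
    finally have mon: "(cmod (b \<alpha>) * real_monom n x \<alpha>)\<^sup>2 \<le>
        (cmod (b \<alpha>) * ((3 * \<tau> powr (- real m * \<kappa>)) * real_monom n v \<alpha>))\<^sup>2"
      by (intro power_mono mult_left_mono) (auto simp: real_monom_nonneg x_bounds)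
    have "slot_term j \<alpha> \<le> (L * ((real (\<alpha> j) / real m)\<^sup>2 * W \<alpha>)) *
        (cmod (b \<alpha>) * ((3 * \<tau> powr (- real m * \<kappa>)) * real_monom n v \<alpha>))\<^sup>2"
      unfolding slot_term_eq
    proof (rule mult_mono[OF _ mon])
      show "slot_wt n m j \<alpha> * (multi_fact n \<alpha> / fact m) * (real (\<alpha> j) / real m) \<le>
          L * ((real (\<alpha> j) / real m)\<^sup>2 * W \<alpha>)"
        unfolding L_def W_def using False m j
        by (intro slot_wt_multi_fact_le[OF K _ mi off]) auto
    qed (use L W in auto)
    also have "\<dots> = L * (9 * (\<tau> powr (- real m * \<kappa>))\<^sup>2) * (W \<alpha> * (cmod (b \<alpha>) * h \<alpha>)\<^sup>2)"
      by (simp add: h_def power_mult_distrib power_divide mult_ac)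
    finally show ?thesis .
  qed
  have "(\<Sum>\<alpha>\<in>offdiag n m. slot_term j \<alpha>) \<le>
      (\<Sum>\<alpha>\<in>offdiag n m. L * (9 * (\<tau> powr (- real m * \<kappa>))\<^sup>2) * (W \<alpha> * (cmod (b \<alpha>) * h \<alpha>)\<^sup>2))"
    by (intro sum_mono termwise)
  also have "\<dots> = L * (9 * (\<tau> powr (- real m * \<kappa>))\<^sup>2) *
      (\<Sum>\<alpha>\<in>offdiag n m. W \<alpha> * (cmod (b' \<alpha>))\<^sup>2)"
    unfolding sum_distrib_left
    by (intro sum.cong refl) (auto simp: b'_def offdiag_def norm_mult h0)
  also have "\<dots> \<le> L * (9 * (\<tau> powr (- real m * \<kappa>))\<^sup>2) * (\<Sum>\<alpha>\<in>exponent_box n m. W \<alpha> * (cmod (b' \<alpha>))\<^sup>2)"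
    using multi_indices_subset_exponent_box finite_funs_upto[of "{..m}" n 0] L W
    by (intro mult_left_mono sum_mono2) (auto simp: offdiag_def exponent_box_def)
  also have "\<dots> \<le> L * (9 * (\<tau> powr (- real m * \<kappa>))\<^sup>2) *
      (tavg N n (\<lambda>z. cmod (\<Sum>\<alpha>\<in>exponent_box n m. b' \<alpha> * monom_at n z \<alpha>)))\<^sup>2"
    unfolding W_def
  proof (intro mult_left_mono weighted_coeffs_le_tavg N)
    show "(\<Sum>k = 1..m. coeff_wt m k) \<le> 1 / 4" by (rule sum_coeff_wt_le)
    show "unit_index j i \<le> m" for i using m by (simp add: unit_index_def)
    \<comment> \<open>Every monomial present in \<open>slope j\<close> contains z_j, so exponents in
      coordinate j start at 1 and the weights count from there.\<close>
    show "b' \<alpha> = 0" if "i < n" "\<alpha> i < unit_index j i" for \<alpha> i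
      using that by (auto simp: b'_def h_def unit_index_def split: if_splits)
  qed (use L coeff_wt_pos in \<open>auto simp: coeff_wt_def less_imp_le\<close>)
  also have "(\<lambda>z. cmod (\<Sum>\<alpha>\<in>exponent_box n m. b' \<alpha> * monom_at n z \<alpha>)) = (\<lambda>z. cmod (slope j z))"
  proof
    fix z
    have "(\<Sum>\<alpha>\<in>exponent_box n m. b' \<alpha> * monom_at n z \<alpha>) = (\<Sum>\<alpha>\<in>multi_indices n m. b' \<alpha> * monom_at n z \<alpha>)"
      using multi_indices_subset_exponent_box finite_funs_upto[of "{..m}" n 0]
      by (intro sum.mono_neutral_right) (auto simp: b'_def exponent_box_def)
    then show "cmod (\<Sum>\<alpha>\<in>exponent_box n m. b' \<alpha> * monom_at n z \<alpha>) = cmod (slope j z)"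
      by (simp add: b'_def slope_def h_def)
  qed
  finally show ?thesis
    by (simp add: L_def power_mult_distrib mult_ac)
qed

text \<open>\<open>slope i1\<close> contains the large coefficient and is not small. Instead, layer
  k has l2 mass of order \<tau> and Bombieri weight at most 1 / (m choose k), and these reciprocals
  sum to O(1/m).\<close>

lemma sum_slot_term_i1:
  "(\<Sum>\<alpha>\<in>offdiag n m. slot_term i1 \<alpha>) \<le> 36 / real m * (\<tau> powr (- real m * \<kappa>) * \<tau>)\<^sup>2"
proof -
  define g where "g = \<tau> powr (- \<kappa>)"
  have g: "1 \<le> g"
    using tau_powr_le_1 tau by (simp add: g_def powr_minus one_le_inverse_iff)
  have gm: "g ^ m = \<tau> powr (- real m * \<kappa>)"
    using tau by (simp add: g_def powr_realpow[symmetric] powr_powr mult.commute)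
  have xg: "0 \<le> x i \<and> x i \<le> g * y i" if "i < n" for i
  proof (cases "i = i1")
    case True
    then show ?thesis
      using g x_bounds(1)[of i] x_bounds(2)[OF that] by (simp add: y_def)
  next
    case False
    have "g * \<tau> powr \<kappa> = 1"
      using tau by (simp add: g_def powr_add[symmetric])
    then show ?thesis
      using False x_bounds(1)[of i] by (simp add: y_def mult.assoc[symmetric])
  qed
  have termwise: "slot_term i1 \<alpha> \<le> 1 / real (m choose k) * ((g ^ m)\<^sup>2 * (cmod (b \<alpha>) * real_monom n y \<alpha>)\<^sup>2)"
    if \<alpha>: "\<alpha> \<in> layer k" and k: "k \<le> m" for \<alpha> k
  proof -
    have mi: "\<alpha> \<in> multi_indices n m" "\<alpha> i1 = m - k"
      using \<alpha> by (auto simp: layer_def)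
    have "slot_wt n m i1 \<alpha> * (multi_fact n \<alpha> / fact m) * (real (\<alpha> i1) / real m) \<le>
        1 * (1 / real (m choose k)) * 1"
    proof (intro mult_mono)
      show "multi_fact n \<alpha> / fact m \<le> 1 / real (m choose k)"
        by (rule multi_fact_div_le[OF mi(1) i1 mi(2) k])
    qed (use slot_wt_bounds multi_fact_pos[of n \<alpha>] multi_index_le[OF mi(1) i1] m in auto)
    moreover have "(cmod (b \<alpha>) * real_monom n x \<alpha>)\<^sup>2 \<le> (cmod (b \<alpha>) * (g ^ m * real_monom n y \<alpha>))\<^sup>2"
      by (intro power_mono mult_left_mono real_monom_le[OF mi(1)] xg)
        (auto simp: real_monom_nonneg x_bounds)
    ultimately have "slot_term i1 \<alpha> \<le> 1 * (1 / real (m choose k)) * 1 *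
        (cmod (b \<alpha>) * (g ^ m * real_monom n y \<alpha>))\<^sup>2"
      unfolding slot_term_eq by (rule mult_mono) auto
    then show ?thesis by (simp add: power_mult_distrib mult_ac)
  qed
  have nonneg: "0 \<le> slot_term i1 \<alpha>" for \<alpha>
    unfolding slot_term_eq using slot_wt_bounds multi_fact_pos[of n \<alpha>]
    by (intro mult_nonneg_nonneg) auto
  have fin: "finite (layer k)" for k
    by (rule finite_subset[OF _ finite_multi_indices]) (auto simp: layer_def)
  have "(\<Sum>\<alpha>\<in>offdiag n m. slot_term i1 \<alpha>) \<le> (\<Sum>\<alpha>\<in>(\<Union>k\<in>{1..m-1}. layer k). slot_term i1 \<alpha>)"
  proof -
    have "slot_term i1 \<alpha> = 0" if "\<alpha> \<in> offdiag n m - (\<Union>k\<in>{1..m-1}. layer k)" for \<alpha>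
    proof -
      have \<alpha>: "\<alpha> \<in> multi_indices n m" "\<alpha> i1 < m"
        using that i1 by (auto simp: offdiag_def)
      have "\<alpha> \<in> layer (m - \<alpha> i1)"
        using \<alpha> by (simp add: layer_def)
      with that \<alpha> have "\<not> (1 \<le> m - \<alpha> i1 \<and> m - \<alpha> i1 \<le> m - 1)"
        by auto
      with \<alpha> have "\<alpha> i1 = 0" by auto
      then show ?thesis by (simp add: slot_term_def)
    qed
    moreover have "finite (offdiag n m)"
      by (rule finite_subset[OF _ finite_multi_indices]) (auto simp: offdiag_def)
    ultimately have "(\<Sum>\<alpha>\<in>offdiag n m. slot_term i1 \<alpha>) =
        (\<Sum>\<alpha>\<in>offdiag n m \<inter> (\<Union>k\<in>{1..m-1}. layer k). slot_term i1 \<alpha>)"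
      by (intro sum.mono_neutral_right) auto
    also have "\<dots> \<le> (\<Sum>\<alpha>\<in>(\<Union>k\<in>{1..m-1}. layer k). slot_term i1 \<alpha>)"
      using fin nonneg by (intro sum_mono2) auto
    finally show ?thesis .
  qed
  also have "\<dots> = (\<Sum>k=1..m-1. \<Sum>\<alpha>\<in>layer k. slot_term i1 \<alpha>)"
    using fin by (intro sum.UNION_disjoint) (auto simp: layer_def)
  also have "\<dots> \<le> (\<Sum>k=1..m-1. 1 / real (m choose k) * ((g ^ m)\<^sup>2 * (9 * \<tau>\<^sup>2)))"
  proof (rule sum_mono)
    fix k assume k: "k \<in> {1..m-1}"
    have "(\<Sum>\<alpha>\<in>layer k. slot_term i1 \<alpha>) \<le>
        (\<Sum>\<alpha>\<in>layer k. 1 / real (m choose k) * ((g ^ m)\<^sup>2 * (cmod (b \<alpha>) * real_monom n y \<alpha>)\<^sup>2))"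
      using k by (intro sum_mono termwise) auto
    also have "\<dots> = 1 / real (m choose k) * ((g ^ m)\<^sup>2 * (\<Sum>\<alpha>\<in>layer k. (cmod (b \<alpha>) * real_monom n y \<alpha>)\<^sup>2))"
      by (simp add: sum_distrib_left)
    also have "\<dots> \<le> 1 / real (m choose k) * ((g ^ m)\<^sup>2 * (9 * \<tau>\<^sup>2))"
      using k by (intro mult_left_mono sum_layer_le) auto
    finally show "(\<Sum>\<alpha>\<in>layer k. slot_term i1 \<alpha>) \<le> 1 / real (m choose k) * ((g ^ m)\<^sup>2 * (9 * \<tau>\<^sup>2))" .
  qed
  also have "\<dots> = (\<Sum>k=1..m-1. 1 / real (m choose k)) * ((g ^ m)\<^sup>2 * (9 * \<tau>\<^sup>2))"
    by (rule sum_distrib_right[symmetric])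
  also have "\<dots> \<le> 4 / real m * ((g ^ m)\<^sup>2 * (9 * \<tau>\<^sup>2))"
    by (intro mult_right_mono sum_inverse_binomial_le m) auto
  also have "\<dots> = 36 / real m * (\<tau> powr (- real m * \<kappa>) * \<tau>)\<^sup>2"
    by (simp add: gm power_mult_distrib)
  finally show ?thesis .
qed

lemma sum_sqrt_slot_terms_le:
  assumes K: "264 \<le> K"
  shows "(\<Sum>j<n. sqrt (\<Sum>\<alpha>\<in>offdiag n m. slot_term j \<alpha>)) \<le>
    (6 + 3 * sqrt (954 * real K ^ (1 + K))) / sqrt (real m) * \<tau> powr (1 - real m * \<kappa>)"
proof -
  define Q where "Q = 954 * real K ^ (1 + K)"
  define N where "N = 2 * m + 1"
  define R where "R = \<tau> powr (- real m * \<kappa>)"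
  have Rt: "R * \<tau> = \<tau> powr (1 - real m * \<kappa>)"
    using tau powr_add[of \<tau> "- real m * \<kappa>" 1] by (simp add: R_def)
  have sq: "sqrt (c / real m * (R * w)\<^sup>2) = sqrt c / sqrt (real m) * (R * w)" if "0 \<le> w" for c w
    using that by (simp add: real_sqrt_mult real_sqrt_divide R_def)
  have "(\<Sum>j<n. sqrt (\<Sum>\<alpha>\<in>offdiag n m. slot_term j \<alpha>)) =
      sqrt (\<Sum>\<alpha>\<in>offdiag n m. slot_term i1 \<alpha>) +
      (\<Sum>j\<in>{..<n} - {i1}. sqrt (\<Sum>\<alpha>\<in>offdiag n m. slot_term j \<alpha>))"
    using i1 by (simp add: sum.remove)
  also have "\<dots> \<le> sqrt (36 / real m * (R * \<tau>)\<^sup>2) +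
      (\<Sum>j\<in>{..<n} - {i1}. sqrt (Q / real m * (R * tavg N n (\<lambda>z. cmod (slope j z)))\<^sup>2))"
    unfolding R_def Q_def using K
    by (intro add_mono sum_mono real_sqrt_le_mono sum_slot_term_i1 sum_slot_term_other)
      (auto simp: N_def)
  also have "\<dots> = sqrt 36 / sqrt (real m) * (R * \<tau>) +
      (\<Sum>j\<in>{..<n} - {i1}. sqrt Q / sqrt (real m) * (R * tavg N n (\<lambda>z. cmod (slope j z))))"
  proof -
    have "0 \<le> tavg N n (\<lambda>z. cmod (slope j z))" for j
      by (simp add: tavg_def sum_nonneg)
    then show ?thesis
      by (simp only: sq less_imp_le[OF tau(1)])
  qed
  also have "\<dots> = sqrt 36 / sqrt (real m) * (R * \<tau>) +
      sqrt Q / sqrt (real m) * R * (\<Sum>j\<in>{..<n} - {i1}. tavg N n (\<lambda>z. cmod (slope j z)))"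
    by (simp add: sum_distrib_left mult_ac)
  also have "\<dots> \<le> sqrt 36 / sqrt (real m) * (R * \<tau>) + sqrt Q / sqrt (real m) * R * (3 * \<tau>)"
    by (intro add_left_mono mult_left_mono sum_tavg_slope_le) (auto simp: N_def R_def Q_def)
  also have "sqrt 36 = (6::real)"
    by (rule real_sqrt_unique) auto
  also have "6 / sqrt (real m) * (R * \<tau>) + sqrt Q / sqrt (real m) * R * (3 * \<tau>) =
      (6 + 3 * sqrt Q) / sqrt (real m) * (R * \<tau>)"
    by (simp add: ring_distribs add_divide_distrib)
  finally show ?thesis by (simp add: Rt Q_def)
qed

end

subsection \<open>The Bombieri norm inequality\<close>

text \<open>The q-th power turns m^(-1/2) into at most 2/m, because q \<ge> 2m/(m+1) loses only
  m^(1/(m+1)) \<le> 2. It turns \<tau>^(1-m\<kappa>) into at most \<tau>, because q (1 - m\<kappa>)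
  \<ge> 1. As q \<le> 2, the constant is at most squared.\<close>

lemma offdiag_power_sum_le_of_ge:
  assumes K: "264 \<le> K" and m: "3 \<le> m" and j: "j < n"
    and kappa: "0 \<le> \<kappa>" "real m * \<kappa> \<le> 1 / 2"
    and q: "0 < q" "1 / q = 1 / 2 + (1 / 2 - real m * \<kappa>) / real m" "1 \<le> q * (1 - real m * \<kappa>)"
    and tau: "0 < \<tau>" "\<tau> \<le> 1" "1 - \<tau> \<le> cmod (b (diag_index m j))"
    and bounded: "kappa_bounded n m \<kappa> b"
  shows "(\<Sum>\<alpha>\<in>offdiag n m. (fact m / multi_fact n \<alpha>) powr (1 - q) * cmod (b \<alpha>) powr q) \<le>
    2 * (exp (1 / 2) * (6 + 3 * sqrt (954 * real K ^ (1 + K))))\<^sup>2 * \<tau> / real m"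
proof -
  let ?S = "\<Sum>\<alpha>\<in>offdiag n m. (fact m / multi_fact n \<alpha>) powr (1 - q) * cmod (b \<alpha>) powr q"
  define C where "C = exp (1 / 2) * (6 + 3 * sqrt (954 * real K ^ (1 + K)))"
  have n: "1 \<le> n" and m1: "1 \<le> m" using j m by auto
  have C: "1 \<le> C"
  proof -
    define R where "R = sqrt (954 * real K ^ (1 + K))"
    have "0 \<le> R"
      unfolding R_def by (intro real_sqrt_ge_zero mult_nonneg_nonneg) auto
    then have "1 * 1 \<le> exp (1 / 2 :: real) * (6 + 3 * R)"
      by (intro mult_mono) auto
    then show ?thesis unfolding C_def R_def[symmetric] by simp
  qed
  have S0: "0 \<le> ?S"
    by (intro sum_nonneg mult_nonneg_nonneg) auto
  obtain t :: "nat \<Rightarrow> real" where law: "\<And>i. 0 \<le> t i" "(\<Sum>i<n. t i) = 1"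
    "?S powr (1 / q) \<le> exp (1 / 2) * (\<Sum>j<n. sqrt (\<Sum>\<alpha>\<in>offdiag n m. slot_wt n m j \<alpha> *
        (multi_fact n \<alpha> / fact m) * (real (\<alpha> j) / real m) * (cmod (b \<alpha>))\<^sup>2 *
        (\<Prod>i<n. (t i powr \<kappa>) ^ (2 * \<alpha> i))))"
  proof (rule entropy_blei_inequality[OF n m1 _ q(1,2) kappa, where \<theta> = "slot_wt n m" and L = 1
        and b = b and I = "offdiag n m"])
    show "offdiag n m \<subseteq> multi_indices n m" by (auto simp: offdiag_def)
    show "0 < slot_wt n m j \<alpha>" for j \<alpha> using m by (auto simp: slot_wt_def)
    show "- 1 \<le> (\<Sum>j<n. real (\<alpha> j) / real m * ln (slot_wt n m j \<alpha>))" if "\<alpha> \<in> offdiag n m" for \<alpha>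
      using that by (intro sum_slot_wt_ge m) (auto simp: offdiag_def)
  qed (rule that; assumption)
  interpret near_monomial n m j \<kappa> \<tau> t b
    using m j kappa tau law bounded by unfold_locales
  have "?S powr (1 / q) \<le> exp (1 / 2) * (\<Sum>j<n. sqrt (\<Sum>\<alpha>\<in>offdiag n m. slot_term j \<alpha>))"
    using law(3) by (simp only: slot_term_def)
  also have "\<dots> \<le> exp (1 / 2) * ((6 + 3 * sqrt (954 * real K ^ (1 + K))) / sqrt (real m) *
      \<tau> powr (1 - real m * \<kappa>))"
    by (intro mult_left_mono sum_sqrt_slot_terms_le K) auto
  also have "\<dots> = C * real m powr (- 1 / 2) * \<tau> powr (1 - real m * \<kappa>)"
  proof -
    have "real m powr (- (1 / 2)) = inverse (real m powr (1 / 2))"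
      by (rule powr_minus)
    then have "real m powr (- 1 / 2) = 1 / sqrt (real m)"
      by (simp add: powr_half_sqrt inverse_eq_divide)
    then show ?thesis
      by (simp only: C_def times_divide_eq_left times_divide_eq_right mult_1_right mult.assoc)
  qed
  finally have le: "?S powr (1 / q) \<le> C * real m powr (- 1 / 2) * \<tau> powr (1 - real m * \<kappa>)" .
  have qinv: "1 / 2 \<le> 1 / q" "1 / q \<le> 1 / 2 + 1 / 2 / real m"
  proof -
    have "0 \<le> (1 / 2 - real m * \<kappa>) / real m"
      using kappa by (intro divide_nonneg_nonneg) auto
    moreover have "(1 / 2 - real m * \<kappa>) / real m \<le> 1 / 2 / real m"
      using kappa mult_nonneg_nonneg[of "real m" \<kappa>] by (intro divide_right_mono) auto
    ultimately show "1 / 2 \<le> 1 / q" "1 / q \<le> 1 / 2 + 1 / 2 / real m"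
      unfolding q(2) by linarith+
  qed
  have q2: "q \<le> 2"
    using qinv(1) q(1) by (simp add: field_simps)
  have qh: "1 - 1 / (real m + 1) \<le> q / 2"
  proof -
    have "1 / q \<le> (real m + 1) / (2 * real m)"
      using qinv(2) m by (simp add: field_simps)
    then have "2 * real m / (real m + 1) \<le> q"
      using q(1) m by (simp add: field_simps)
    moreover have "1 - 1 / (real m + 1) = real m / (real m + 1)"
      by (simp add: field_simps add_eq_0_iff)
    moreover have "2 * real m / (real m + 1) = 2 * (real m / (real m + 1))"
      by simp
    ultimately show ?thesis by linarith
  qed
  have "?S = (?S powr (1 / q)) powr q"
    using S0 q(1) by (simp add: powr_powr)
  also have "\<dots> \<le> (C * real m powr (- 1 / 2) * \<tau> powr (1 - real m * \<kappa>)) powr q"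
    using le q(1) by (intro powr_mono2) auto
  also have "\<dots> = C powr q * real m powr (- q / 2) * \<tau> powr (q * (1 - real m * \<kappa>))"
    using C m tau by (simp add: powr_mult powr_powr mult.commute)
  also have "\<dots> \<le> C\<^sup>2 * (2 / real m) * \<tau>"
  proof (intro mult_mono)
    have "C powr q \<le> C powr 2"
      using C q2 by (intro powr_mono) auto
    also have "\<dots> = C\<^sup>2" using C by simp
    finally show "C powr q \<le> C\<^sup>2" .
    have "real m powr (- q / 2) \<le> real m powr (1 / (real m + 1) - 1)"
      using qh m by (intro powr_mono) auto
    also have "\<dots> = real m powr (1 / (real m + 1)) * (1 / real m)"
      using m by (simp add: powr_diff)
    also have "\<dots> \<le> 2 * (1 / real m)"
    proof (intro mult_right_mono)
      have "real m \<le> 2 ^ (m + 1)"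
      proof -
        have "real m < 2 ^ m" "(2::real) ^ m \<le> 2 ^ (m + 1)"
          by simp_all
        then show ?thesis by linarith
      qed
      then have "real m powr (1 / (real m + 1)) \<le> (2 ^ (m + 1)) powr (1 / (real m + 1))"
        using m by (intro powr_mono2) auto
      also have "\<dots> = (2 powr (real m + 1)) powr (1 / (real m + 1))"
        using powr_realpow[of 2 "m + 1"] by (simp add: add.commute)
      also have "\<dots> = 2 powr ((real m + 1) * (1 / (real m + 1)))"
        by (rule powr_powr)
      also have "(real m + 1) * (1 / (real m + 1)) = 1"
        by (simp add: add_eq_0_iff)
      finally show "real m powr (1 / (real m + 1)) \<le> 2" by simp
    qed simp
    finally show "real m powr (- q / 2) \<le> 2 / real m" by simp
    have "\<tau> powr (q * (1 - real m * \<kappa>)) \<le> \<tau> powr 1"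
      using tau q(3) by (intro powr_mono') auto
    then show "\<tau> powr (q * (1 - real m * \<kappa>)) \<le> \<tau>" using tau by simp
  qed (use tau C in auto)
  finally show ?thesis by (simp add: C_def mult_ac)
qed

lemma offdiag_power_sum_le:
  assumes K: "264 \<le> K" and m: "3 \<le> m" and j: "j < n"
    and kappa: "0 \<le> \<kappa>" "real m * \<kappa> \<le> 1 / 2"
    and q: "0 < q" "1 / q = 1 / 2 + (1 / 2 - real m * \<kappa>) / real m" "1 \<le> q * (1 - real m * \<kappa>)"
    and le1: "cmod (b (diag_index m j)) \<le> 1"
    and bounded: "kappa_bounded n m \<kappa> b"
  shows "(\<Sum>\<alpha>\<in>offdiag n m. (fact m / multi_fact n \<alpha>) powr (1 - q) * cmod (b \<alpha>) powr q) \<le>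
    2 * (exp (1 / 2) * (6 + 3 * sqrt (954 * real K ^ (1 + K))))\<^sup>2 *
      (1 - cmod (b (diag_index m j))) / real m"
    (is "?S \<le> ?B * ?\<delta> / real m")
proof (rule field_le_epsilon)
  fix e :: real assume e: "0 < e"
  have B: "0 < ?B"
    by (intro mult_pos_pos zero_less_power add_pos_nonneg) auto
  \<comment> \<open>With zero deficit any positive \<tau> is admissible; this one keeps the bound
    below e.\<close>
  define \<tau> where "\<tau> = (if ?\<delta> = 0 then min 1 (e * real m / ?B) else ?\<delta>)"
  have tau: "0 < \<tau>" "\<tau> \<le> 1" "1 - \<tau> \<le> cmod (b (diag_index m j))"
    using e B m le1 by (auto simp: \<tau>_def)
  have "?S \<le> ?B * \<tau> / real m"
    by (rule offdiag_power_sum_le_of_ge[OF K m j kappa q tau bounded])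
  also have "\<dots> \<le> ?B * ?\<delta> / real m + e"
  proof (cases "?\<delta> = 0")
    case True
    then have "?B * \<tau> \<le> ?B * (e * real m / ?B)"
      using B by (intro mult_left_mono) (auto simp: \<tau>_def)
    also have "\<dots> = e * real m"
      using B by (metis less_irrefl nonzero_mult_div_cancel_left times_divide_eq_right)
    finally show ?thesis
      using True m by (simp only: divide_le_eq) simp
  next
    case False
    then show ?thesis using e by (simp add: \<tau>_def)
  qed
  finally show "?S \<le> ?B * ?\<delta> / real m + e" .
qed

text \<open>Duality: t_j proportional to d_j^s is the equality case of Holder's inequality, and m-th
  roots of the phases align the coefficients. On the grid of order m only exponents divisible by m
  survive, which in degree m are the diagonal ones, and the mean equals S^(1/s).\<close>

lemma sum_diag_powr_le_1:
  assumes m: "1 \<le> m" and kappa: "0 \<le> \<kappa>" "real m * \<kappa> \<le> 1 / 2"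
    and bounded: "kappa_bounded n m \<kappa> b"
  defines "s \<equiv> 1 / (1 - real m * \<kappa>)"
  shows "(\<Sum>j<n. cmod (b (diag_index m j)) powr s) \<le> 1"
proof -
  define d where "d = (\<lambda>j. cmod (b (diag_index m j)))"
  define S where "S = (\<Sum>j<n. d j powr s)"
  have S0: "0 \<le> S" by (simp add: S_def sum_nonneg)
  have s: "1 \<le> s" "1 + s * (real m * \<kappa>) = s" "1 / s = 1 - real m * \<kappa>"
    using kappa mult_nonneg_nonneg[of "real m" \<kappa>] by (auto simp: s_def field_simps)
  show ?thesis
  proof (cases "S = 0")
    case False
    with S0 have S: "0 < S" by simp
    have "\<forall>j. \<exists>u. cmod u = 1 \<and> u * b (diag_index m j) = of_real (d j)"
      unfolding d_def using ex_unimodular_mult_norm by metis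
    then obtain u where u: "\<And>j. cmod (u j) = 1" "\<And>j. u j * b (diag_index m j) = of_real (d j)"
      by metis
    have "\<forall>j. \<exists>w. w ^ m = u j"
    proof
      fix j
      have "u j \<noteq> 0" using u(1)[of j] by auto
      have "exp (Ln (u j) / of_nat m) ^ m = u j"
        using m \<open>u j \<noteq> 0\<close> by (simp add: exp_of_nat_mult[symmetric])
      then show "\<exists>w. w ^ m = u j" by blast
    qed
    then obtain w where w: "\<And>j. w j ^ m = u j" by metis
    have w1: "cmod (w j) = 1" for j
    proof -
      have "cmod (w j) ^ m = 1 ^ m"
        using w[of j] u(1)[of j] by (simp flip: norm_power)
      then show ?thesis
        using power_eq_imp_eq_base[of "cmod (w j)" m 1] m by simp
    qed
    define t where "t = (\<lambda>j. d j powr s / S)"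
    define y where "y = (\<lambda>j. of_real (t j powr \<kappa>) * w j)"
    have t: "\<forall>i<n. 0 \<le> t i" "(\<Sum>i<n. t i) \<le> 1"
      using S by (auto simp: t_def S_def sum_divide_distrib[symmetric])
    have pt: "cmod (hpoly n m b (\<lambda>i. y i * z i)) \<le> 1" if z: "\<And>i. cmod (z i) = 1" for z
    proof -
      have "cmod (hpoly n m b (\<lambda>i. y i * z i)) \<le> 1 powr (real m * \<kappa>)"
        using bounded t z w1 unfolding kappa_bounded_def
        by (intro bounded[unfolded kappa_bounded_def, rule_format, of t]) (auto simp: y_def norm_mult)
      then show ?thesis by simp
    qed
    have diag_set: "{\<alpha>\<in>multi_indices n m. \<forall>i<n. \<alpha> i mod m = 0} = diag_index m ` {..<n}"
    proof (intro equalityI subsetI)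
      fix \<alpha> assume "\<alpha> \<in> {\<alpha>\<in>multi_indices n m. \<forall>i<n. \<alpha> i mod m = 0}"
      then have \<alpha>: "\<alpha> \<in> multi_indices n m" "\<And>i. i < n \<Longrightarrow> \<alpha> i mod m = 0" by auto
      have "\<exists>j<n. \<alpha> j \<noteq> 0"
      proof (rule ccontr)
        assume "\<not> (\<exists>j<n. \<alpha> j \<noteq> 0)"
        then have "(\<Sum>i<n. \<alpha> i) = 0" by simp
        with \<alpha>(1) m show False by (simp add: multi_indices_def)
      qed
      then obtain j where j: "j < n" "\<alpha> j \<noteq> 0" by blast
      have "m dvd \<alpha> j" using \<alpha>(2)[OF j(1)] by auto
      then have "m \<le> \<alpha> j" using j by (intro dvd_imp_le) auto
      then have "\<alpha> j = m" using multi_index_le[OF \<alpha>(1) j(1)] by simp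
      then show "\<alpha> \<in> diag_index m ` {..<n}"
        using multi_index_eq_diag[OF \<alpha>(1) j(1)] j by auto
    qed (use diag_index_in in \<open>auto simp: diag_index_def\<close>)
    have m0: "0 < m" using m by simp
    have "tavg m n (\<lambda>z. hpoly n m b (\<lambda>i. y i * z i)) = tavg m n (\<lambda>z. \<Sum>\<alpha>\<in>multi_indices n m.
        (b \<alpha> * monom_at n y \<alpha>) * (monom_at n z \<alpha> * cnj (monom_at n z (\<lambda>_. 0))))"
      by (simp add: hpoly_monom_at monom_at_mult mult.assoc) (simp add: monom_at_def)
    also have "\<dots> = (\<Sum>\<alpha>\<in>multi_indices n m. if \<forall>i<n. \<alpha> i mod m = 0 then b \<alpha> * monom_at n y \<alpha> else 0)"
      unfolding tavg_sum tavg_cmult tavg_character[OF m0] by (intro sum.cong) auto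
    also have "\<dots> = (\<Sum>\<alpha>\<in>diag_index m ` {..<n}. b \<alpha> * monom_at n y \<alpha>)"
      unfolding diag_set[symmetric] by (rule sum.inter_filter[OF finite_multi_indices, symmetric])
    also have "\<dots> = (\<Sum>j<n. b (diag_index m j) * y j ^ m)"
      by (subst sum.reindex[OF inj_on_diag_index[OF m]]) (simp add: monom_at_diag_index)
    also have "\<dots> = (\<Sum>j<n. of_real (d j * (t j powr \<kappa>) ^ m))"
      using u by (intro sum.cong refl) (simp add: y_def power_mult_distrib w mult_ac)
    also have "\<dots> = (\<Sum>j<n. of_real (d j powr s * S powr (- (real m * \<kappa>))))"
    proof (intro sum.cong refl arg_cong[where f = of_real])
      fix j
      show "d j * (t j powr \<kappa>) ^ m = d j powr s * S powr (- (real m * \<kappa>))"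
      proof (cases "d j = 0")
        case False
        then have d: "0 < d j" by (simp add: d_def)
        then have tj: "0 < t j" using S by (simp add: t_def)
        have "(t j powr \<kappa>) ^ m = t j powr (real m * \<kappa>)"
          using tj by (simp add: powr_realpow[symmetric] powr_powr mult.commute)
        also have "\<dots> = d j powr (s * (real m * \<kappa>)) * S powr (- (real m * \<kappa>))"
          using S d by (simp add: t_def powr_divide powr_powr powr_minus_divide)
        finally have "d j * (t j powr \<kappa>) ^ m =
            d j powr (1 + s * (real m * \<kappa>)) * S powr (- (real m * \<kappa>))"
          using d by (simp add: powr_add)
        then show ?thesis by (simp only: s(2))
      qed simp
    qed
    also have "\<dots> = of_real (S * S powr (- (real m * \<kappa>)))"
      by (simp add: S_def sum_distrib_right)
    also have "S * S powr (- (real m * \<kappa>)) = S powr (1 / s)"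
      using S powr_add[of S 1 "- (real m * \<kappa>)"] by (simp add: s(3))
    finally have "S powr (1 / s) = cmod (tavg m n (\<lambda>z. hpoly n m b (\<lambda>i. y i * z i)))"
      by simp
    also have "\<dots> \<le> tavg m n (\<lambda>z. cmod (hpoly n m b (\<lambda>i. y i * z i)))"
      by (rule norm_tavg_le)
    also have "\<dots> \<le> tavg m n (\<lambda>z. 1)"
      by (intro tavg_mono pt norm_grid[OF m0])
    also have "\<dots> = 1" by (rule tavg_const[OF m0])
    finally have "S powr (1 / s) \<le> 1" .
    then have "(S powr (1 / s)) powr s \<le> 1 powr s"
      using s by (intro powr_mono2) auto
    then show ?thesis
      using S s(1) by (simp add: powr_powr S_def d_def)
  qed (simp add: S_def d_def)
qed

lemma powr_le_linear:
  fixes x a :: real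
  assumes "0 \<le> x" "0 \<le> a" "a \<le> 1"
  shows "x powr a \<le> 1 - a * (1 - x)"
proof (cases "x = 0")
  case True
  then show ?thesis using assms by simp
next
  case False
  then have x: "0 < x" using assms by simp
  have "exp ((1 - a) * 0 + a * ln x) \<le> (1 - a) * exp 0 + a * exp (ln x)"
    using convex_onD[OF exp_convex, of a 0 "ln x"] assms by simp
  then show ?thesis
    using x by (simp add: powr_def algebra_simps)
qed

lemma bombieri_power_sum_le_1:
  fixes K :: nat
  defines "B \<equiv> 2 * (exp (1 / 2) * (6 + 3 * sqrt (954 * real K ^ (1 + K))))\<^sup>2"
  assumes K: "264 \<le> K" and m: "3 \<le> m" "B \<le> real m" and n: "1 \<le> n"
    and kappa: "0 \<le> \<kappa>" "real m * \<kappa> \<le> 1 / 2"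
    and q: "0 < q" "1 / q = 1 / 2 + (1 / 2 - real m * \<kappa>) / real m"
    and gap: "1 + B / real m \<le> q * (1 - real m * \<kappa>)"
    and bounded: "kappa_bounded n m \<kappa> b"
  shows "(\<Sum>\<alpha>\<in>multi_indices n m. (fact m / multi_fact n \<alpha>) powr (1 - q) * cmod (b \<alpha>) powr q) \<le> 1"
proof -
  define F where "F = (\<lambda>\<alpha>. (fact m / multi_fact n \<alpha>) powr (1 - q) * cmod (b \<alpha>) powr q)"
  define d where "d = (\<lambda>j. cmod (b (diag_index m j)))"
  define s where "s = 1 / (1 - real m * \<kappa>)"
  have m1: "1 \<le> m" using m by simp
  have B: "0 \<le> B" by (simp add: B_def)
  have s: "1 \<le> s"
    using kappa mult_nonneg_nonneg[of "real m" \<kappa>] by (simp add: s_def field_simps)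
  have ds: "(\<Sum>j<n. d j powr s) \<le> 1"
    using sum_diag_powr_le_1[OF m1 kappa bounded] by (simp add: d_def s_def)
  have d1: "d j \<le> 1" if "j < n" for j
  proof (rule ccontr)
    assume "\<not> d j \<le> 1"
    then have "1 powr s < d j powr s"
      using s by (intro powr_less_mono2) auto
    also have "\<dots> \<le> (\<Sum>j<n. d j powr s)"
      using that by (intro member_le_sum) auto
    finally show False using ds by simp
  qed
  have "finite (d ` {..<n})" "d ` {..<n} \<noteq> {}"
    using n by (auto simp: lessThan_empty_iff)
  from Max_in[OF this] obtain j where j: "j < n" "d j = Max (d ` {..<n})"
    by auto
  have max: "d i \<le> d j" if "i < n" for i
    using that j by simp
  have dj: "0 \<le> d j" "d j \<le> 1"
    using d1[OF j(1)] by (auto simp: d_def)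
  have qs: "B / real m \<le> q - s"
  proof -
    have "B / real m * 1 \<le> B / real m * s"
      using s B by (intro mult_left_mono) auto
    also have "\<dots> \<le> (q * (1 - real m * \<kappa>) - 1) * s"
      using gap s by (intro mult_right_mono) auto
    also have "\<dots> = q * ((1 - real m * \<kappa>) * s) - s"
      by (simp add: algebra_simps)
    also have "(1 - real m * \<kappa>) * s = 1"
      using kappa by (simp add: s_def)
    finally show ?thesis by simp
  qed
  have qs0: "0 \<le> q - s"
    using B by (intro order_trans[OF _ qs]) simp
  have "(\<Sum>i<n. F (diag_index m i)) = (\<Sum>i<n. d i powr q)"
  proof (intro sum.cong refl)
    fix i assume i: "i \<in> {..<n}"
    have "multi_fact n (diag_index m i) = fact m"
      using i by (simp add: multi_fact_def diag_index_def if_distrib[of fact] cong: if_cong)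
    then show "F (diag_index m i) = d i powr q"
      by (simp add: F_def d_def)
  qed
  also have "\<dots> \<le> (\<Sum>i<n. d i powr s * d j powr (B / real m))"
  proof (rule sum_mono)
    fix i assume "i \<in> {..<n}"
    then have i: "d i \<le> d j" by (simp add: max)
    have "d i powr q = d i powr s * d i powr (q - s)"
      by (simp add: powr_add[symmetric])
    also have "d i powr (q - s) \<le> d j powr (q - s)"
      using i qs0 by (intro powr_mono2) (auto simp: d_def)
    also have "\<dots> \<le> d j powr (B / real m)"
      using qs dj by (intro powr_mono') auto
    finally show "d i powr q \<le> d i powr s * d j powr (B / real m)"
      by (simp add: mult_left_mono)
  qed
  also have "\<dots> = (\<Sum>i<n. d i powr s) * d j powr (B / real m)"
    by (simp add: sum_distrib_right)
  \<comment> \<open>Linearising d_j^(B/m) requires the exponent to be at most 1, hence B \<le>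
    m.\<close>
  also have "\<dots> \<le> 1 * (1 - B / real m * (1 - d j))"
    using m B by (intro mult_mono ds powr_le_linear dj) (auto simp: sum_nonneg)
  finally have diag: "(\<Sum>i<n. F (diag_index m i)) \<le> 1 - B * (1 - d j) / real m"
    by simp
  have "1 \<le> q * (1 - real m * \<kappa>)"
    using gap B by (smt (verit) divide_nonneg_nonneg of_nat_0_le_iff)
  then have off: "(\<Sum>\<alpha>\<in>offdiag n m. F \<alpha>) \<le> B * (1 - d j) / real m"
    unfolding F_def d_def B_def
    using offdiag_power_sum_le[OF K m(1) j(1) kappa q _ _ bounded] dj(2) by (simp add: d_def)
  have split: "multi_indices n m = diag_index m ` {..<n} \<union> offdiag n m"
  proof (intro equalityI subsetI)
    fix \<alpha> assume \<alpha>: "\<alpha> \<in> multi_indices n m"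
    show "\<alpha> \<in> diag_index m ` {..<n} \<union> offdiag n m"
    proof (cases "\<exists>i<n. \<alpha> i = m")
      case True
      then show ?thesis using multi_index_eq_diag[OF \<alpha>] by auto
    next
      case False
      then have "\<alpha> i < m" if "i < n" for i
        using multi_index_le[OF \<alpha> that] that by (metis order_le_less)
      then show ?thesis using \<alpha> by (simp add: offdiag_def)
    qed
  qed (use diag_index_in in \<open>auto simp: offdiag_def\<close>)
  have "finite (offdiag n m)"
    by (rule finite_subset[OF _ finite_multi_indices]) (auto simp: offdiag_def)
  moreover have "diag_index m ` {..<n} \<inter> offdiag n m = {}"
    by (auto simp: offdiag_def diag_index_def)
  ultimately have "(\<Sum>\<alpha>\<in>multi_indices n m. F \<alpha>) =
      (\<Sum>i<n. F (diag_index m i)) + (\<Sum>\<alpha>\<in>offdiag n m. F \<alpha>)"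
    unfolding split by (subst sum.union_disjoint) (auto simp: sum.reindex[OF inj_on_diag_index[OF m1]])
  then show ?thesis
    using diag off by (simp add: F_def)
qed

section \<open>Normalisation of the polynomial, and the exponents\<close>

lemma hpoly_scale: "hpoly n m b (\<lambda>i. c * z i) = c ^ m * hpoly n m b z"
proof -
  have "monom_at n (\<lambda>i. c * z i) \<alpha> = c ^ m * monom_at n z \<alpha>" if "\<alpha> \<in> multi_indices n m" for \<alpha>
    using that by (simp add: monom_at_mult) (simp add: monom_at_def power_sum[symmetric] multi_indices_def)
  then show ?thesis
    by (simp add: hpoly_monom_at sum_distrib_left mult_ac)
qed

lemma hpoly_le_poly_norm:
  assumes p: "0 < p" and n: "1 \<le> n" and z: "lp_norm n p z \<le> 1"
  shows "cmod (hpoly n m b z) \<le> poly_norm n m p b"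
  unfolding poly_norm_def
proof (rule cSup_upper)
  show "cmod (hpoly n m b z) \<in> {cmod (hpoly n m b z) |z. lp_norm n p z \<le> 1}"
    using z by auto
  show "bdd_above {cmod (hpoly n m b z) |z. lp_norm n p z \<le> 1}"
  proof (rule bdd_aboveI)
    fix x assume "x \<in> {cmod (hpoly n m b z) |z. lp_norm n p z \<le> 1}"
    then obtain z where z: "x = cmod (hpoly n m b z)" "lp_norm n p z \<le> 1" by auto
    have z1: "cmod (z i) \<le> 1" if i: "i < n" for i
    proof (cases "p = \<infinity>")
      case True
      then have "Max ((\<lambda>i. cmod (z i)) ` {..<n}) \<le> 1"
        using z by (simp add: lp_norm_def)
      moreover have "cmod (z i) \<le> Max ((\<lambda>i. cmod (z i)) ` {..<n})"
        using i by (intro Max_ge) auto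
      ultimately show ?thesis by simp
    next
      case False
      define r where "r = real_of_ereal p"
      have r: "0 < r"
        using False p by (cases p) (auto simp: r_def)
      have "(\<Sum>i<n. cmod (z i) powr r) powr (1 / r) \<le> 1"
        using z False by (simp add: lp_norm_def r_def)
      then have "((\<Sum>i<n. cmod (z i) powr r) powr (1 / r)) powr r \<le> 1 powr r"
        using r by (intro powr_mono2) auto
      then have "(\<Sum>i<n. cmod (z i) powr r) \<le> 1"
        using r by (simp add: powr_powr sum_nonneg)
      moreover have "cmod (z i) powr r \<le> (\<Sum>i<n. cmod (z i) powr r)"
        using i by (intro member_le_sum) auto
      ultimately have "cmod (z i) powr r \<le> 1" by simp
      then have "\<not> 1 powr r < cmod (z i) powr r" by simp
      then show ?thesis
        using r powr_less_mono2[of r 1 "cmod (z i)"] by fastforce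
    qed
    have "x \<le> (\<Sum>\<alpha>\<in>multi_indices n m. cmod (b \<alpha> * monom_at n z \<alpha>))"
      unfolding z(1) hpoly_monom_at by (rule norm_sum)
    also have "\<dots> \<le> (\<Sum>\<alpha>\<in>multi_indices n m. cmod (b \<alpha>))"
    proof (rule sum_mono)
      fix \<alpha>
      have "cmod (monom_at n z \<alpha>) \<le> (\<Prod>i<n. 1)"
        unfolding monom_at_def prod_norm[symmetric] norm_power
        using z1 by (intro prod_mono) (auto intro: power_le_one)
      then show "cmod (b \<alpha> * monom_at n z \<alpha>) \<le> cmod (b \<alpha>)"
        by (simp add: norm_mult mult_left_le)
    qed
    finally show "x \<le> (\<Sum>\<alpha>\<in>multi_indices n m. cmod (b \<alpha>))" .
  qed
qed

text \<open>For finite p, dividing z by T^(1/p) puts it into the unit ball, and homogeneity returns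
  the factor T^(m/p). For p = \<infinity> the point is already in the polydisc.\<close>

lemma kappa_bounded_scaled:
  assumes m: "1 \<le> m" and n: "1 \<le> n" and p: "ereal (2 * real m) \<le> p"
    and c: "poly_norm n m p b \<le> c" "0 < c"
  shows "kappa_bounded n m (if p = \<infinity> then 0 else 1 / real_of_ereal p) (\<lambda>\<alpha>. b \<alpha> / of_real c)"
  unfolding kappa_bounded_def
proof (intro allI impI, elim conjE)
  fix t T z
  assume t: "\<forall>i<n. 0 \<le> t i" "(\<Sum>i<n. t i) \<le> T" "0 < T"
    and z: "\<forall>i<n. cmod (z i) \<le> t i powr (if p = \<infinity> then 0 else 1 / real_of_ereal p)"
  have p0: "0 < p"
    using p m by (intro less_le_trans[OF _ p]) simp
  have scaled: "cmod (hpoly n m (\<lambda>\<alpha>. b \<alpha> / of_real c) w) = cmod (hpoly n m b w) / c" for w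
    using c by (simp add: hpoly_def sum_divide_distrib[symmetric] norm_divide)
  show "cmod (hpoly n m (\<lambda>\<alpha>. b \<alpha> / of_real c) z) \<le>
      T powr (real m * (if p = \<infinity> then 0 else 1 / real_of_ereal p))"
  proof (cases "p = \<infinity>")
    case True
    have "cmod (z i) \<le> 1" if "i < n" for i
    proof -
      have "cmod (z i) \<le> t i powr 0" using z that True by simp
      also have "\<dots> \<le> 1" by simp
      finally show ?thesis .
    qed
    then have "lp_norm n p z \<le> 1"
      using n True by (auto simp: lp_norm_def lessThan_empty_iff)
    from hpoly_le_poly_norm[OF p0 n this, of m b] have "cmod (hpoly n m b z) \<le> c"
      using c by simp
    then show ?thesis
      using c t True by (simp add: scaled)
  next
    case False
    define r where "r = real_of_ereal p"
    have r: "0 < r"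
      using False p0 by (cases p) (auto simp: r_def)
    define l where "l = T powr (1 / r)"
    have l: "0 < l" using t by (simp add: l_def)
    define w where "w = (\<lambda>i. of_real (1 / l) * z i)"
    have "(\<Sum>i<n. cmod (w i) powr r) \<le> (\<Sum>i<n. t i / T)"
    proof (rule sum_mono)
      fix i assume i: "i \<in> {..<n}"
      have "cmod (w i) powr r = cmod (z i) powr r / l powr r"
        using l by (simp add: w_def norm_mult norm_divide powr_divide)
      also have "l powr r = T"
        using t r by (simp add: l_def powr_powr)
      also have "cmod (z i) powr r \<le> (t i powr (1 / r)) powr r"
        using z i r False by (intro powr_mono2) (auto simp: r_def)
      also have "\<dots> = t i"
        using t i r by (simp add: powr_powr)
      finally show "cmod (w i) powr r \<le> t i / T"
        using t by (simp add: divide_right_mono)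
    qed
    also have "\<dots> \<le> 1"
      using t by (simp add: sum_divide_distrib[symmetric])
    finally have "(\<Sum>i<n. cmod (w i) powr r) powr (1 / r) \<le> 1 powr (1 / r)"
      using r by (intro powr_mono2) (auto simp: sum_nonneg)
    then have "lp_norm n p w \<le> 1"
      using False by (simp add: lp_norm_def r_def)
    from hpoly_le_poly_norm[OF p0 n this, of m b] have "cmod (hpoly n m b w) \<le> c"
      using c by simp
    moreover have "hpoly n m b z = of_real l ^ m * hpoly n m b w"
      using l by (simp add: hpoly_scale[symmetric] w_def)
    ultimately have "cmod (hpoly n m b z) \<le> l ^ m * c"
      using l by (simp add: norm_mult norm_power)
    also have "l ^ m = T powr (real m * (1 / r))"
      using t by (simp add: l_def powr_realpow[symmetric] powr_powr)
    finally show ?thesis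
      using c False by (simp add: scaled r_def divide_le_eq)
  qed
qed

lemma bombieri_norm_scale:
  assumes "0 < q" "0 < c"
  shows "bombieri_norm n m q b = c * bombieri_norm n m q (\<lambda>\<alpha>. b \<alpha> / of_real c)"
proof -
  let ?S = "\<Sum>\<alpha>\<in>multi_indices n m. (fact m / multi_fact n \<alpha>) powr (1 - q) * cmod (b \<alpha> / of_real c) powr q"
  have S: "0 \<le> ?S" by (intro sum_nonneg mult_nonneg_nonneg) auto
  have "(\<Sum>\<alpha>\<in>multi_indices n m. (fact m / multi_fact n \<alpha>) powr (1 - q) * cmod (b \<alpha>) powr q) =
      c powr q * ?S"
    unfolding sum_distrib_left using assms
    by (intro sum.cong refl) (simp add: norm_divide powr_divide)
  then have "bombieri_norm n m q b = (c powr q * ?S) powr (1 / q)"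
    by (simp add: bombieri_norm_def)
  also have "\<dots> = c * ?S powr (1 / q)"
    using assms S by (simp add: powr_mult powr_powr)
  finally show ?thesis by (simp add: bombieri_norm_def)
qed

text \<open>In terms of \<kappa> = 1/p the reciprocals of q and s are affine, with 1/s = 1 -
  m\<kappa>, and p = \<infinity> is just \<kappa> = 0.\<close>

lemma exponents_kappa:
  fixes p :: ereal
  assumes m: "1 \<le> m" and p: "ereal (2 * real m) \<le> p"
  defines "\<kappa> \<equiv> if p = \<infinity> then 0 else 1 / real_of_ereal p"
  shows "0 \<le> \<kappa>" "real m * \<kappa> \<le> 1 / 2" "0 < q_exp m p"
    "1 / q_exp m p = 1 / 2 + (1 / 2 - real m * \<kappa>) / real m"
    "q_exp m p * (1 - real m * \<kappa>) = 1 + beta_exp m p"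
proof -
  have "0 \<le> \<kappa> \<and> real m * \<kappa> \<le> 1 / 2 \<and> 0 < q_exp m p \<and>
    1 / q_exp m p = 1 / 2 + (1 / 2 - real m * \<kappa>) / real m \<and>
    q_exp m p * (1 - real m * \<kappa>) = 1 + beta_exp m p"
  proof (cases "p = \<infinity>")
    case True
    then show ?thesis
      using m by (simp add: \<kappa>_def q_exp_def beta_exp_def s_exp_def field_simps)
  next
    case False
    then obtain r where pr: "p = ereal r"
      using p by (cases p) auto
    have r: "2 * real m \<le> r" "0 < r"
      using p m unfolding pr by auto
    have mr: "real m * r > 0" using m r by simp
    have "real m * r + r - 2 * real m > 0" "r - real m > 0"
      using r mr m by linarith+
    then show ?thesis
      using m r mr by (auto simp: \<kappa>_def pr q_exp_def beta_exp_def s_exp_def field_simps)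
  qed
  then show "0 \<le> \<kappa>" "real m * \<kappa> \<le> 1 / 2" "0 < q_exp m p"
    "1 / q_exp m p = 1 / 2 + (1 / 2 - real m * \<kappa>) / real m"
    "q_exp m p * (1 - real m * \<kappa>) = 1 + beta_exp m p"
    by auto
qed

text \<open>With u = p - 2m one has \<beta> = (m-1) u / ((m+1) u + 2m^2). The first term of the
  denominator calls for m \<ge> 8B and the second for u \<ge> 8B; each then uses up a quarter of m^2
  u, and m^2 u / 2 \<le> (m-1) m u.\<close>

lemma beta_exp_ge:
  fixes p :: ereal
  assumes B: "0 < B" and m: "2 \<le> m" "8 * B \<le> real m" and p: "ereal (2 * real m + 8 * B) \<le> p"
  shows "B / real m \<le> beta_exp m p"
proof (cases "p = \<infinity>")
  case True
  have beta: "beta_exp m p = (real m - 1) / (real m + 1)"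
    using True by (simp add: beta_exp_def q_exp_def s_exp_def field_simps)
  have "B / real m \<le> 1 / 8"
    using m by (simp add: divide_le_eq)
  also have "\<dots> \<le> (real m - 1) / (real m + 1)"
    using m by (simp add: field_simps)
  finally show ?thesis by (simp add: beta)
next
  case False
  then obtain r where pr: "p = ereal r"
    using p by (cases p) auto
  define u where "u = r - 2 * real m"
  have u: "8 * B \<le> u" using p by (simp add: pr u_def)
  have r: "r = u + 2 * real m" by (simp add: u_def)
  define D where "D = (real m + 1) * u + 2 * (real m)\<^sup>2"
  have D: "0 < D" "real m * r + r - 2 * real m = D"
    using u B m by (auto simp: D_def r power2_eq_square algebra_simps intro!: add_nonneg_pos)
  have beta: "beta_exp m p = (real m - 1) * u / D"
  proof -
    have "r - real m > 0" "r > 0" using u B by (auto simp: r add_pos_nonneg)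
    then have "q_exp m p / s_exp m p = 2 * real m * (r - real m) / D"
      using D by (simp add: q_exp_def s_exp_def pr field_simps)
    also have "\<dots> - 1 = (2 * real m * (r - real m) - D) / D"
      using D by (simp add: diff_divide_distrib)
    also have "2 * real m * (r - real m) - D = (real m - 1) * u"
      by (simp add: D_def r power2_eq_square algebra_simps)
    finally show ?thesis by (simp add: beta_exp_def)
  qed
  have "B * ((real m + 1) * u) \<le> real m / 8 * (2 * real m * u)"
    using m u B by (intro mult_mono mult_right_mono) auto
  moreover have "B * (2 * (real m)\<^sup>2) \<le> u / 8 * (2 * (real m)\<^sup>2)"
    using u by (intro mult_right_mono) auto
  moreover have "real m / 2 * (real m * u) \<le> (real m - 1) * (real m * u)"
    using m u B by (intro mult_right_mono mult_nonneg_nonneg) auto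
  ultimately have "B * D \<le> (real m - 1) * u * real m"
    by (simp add: D_def power2_eq_square algebra_simps)
  then show ?thesis
    using D m by (simp add: beta divide_le_eq pos_le_divide_eq)
qed

theorem theorem3:
  "\<exists>(A::real) (B::real) (m0::nat). A > 0 \<and> B > 0 \<and> m0 \<ge> 1 \<and>
     (\<forall>(m::nat) (n::nat) (p::ereal).
        m \<ge> m0 \<and> n \<ge> 1 \<and> ereal (2 * real m) \<le> p \<and> beta_exp m p \<ge> B / real m \<longrightarrow>
        (\<forall>b :: (nat \<Rightarrow> nat) \<Rightarrow> complex.
           bombieri_norm n m (q_exp m p) b \<le> poly_norm n m p b)) \<and>
     (\<forall>(m::nat) (n::nat) (p::ereal).
        m \<ge> m0 \<and> n \<ge> 1 \<and> ereal (2 * real m + A) \<le> p \<longrightarrow>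
        (\<forall>b :: (nat \<Rightarrow> nat) \<Rightarrow> complex.
           bombieri_norm n m (q_exp m p) b \<le> poly_norm n m p b))"
proof -
  \<comment> \<open>A generic K keeps \<open>K ^ (1 + K)\<close> symbolic instead of an enormous
    numeral.\<close>
  obtain K :: nat where K: "264 \<le> K"
    using le_refl by blast
  define B where "B = 2 * (exp (1 / 2) * (6 + 3 * sqrt (954 * real K ^ (1 + K))))\<^sup>2"
  have B: "0 < B"
    unfolding B_def by (intro mult_pos_pos zero_less_power add_pos_nonneg) auto
  \<comment> \<open>Large enough for m \<ge> 3, for B/m \<le> 1 on the diagonal, and for 8B \<le> m
    in the bound on \<beta>.\<close>
  define m0 where "m0 = nat \<lceil>8 * B\<rceil> + 3"
  have m0: "3 \<le> m" "8 * B \<le> real m" if "m0 \<le> m" for m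
    using that by (auto simp: m0_def) linarith
  have main: "bombieri_norm n m (q_exp m p) b \<le> poly_norm n m p b"
    if m: "m0 \<le> m" and n: "1 \<le> n" and p: "ereal (2 * real m) \<le> p"
      and beta: "B / real m \<le> beta_exp m p" for m n p b
  proof (rule field_le_epsilon)
    fix e :: real assume e: "0 < e"
    define \<kappa> where "\<kappa> = (if p = \<infinity> then 0 else 1 / real_of_ereal p)"
    \<comment> \<open>The sup-norm may be 0, so the polynomial is divided by the norm plus e, with e
      arbitrary.\<close>
    define c where "c = poly_norm n m p b + e"
    have m3: "3 \<le> m" "B \<le> real m" and m1: "1 \<le> m"
      using m0[OF m] B by auto
    have p0: "0 < p"
      using p m1 by (intro less_le_trans[OF _ p]) simp
    have "lp_norm n p (\<lambda>_. 0) \<le> 1"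
      using n by (auto simp: lp_norm_def lessThan_empty_iff)
    from hpoly_le_poly_norm[OF p0 n this, of m b] have "0 \<le> poly_norm n m p b"
      by (rule order_trans[rotated]) simp
    then have c: "poly_norm n m p b \<le> c" "0 < c"
      using e by (auto simp: c_def)
    note ex = exponents_kappa[OF m1 p, folded \<kappa>_def]
    have "(\<Sum>\<alpha>\<in>multi_indices n m. (fact m / multi_fact n \<alpha>) powr (1 - q_exp m p) *
        cmod (b \<alpha> / of_real c) powr q_exp m p) \<le> 1"
      using beta m3 kappa_bounded_scaled[OF m1 n p c, folded \<kappa>_def] unfolding B_def
      by (intro bombieri_power_sum_le_1[OF K _ _ n ex(1-4)]) (simp_all add: ex(5))
    then have "bombieri_norm n m (q_exp m p) (\<lambda>\<alpha>. b \<alpha> / of_real c) \<le> 1 powr (1 / q_exp m p)"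
      unfolding bombieri_norm_def using ex(3)
      by (intro powr_mono2) (auto intro!: sum_nonneg mult_nonneg_nonneg)
    then show "bombieri_norm n m (q_exp m p) b \<le> poly_norm n m p b + e"
      using c bombieri_norm_scale[OF ex(3) c(2), of n m b] by (simp add: c_def)
  qed
  have second: "bombieri_norm n m (q_exp m p) b \<le> poly_norm n m p b"
    if m: "m0 \<le> m" and n: "1 \<le> n" and p: "ereal (2 * real m + 8 * B) \<le> p" for m n p b
  proof (rule main[OF m n])
    show "ereal (2 * real m) \<le> p"
      using B by (intro order_trans[OF _ p]) simp
    show "B / real m \<le> beta_exp m p"
      using m0[OF m] by (intro beta_exp_ge B p) auto
  qed
  show ?thesis
  proof (rule exI[of _ "8 * B"], rule exI[of _ B], rule exI[of _ m0], intro conjI allI impI)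
    show "0 < 8 * B" "0 < B" "1 \<le> m0" using B by (auto simp: m0_def)
  next
    fix m n :: nat and p b
    assume "m0 \<le> m \<and> 1 \<le> n \<and> ereal (2 * real m) \<le> p \<and> B / real m \<le> beta_exp m p"
    then show "bombieri_norm n m (q_exp m p) b \<le> poly_norm n m p b"
      by (intro main) auto
  next
    fix m n :: nat and p b
    assume "m0 \<le> m \<and> 1 \<le> n \<and> ereal (2 * real m + 8 * B) \<le> p"
    then show "bombieri_norm n m (q_exp m p) b \<le> poly_norm n m p b"
      by (intro second) auto
  qed
qed

end
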